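(* Let $1\le n\le3$, $p,q>0$ and $\alpha,\beta\in[1,\infty)$. Assume that $u_0=v_0=0$ and that $u_1,v_1\in L^1\cap H^1$ satisfy $$M_u:=\int_{\mathbb R^n}u_1(x)\,dx>0,\qquad M_v:=\int_{\mathbb R^n}v_1(x)\,dx>0 .$$ If $$\min\{p+\alpha,q+\beta\}<1+\frac2n,$$ then there is no global (in time) mild solution of the Cauchy problem $$\begin{cases} u_{tt}-\Delta u+u_t=|u|^{\alpha}|v|^{p}, & x\in\mathbb R^n,\ t>0,\\ v_{tt}-\Delta v+v_t=|u|^{q}|v|^{\beta}, & x\in\mathbb R^n,\ t>0,\\ (u,u_t,v,v_t)(0,x)=(u_0,u_1,v_0,v_1)(x), & x\in\mathbb R^n.\end{cases}$$
   Context: All functions are real-valued and all function spaces are over $\mathbb R^n$. Kernel: $\mathcal K(t,x)$ is defined by its spatial Fourier transform, $\widehat{\mathcal K}(t,\xi)=\dfrac{e^{-t/2}\sinh\left(t\sqrt{1/4-|\xi|^2}\right)}{\sqrt{1/4-|\xi|^2}}$ if $|\xi|<1/2$, $\widehat{\mathcal K}(t,\xi)=\dfrac{e^{-t/2}\sin\left(t\sqrt{|\xi|^2-1/4}\right)}{\sqrt{|\xi|^2-1/4}}$ if $|\xi|>1/2$, and $\widehat{\mathcal K}(t,\xi)=te^{-t/2}$ if $|\xi|=1/2$; convolution $\ast_x$ with $\mathcal K(t,\cdot)$ (resp. $\partial_t\mathcal K(t,\cdot)$) is the Fourier multiplier with symbol $\widehat{\mathcal K}(t,\xi)$ (resp.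 $\partial_t\widehat{\mathcal K}(t,\xi)$). For $w\in\{u,v\}$ put $w^{\rm lin}(t,x)=(\mathcal K(t,x)+\partial_t\mathcal K(t,x))\ast_x w_0(x)+\mathcal K(t,x)\ast_x w_1(x)$. Mild solution: let $T\in(0,\infty]$. A pair $(u,v)\in(\mathcal C([0,T);L^2))^2$ is a (local in time) mild solution if $F_u:=|u|^\alpha|v|^p$ and $F_v:=|u|^q|v|^\beta$ belong to $L^1_{\rm loc}([0,T);L^2)$ and $$u(t,x)=u^{\rm lin}(t,x)+\int_0^t\mathcal K(t-s,x)\ast_x F_u(s,x)\,ds,\qquad v(t,x)=v^{\rm lin}(t,x)+\int_0^t\mathcal K(t-s,x)\ast_x F_v(s,x)\,ds .$$ If $T=\infty$, the mild solution is called global (in time). *)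

theory Defs
  imports "HOL-Analysis.Analysis"
begin

text \<open>Elements of \<open>L\<^sup>2\<close> are represented by functions; equality in \<open>L\<^sup>2\<close> is
  equality almost everywhere.\<close>

definition L2 :: "('a::euclidean_space \<Rightarrow> 'b::{banach, second_countable_topology}) set" where
  "L2 = {f \<in> borel_measurable lebesgue. integrable lebesgue (\<lambda>x. (norm (f x))\<^sup>2)}"

definition L2_norm :: "('a::euclidean_space \<Rightarrow> 'b::{banach, second_countable_topology}) \<Rightarrow> real" where
  "L2_norm f = sqrt (\<integral>x. (norm (f x))\<^sup>2 \<partial>lebesgue)"

text \<open>Membership in \<open>L\<^sup>2\<close> is demanded explicitly because \<open>L2_norm\<close> is \<open>0\<close> on functions that
  are not square integrable.\<close>

definition tendsto_L2 ::
  "('i \<Rightarrow> 'a::euclidean_space \<Rightarrow> 'b::{banach, second_countable_topology}) \<Rightarrow> ('a \<Rightarrow> 'b) \<Rightarrow> 'i filter \<Rightarrow> bool" where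
  "tendsto_L2 X f Fl \<longleftrightarrow>
     f \<in> L2 \<and> (\<forall>\<^sub>F i in Fl. X i \<in> L2) \<and> ((\<lambda>i. L2_norm (\<lambda>x. X i x - f x)) \<longlongrightarrow> 0) Fl"


subsection \<open>Bochner integral of \<open>L\<^sup>2\<close>-valued functions\<close>

text \<open>These definitions follow \<open>simple_bochner_integrable\<close>, \<open>simple_bochner_integral\<close> and
  \<open>has_bochner_integral\<close>, which are not applicable because there is no type of \<open>L\<^sup>2\<close> classes.
  The almost everywhere convergence in \<open>L2_approx\<close> is strong measurability of \<open>F\<close>; it also makes
  the integrand of the lower integral \<open>nn_integral\<close> measurable, up to null sets.\<close>

definition L2_simple :: "'t measure \<Rightarrow> ('t \<Rightarrow> 'a::euclidean_space \<Rightarrow> real) \<Rightarrow> bool" where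
  "L2_simple M s \<longleftrightarrow> simple_function M s \<and> s ` space M \<subseteq> L2 \<and>
     emeasure M {t \<in> space M. s t \<noteq> (\<lambda>x. 0)} \<noteq> \<infinity>"

definition L2_simple_integral :: "'t measure \<Rightarrow> ('t \<Rightarrow> 'a \<Rightarrow> real) \<Rightarrow> 'a \<Rightarrow> real" where
  "L2_simple_integral M s x = (\<Sum>g \<in> s ` space M. measure M {t \<in> space M. s t = g} * g x)"

definition L2_approx ::
  "'t measure \<Rightarrow> ('t \<Rightarrow> 'a::euclidean_space \<Rightarrow> real) \<Rightarrow> (nat \<Rightarrow> 't \<Rightarrow> 'a \<Rightarrow> real) \<Rightarrow> bool" where
  "L2_approx M F s \<longleftrightarrow>
     (\<forall>i. L2_simple M (s i)) \<and>
     (AE t in M. tendsto_L2 (\<lambda>i. s i t) (F t) sequentially) \<and>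
     (\<lambda>i. \<integral>\<^sup>+t. ennreal (L2_norm (\<lambda>x. F t x - s i t x)) \<partial>M) \<longlonglongrightarrow> 0"

definition L2_integrable :: "'t measure \<Rightarrow> ('t \<Rightarrow> 'a::euclidean_space \<Rightarrow> real) \<Rightarrow> bool" where
  "L2_integrable M F \<longleftrightarrow> (\<exists>s. L2_approx M F s)"

definition has_L2_integral ::
  "'t measure \<Rightarrow> ('t \<Rightarrow> 'a::euclidean_space \<Rightarrow> real) \<Rightarrow> ('a \<Rightarrow> real) \<Rightarrow> bool" where
  "has_L2_integral M F I \<longleftrightarrow>
     (\<exists>s. L2_approx M F s \<and> tendsto_L2 (\<lambda>i. L2_simple_integral M (s i)) I sequentially)"


subsection \<open>Time-dependent function spaces on \<open>[0,T)\<close>\<close>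

definition time_interval :: "ereal \<Rightarrow> real set" where
  "time_interval T = {t. 0 \<le> t \<and> ereal t < T}"

definition C_L2 :: "ereal \<Rightarrow> (real \<Rightarrow> 'a::euclidean_space \<Rightarrow> real) set" where
  "C_L2 T = {w. \<forall>t \<in> time_interval T. w t \<in> L2 \<and> tendsto_L2 w (w t) (at t within time_interval T)}"

definition L1loc_L2 :: "ereal \<Rightarrow> (real \<Rightarrow> 'a::euclidean_space \<Rightarrow> real) set" where
  "L1loc_L2 T = {F. \<forall>\<tau> \<in> time_interval T. L2_integrable (lebesgue_on {0..\<tau>}) F}"


subsection \<open>Fourier transform, \<open>H\<^sup>1\<close> and Fourier multipliers\<close>

text \<open>\<open>F\<close> is the Plancherel transform of \<open>f\<close>: the \<open>L\<^sup>2\<close> limit of the transforms of the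
  truncations of \<open>f\<close> to balls.  With the phase \<open>x \<bullet> \<xi>\<close> (no factor \<open>2\<pi>\<close>), \<open>-\<Delta>\<close> has symbol
  \<open>\<bar>\<xi>\<bar>\<^sup>2\<close>.\<close>

definition has_fourier ::
  "('a::euclidean_space \<Rightarrow> complex) \<Rightarrow> ('a \<Rightarrow> complex) \<Rightarrow> bool" where
  "has_fourier f F \<longleftrightarrow> f \<in> L2 \<and>
     tendsto_L2 (\<lambda>R \<xi>. LINT x:cball 0 R|lebesgue. cis (- (x \<bullet> \<xi>)) * f x) F at_top"

definition H1 :: "('a::euclidean_space \<Rightarrow> real) set" where
  "H1 = {f \<in> L2. \<exists>F. has_fourier (\<lambda>x. complex_of_real (f x)) F \<and>
           integrable lebesgue (\<lambda>\<xi>. (1 + (norm \<xi>)\<^sup>2) * (norm (F \<xi>))\<^sup>2)}"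

text \<open>\<open>g\<close> is the image of \<open>f\<close> under the Fourier multiplier with symbol \<open>m\<close>.\<close>

definition fourier_multiplier ::
  "('a::euclidean_space \<Rightarrow> real) \<Rightarrow> ('a \<Rightarrow> real) \<Rightarrow> ('a \<Rightarrow> real) \<Rightarrow> bool" where
  "fourier_multiplier m f g \<longleftrightarrow> f \<in> L2 \<and> g \<in> L2 \<and>
     (\<exists>F. has_fourier (\<lambda>x. complex_of_real (f x)) F \<and>
          has_fourier (\<lambda>x. complex_of_real (g x)) (\<lambda>\<xi>. complex_of_real (m \<xi>) * F \<xi>))"


subsection \<open>Mild solutions\<close>

definition K_hat :: "real \<Rightarrow> 'a::euclidean_space \<Rightarrow> real" where
  "K_hat t \<xi> =
     (if norm \<xi> < 1/2 then
        exp (- t/2) * sinh (t * sqrt (1/4 - (norm \<xi>)\<^sup>2)) / sqrt (1/4 - (norm \<xi>)\<^sup>2)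
      else if norm \<xi> > 1/2 then
        exp (- t/2) * sin (t * sqrt ((norm \<xi>)\<^sup>2 - 1/4)) / sqrt ((norm \<xi>)\<^sup>2 - 1/4)
      else t * exp (- t/2))"

definition dt_K_hat :: "real \<Rightarrow> 'a::euclidean_space \<Rightarrow> real" where
  "dt_K_hat t \<xi> = deriv (\<lambda>\<tau>. K_hat \<tau> \<xi>) t"

definition linear_solution ::
  "('a::euclidean_space \<Rightarrow> real) \<Rightarrow> ('a \<Rightarrow> real) \<Rightarrow> real \<Rightarrow> ('a \<Rightarrow> real) \<Rightarrow> bool" where
  "linear_solution w0 w1 t w \<longleftrightarrow>
     (\<exists>a b. fourier_multiplier (\<lambda>\<xi>. K_hat t \<xi> + dt_K_hat t \<xi>) w0 a \<and>
            fourier_multiplier (K_hat t) w1 b \<and>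
            (AE x in lebesgue. w x = a x + b x))"

text \<open>In the Duhamel term, \<open>G s\<close> is the convolution of \<open>F s\<close> with the kernel at time \<open>t - s\<close>.
  It is only required for almost every \<open>s\<close>, since a function in \<open>L\<^sup>1\<^sub>l\<^sub>o\<^sub>c([0,T);L\<^sup>2)\<close> takes values
  in \<open>L\<^sup>2\<close> only for almost every time.\<close>

definition duhamel_solution ::
  "('a::euclidean_space \<Rightarrow> real) \<Rightarrow> ('a \<Rightarrow> real) \<Rightarrow> (real \<Rightarrow> 'a \<Rightarrow> real) \<Rightarrow> real \<Rightarrow> ('a \<Rightarrow> real) \<Rightarrow> bool" where
  "duhamel_solution w0 w1 F t w \<longleftrightarrow>
     (\<exists>l G I. linear_solution w0 w1 t l \<and>
        (AE s in lebesgue_on {0..t}. fourier_multiplier (K_hat (t - s)) (F s) (G s)) \<and>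
        has_L2_integral (lebesgue_on {0..t}) G I \<and>
        (AE x in lebesgue. w x = l x + I x))"

definition power_nonlinearity ::
  "real \<Rightarrow> real \<Rightarrow> (real \<Rightarrow> 'a \<Rightarrow> real) \<Rightarrow> (real \<Rightarrow> 'a \<Rightarrow> real) \<Rightarrow> real \<Rightarrow> 'a \<Rightarrow> real" where
  "power_nonlinearity a b u v t x = \<bar>u t x\<bar> powr a * \<bar>v t x\<bar> powr b"

definition mild_solution ::
  "real \<Rightarrow> real \<Rightarrow> real \<Rightarrow> real \<Rightarrow>
   ('a::euclidean_space \<Rightarrow> real) \<Rightarrow> ('a \<Rightarrow> real) \<Rightarrow> ('a \<Rightarrow> real) \<Rightarrow> ('a \<Rightarrow> real) \<Rightarrow>
   ereal \<Rightarrow> (real \<Rightarrow> 'a \<Rightarrow> real) \<Rightarrow> (real \<Rightarrow> 'a \<Rightarrow> real) \<Rightarrow> bool" where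
  "mild_solution \<alpha> p q \<beta> u0 u1 v0 v1 T u v \<longleftrightarrow>
     0 < T \<and> u \<in> C_L2 T \<and> v \<in> C_L2 T \<and>
     power_nonlinearity \<alpha> p u v \<in> L1loc_L2 T \<and>
     power_nonlinearity q \<beta> u v \<in> L1loc_L2 T \<and>
     (\<forall>t \<in> time_interval T.
        duhamel_solution u0 u1 (power_nonlinearity \<alpha> p u v) t (u t) \<and>
        duhamel_solution v0 v1 (power_nonlinearity q \<beta> u v) t (v t))"

abbreviation global_mild_solution ::
  "real \<Rightarrow> real \<Rightarrow> real \<Rightarrow> real \<Rightarrow>
   ('a::euclidean_space \<Rightarrow> real) \<Rightarrow> ('a \<Rightarrow> real) \<Rightarrow> ('a \<Rightarrow> real) \<Rightarrow> ('a \<Rightarrow> real) \<Rightarrow>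
   (real \<Rightarrow> 'a \<Rightarrow> real) \<Rightarrow> (real \<Rightarrow> 'a \<Rightarrow> real) \<Rightarrow> bool" where
  "global_mild_solution \<alpha> p q \<beta> u0 u1 v0 v1 \<equiv> mild_solution \<alpha> p q \<beta> u0 u1 v0 v1 \<infinity>"

end

theory Submission
  imports Defs "HOL-Probability.Probability" "HOL-Real_Asymp.Real_Asymp"
begin

text \<open>In dimension at most three the kernel of the damped wave equation is positive, so solutions with
  zero initial position dominate the linear solutions.  On the ball of radius \<open>\<surd>t\<close> these behave like
  the mean of the initial velocity times the heat kernel, that is like \<open>t powr (- n / 2)\<close>.  Inserting
  this into the nonlinearity and integrating over \<open>[t / 4, t / 2]\<close> improves the exponent of the lower
  bound for the first unknown by a fixed amount when \<open>\<alpha> + p < 1 + 2 / n\<close>.  After finitely many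
  iterations both unknowns grow at least linearly on these balls.  Once they are large, finite
  propagation speed makes the problem local: in a backward light cone a common lower bound \<open>L\<close> improves
  to a multiple of \<open>L powr \<gamma>\<close> with \<open>\<gamma> > 1\<close> over ever shorter time steps, and becomes infinite within unit
  time.\<close>

subsection \<open>Gaussians\<close>

lemma sigma_finite_lebesgue: "sigma_finite_measure (lebesgue :: 'a::euclidean_space measure)"
proof
  obtain A :: "'a set set" where A: "countable A" "A \<subseteq> sets lborel" "\<Union>A = space lborel"
      "\<And>a. a \<in> A \<Longrightarrow> emeasure lborel a \<noteq> \<infinity>"
    using lborel.sigma_finite_countable by metis
  show "\<exists>A::'a set set. countable A \<and> A \<subseteq> sets lebesgue \<and> \<Union>A = space lebesgue \<and>
      (\<forall>a\<in>A. emeasure lebesgue a \<noteq> \<infinity>)"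
    using A by (intro exI[of _ A]) (auto simp: emeasure_completion)
qed

interpretation lebesgue: sigma_finite_measure "lebesgue :: 'a::euclidean_space measure"
  by (rule sigma_finite_lebesgue)

interpretation lebesgue_pair:
  pair_sigma_finite "lebesgue :: 'a::euclidean_space measure" "lebesgue :: 'b::euclidean_space measure" ..

lemma borel_measurable_lebesgueI: "f \<in> borel_measurable borel \<Longrightarrow> f \<in> borel_measurable lebesgue"
  by (intro measurable_completion) simp

lemma borel_measurable_pair_lebesgueI:
  fixes f :: "'a::euclidean_space \<times> 'b::euclidean_space \<Rightarrow> 'c::topological_space"
  assumes "f \<in> borel_measurable borel"
  shows "f \<in> borel_measurable (lebesgue \<Otimes>\<^sub>M lebesgue)"
proof -
  have 1: "(\<lambda>x. x) \<in> lebesgue \<rightarrow>\<^sub>M (borel :: 'a measure)" "(\<lambda>x. x) \<in> lebesgue \<rightarrow>\<^sub>M (borel :: 'b measure)"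
    by (auto intro: borel_measurable_lebesgueI)
  have "(\<lambda>p. (fst p, snd p)) \<in> (lebesgue \<Otimes>\<^sub>M lebesgue) \<rightarrow>\<^sub>M (borel \<Otimes>\<^sub>M borel :: ('a \<times> 'b) measure)"
    by (intro measurable_Pair measurable_compose[OF measurable_fst 1(1)] measurable_compose[OF measurable_snd 1(2)])
  then show ?thesis
    using measurable_compose[OF _ assms[folded borel_prod], of "\<lambda>p. (fst p, snd p)"] by simp
qed

lemma borel_measurable_cis [measurable]: "cis \<in> borel_measurable borel"
  by (intro borel_measurable_continuous_onI continuous_intros)

lemma
  fixes f :: "'a::euclidean_space \<Rightarrow> real \<Rightarrow> complex"
  assumes f: "\<And>b. b \<in> Basis \<Longrightarrow> integrable lborel (f b)"
  shows integrable_prod_Basis: "integrable lborel (\<lambda>x::'a. \<Prod>b\<in>Basis. f b (x \<bullet> b))"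
    and integral_prod_Basis:
      "(\<integral>x. (\<Prod>b\<in>Basis. f b (x \<bullet> b)) \<partial>(lborel::'a measure)) = (\<Prod>b\<in>Basis. \<integral>x. f b x \<partial>lborel)"
proof -
  interpret product_sigma_finite "\<lambda>_::'a. lborel :: real measure" ..
  have [measurable]: "f b \<in> borel_measurable borel" if "b \<in> Basis" for b
    using f[OF that] by auto
  have m: "(\<lambda>x::'a. \<Prod>b\<in>Basis. f b (x \<bullet> b)) \<in> borel_measurable borel"
    by measurable
  have eq: "(\<Prod>b\<in>Basis. f b ((\<Sum>b'\<in>Basis. g b' *\<^sub>R b') \<bullet> b)) = (\<Prod>b\<in>Basis. f b (g b))" for g :: "'a \<Rightarrow> real"
    by (rule prod.cong) (auto simp: inner_sum_left inner_Basis if_distrib sum.delta cong: if_cong)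
  have mg: "(\<lambda>g. \<Sum>b\<in>Basis. g b *\<^sub>R b) \<in> (\<Pi>\<^sub>M b\<in>(Basis::'a set). lborel) \<rightarrow>\<^sub>M borel"
    by (intro borel_measurable_sum borel_measurable_scaleR) auto
  show "integrable lborel (\<lambda>x::'a. \<Prod>b\<in>Basis. f b (x \<bullet> b))"
    unfolding lborel_eq[where 'a='a]
    by (subst integrable_distr_eq[OF mg m]) (use f in \<open>simp add: eq product_integrable_prod\<close>)
  show "(\<integral>x. (\<Prod>b\<in>Basis. f b (x \<bullet> b)) \<partial>(lborel::'a measure)) = (\<Prod>b\<in>Basis. \<integral>x. f b x \<partial>lborel)"
    unfolding lborel_eq[where 'a='a]
    by (subst integral_distr[OF mg m]) (use f in \<open>simp add: eq product_integral_prod\<close>)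
qed

definition heat :: "real \<Rightarrow> 'a::euclidean_space \<Rightarrow> real" where
  "heat e x = exp (- (norm x)\<^sup>2 / (4 * e)) / sqrt (4 * pi * e) ^ DIM('a)"

abbreviation gauss :: "real \<Rightarrow> 'a::euclidean_space \<Rightarrow> real" where
  "gauss c x \<equiv> exp (- (c * (norm x)\<^sup>2))"

lemma heat_measurable [measurable]: "heat e \<in> borel_measurable borel"
  unfolding heat_def by measurable

lemma heat_pos: "e > 0 \<Longrightarrow> heat e x > 0"
  by (auto simp: heat_def)

lemma heat_nonneg: "e > 0 \<Longrightarrow> heat e x \<ge> 0"
  using heat_pos less_imp_le by blast

lemma char_normal_density:
  assumes "\<sigma> > 0"
  shows "integrable lborel (\<lambda>x. complex_of_real (normal_density 0 \<sigma> x) * cis (x * t))"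
    and "(\<integral>x. complex_of_real (normal_density 0 \<sigma> x) * cis (x * t) \<partial>lborel) = exp (- (\<sigma>\<^sup>2 * t\<^sup>2 / 2))"
proof -
  show "integrable lborel (\<lambda>x. complex_of_real (normal_density 0 \<sigma> x) * cis (x * t))"
    by (rule Bochner_Integration.integrable_bound[OF integrable_normal_density[OF assms, of 0]])
       (auto simp: norm_mult)
  have "(\<integral>x. complex_of_real (normal_density 0 \<sigma> x) * cis (x * t) \<partial>lborel)
     = \<bar>\<sigma>\<bar> *\<^sub>R (\<integral>x. complex_of_real (normal_density 0 \<sigma> (0 + \<sigma> * x)) * cis ((0 + \<sigma> * x) * t) \<partial>lborel)"
    by (rule lborel_integral_real_affine) (use assms in auto)
  also have "\<dots> = (\<integral>x. \<sigma> *\<^sub>R (complex_of_real (normal_density 0 \<sigma> (0 + \<sigma> * x)) * cis ((0 + \<sigma> * x) * t)) \<partial>lborel)"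
    using assms by simp
  also have "\<dots> = (\<integral>x. std_normal_density x *\<^sub>R iexp ((\<sigma> * t) * x) \<partial>lborel)"
  proof (rule Bochner_Integration.integral_cong[OF refl])
    fix x
    have "\<sigma> * normal_density 0 \<sigma> (\<sigma> * x) = std_normal_density x"
      using assms by (simp add: normal_density_def real_sqrt_mult power_mult_distrib field_simps)
    moreover have "cis (\<sigma> * x * t) = iexp ((\<sigma> * t) * x)"
      by (simp add: cis_conv_exp mult_ac)
    ultimately show "\<sigma> *\<^sub>R (complex_of_real (normal_density 0 \<sigma> (0 + \<sigma> * x)) * cis ((0 + \<sigma> * x) * t))
       = std_normal_density x *\<^sub>R iexp ((\<sigma> * t) * x)"
      by (simp add: scaleR_conv_of_real flip: of_real_mult mult.assoc)
  qed
  also have "\<dots> = char std_normal_distribution (\<sigma> * t)"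
    unfolding char_def by (subst integral_density) auto
  also have "\<dots> = exp (- (\<sigma>\<^sup>2 * t\<^sup>2 / 2))"
    by (simp add: char_std_normal_distribution power_mult_distrib)
  finally show "(\<integral>x. complex_of_real (normal_density 0 \<sigma> x) * cis (x * t) \<partial>lborel) = exp (- (\<sigma>\<^sup>2 * t\<^sup>2 / 2))" .
qed

lemma norm_sq_Basis: "(norm (x::'a::euclidean_space))\<^sup>2 = (\<Sum>b\<in>Basis. (x \<bullet> b)\<^sup>2)"
  unfolding power2_norm_eq_inner by (subst euclidean_inner) (simp add: power2_eq_square)

lemma cis_sum: "finite A \<Longrightarrow> cis (sum f A) = (\<Prod>a\<in>A. cis (f a))"
  by (induction A rule: finite_induct) (auto simp flip: cis_mult)

lemma heat_cis_eq_prod: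
  fixes x z :: "'a::euclidean_space"
  assumes "e > 0"
  shows "complex_of_real (heat e x) * cis (x \<bullet> z)
    = (\<Prod>b\<in>Basis. complex_of_real (normal_density 0 (sqrt (2 * e)) (x \<bullet> b)) * cis ((x \<bullet> b) * (z \<bullet> b)))"
proof -
  have "heat e x = (\<Prod>b\<in>Basis. normal_density 0 (sqrt (2 * e)) (x \<bullet> b))"
  proof -
    have "(\<Prod>b\<in>Basis. normal_density 0 (sqrt (2 * e)) (x \<bullet> b))
        = (\<Prod>b\<in>Basis. exp (- (x \<bullet> b)\<^sup>2 / (4 * e)) / sqrt (4 * pi * e))"
      using assms by (simp add: normal_density_def mult_ac)
    also have "\<dots> = exp (\<Sum>b\<in>Basis. - (x \<bullet> b)\<^sup>2 / (4 * e)) / sqrt (4 * pi * e) ^ DIM('a)"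
      unfolding prod_dividef by (simp add: exp_sum)
    also have "(\<Sum>b\<in>Basis. - (x \<bullet> b)\<^sup>2 / (4 * e)) = - (norm x)\<^sup>2 / (4 * e)"
      unfolding norm_sq_Basis by (simp add: sum_divide_distrib sum_negf)
    finally show ?thesis by (simp add: heat_def)
  qed
  moreover have "cis (x \<bullet> z) = (\<Prod>b\<in>Basis. cis ((x \<bullet> b) * (z \<bullet> b)))"
    by (subst euclidean_inner) (simp add: cis_sum)
  ultimately show ?thesis
    by (simp add: prod.distrib)
qed

lemma
  fixes z :: "'a::euclidean_space"
  assumes "e > 0"
  shows integrable_heat_cis: "integrable lebesgue (\<lambda>x. complex_of_real (heat e x) * cis (x \<bullet> z))"
    and integral_heat_cis: "(\<integral>x. complex_of_real (heat e x) * cis (x \<bullet> z) \<partial>lebesgue) = gauss e z"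
proof -
  let ?f = "\<lambda>b x. complex_of_real (normal_density 0 (sqrt (2 * e)) x) * cis (x * (z \<bullet> b))"
  have s: "sqrt (2 * e) > 0" using assms by simp
  have m: "(\<lambda>x. complex_of_real (heat e x) * cis (x \<bullet> z)) \<in> borel_measurable lborel"
    by measurable
  have "integrable lborel (\<lambda>x::'a. \<Prod>b\<in>Basis. ?f b (x \<bullet> b))"
    by (rule integrable_prod_Basis) (rule char_normal_density[OF s])
  then show "integrable lebesgue (\<lambda>x. complex_of_real (heat e x) * cis (x \<bullet> z))"
    by (subst integrable_completion[OF m]) (simp only: heat_cis_eq_prod[OF assms])
  have "(\<integral>x. complex_of_real (heat e x) * cis (x \<bullet> z) \<partial>lborel) = (\<Prod>b\<in>Basis. \<integral>x. ?f b x \<partial>lborel)"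
    unfolding heat_cis_eq_prod[OF assms] by (rule integral_prod_Basis) (rule char_normal_density[OF s])
  also have "\<dots> = (\<Prod>b\<in>Basis. complex_of_real (exp (- (e * (z \<bullet> b)\<^sup>2))))"
    using char_normal_density(2)[OF s] assms by simp
  also have "\<dots> = complex_of_real (gauss e z)"
    by (simp add: norm_sq_Basis sum_distrib_left exp_sum[symmetric] sum_negf[symmetric] del: of_real_exp flip: of_real_prod)
  finally show "(\<integral>x. complex_of_real (heat e x) * cis (x \<bullet> z) \<partial>lebesgue) = gauss e z"
    by (simp add: integral_completion[OF m])
qed

lemma
  assumes "e > 0"
  shows integrable_heat: "integrable lebesgue (heat e :: 'a::euclidean_space \<Rightarrow> real)"
    and integral_heat: "(\<integral>x. heat e (x::'a) \<partial>lebesgue) = 1"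
proof -
  have 1: "integrable lebesgue (\<lambda>x::'a. complex_of_real (heat e x))"
    using integrable_heat_cis[OF assms, of 0] by simp
  then show "integrable lebesgue (heat e :: 'a::euclidean_space \<Rightarrow> real)"
    using complex_of_real_integrable_eq by blast
  have "(\<integral>x. complex_of_real (heat e (x::'a)) \<partial>lebesgue) = 1"
    using integral_heat_cis[OF assms, of 0] by simp
  then show "(\<integral>x. heat e (x::'a) \<partial>lebesgue) = 1"
    by simp
qed

lemma heat_le_heat_double:
  assumes "e > 0" "\<delta> > 0" "norm (a::'a::euclidean_space) \<ge> \<delta>"
  shows "heat e a \<le> sqrt 2 ^ DIM('a) * exp (- \<delta>\<^sup>2 / (8 * e)) * heat (2 * e) a"
proof -
  have "exp (- (norm a)\<^sup>2 / (4 * e)) = exp (- (norm a)\<^sup>2 / (8 * e)) * exp (- (norm a)\<^sup>2 / (8 * e))"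
    by (simp add: field_simps flip: exp_add)
  also have "\<dots> \<le> exp (- \<delta>\<^sup>2 / (8 * e)) * exp (- (norm a)\<^sup>2 / (8 * e))"
    using assms by (intro mult_right_mono) (auto intro!: divide_right_mono power_mono)
  finally have "exp (- (norm a)\<^sup>2 / (4 * e)) \<le> exp (- \<delta>\<^sup>2 / (8 * e)) * exp (- (norm a)\<^sup>2 / (8 * e))" .
  moreover have "sqrt (4 * pi * (2 * e)) ^ DIM('a) = sqrt 2 ^ DIM('a) * sqrt (4 * pi * e) ^ DIM('a)"
    unfolding power_mult_distrib[symmetric] real_sqrt_mult[symmetric] by (simp add: mult_ac)
  ultimately show ?thesis
    using assms by (simp add: heat_def divide_right_mono mult_ac)
qed

lemma heat_approx_identity:
  fixes \<Phi> :: "'a::euclidean_space \<Rightarrow> real"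
  assumes meas: "\<Phi> \<in> borel_measurable lebesgue" and bdd: "\<And>a. \<bar>\<Phi> a\<bar> \<le> B"
    and cont: "isCont \<Phi> 0"
  shows "((\<lambda>e. \<integral>a. heat e a * \<Phi> a \<partial>lebesgue) \<longlongrightarrow> \<Phi> 0) (at_right 0)"
proof (rule tendstoI)
  fix r :: real assume "r > 0"
  obtain \<eta> where \<eta>: "\<eta> > 0" "\<eta> < r" using \<open>r > 0\<close> dense by blast
  obtain \<delta> where \<delta>: "\<delta> > 0" "\<And>a. norm a < \<delta> \<Longrightarrow> \<bar>\<Phi> a - \<Phi> 0\<bar> < \<eta>"
    using cont \<eta>(1) unfolding continuous_at_eps_delta by (auto simp: dist_norm)
  have B: "B \<ge> 0" using bdd[of 0] by linarith
  define K where "K = 2 * B * sqrt 2 ^ DIM('a)"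
  have "((\<lambda>e. \<eta> + K * exp (- \<delta>\<^sup>2 / (8 * e))) \<longlongrightarrow> \<eta>) (at_right 0)"
  proof -
    have "((\<lambda>e. exp (- \<delta>\<^sup>2 / (8 * e))) \<longlongrightarrow> 0) (at_right 0)"
      using \<delta>(1) by real_asymp
    from tendsto_add[OF tendsto_const[of \<eta>] tendsto_mult[OF tendsto_const[of K] this]] show ?thesis by simp
  qed
  then have ev: "\<forall>\<^sub>F e in at_right 0. \<eta> + K * exp (- \<delta>\<^sup>2 / (8 * e)) < r"
    using \<eta>(2) by (rule order_tendstoD(2))
  show "\<forall>\<^sub>F e in at_right 0. dist (\<integral>a. heat e a * \<Phi> a \<partial>lebesgue) (\<Phi> 0) < r"
    using ev eventually_at_right_less[of 0]
  proof eventually_elim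
    case (elim e)
    have [measurable]: "\<Phi> \<in> borel_measurable lebesgue" by fact
    have [measurable]: "heat e \<in> borel_measurable (lebesgue :: 'a measure)"
      by (intro borel_measurable_lebesgueI) auto
    have int1: "integrable lebesgue (\<lambda>a. heat e a * \<Phi> a)"
      by (rule Bochner_Integration.integrable_bound[OF integrable_mult_left[OF integrable_heat[OF elim(2)], of B]])
         (use bdd B heat_nonneg[OF elim(2)] in \<open>auto simp: abs_mult intro!: mult_left_mono\<close>)
    have pt: "\<bar>heat e a * (\<Phi> a - \<Phi> 0)\<bar> \<le> \<eta> * heat e a + K * exp (- \<delta>\<^sup>2 / (8 * e)) * heat (2 * e) a" for a :: 'a
    proof (cases "norm a < \<delta>")
      case True
      have "\<bar>heat e a * (\<Phi> a - \<Phi> 0)\<bar> \<le> heat e a * \<eta>"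
        using \<delta>(2)[OF True] heat_nonneg[OF elim(2), of a] by (auto simp: abs_mult intro!: mult_left_mono)
      moreover have "0 \<le> K * exp (- \<delta>\<^sup>2 / (8 * e)) * heat (2 * e) a"
        using B heat_nonneg[of "2*e" a] elim by (auto simp: K_def)
      ultimately show ?thesis by (simp add: mult.commute)
    next
      case False
      have "\<bar>\<Phi> a - \<Phi> 0\<bar> \<le> 2 * B" using bdd[of a] bdd[of 0] by linarith
      then have "\<bar>heat e a * (\<Phi> a - \<Phi> 0)\<bar> \<le> heat e a * (2 * B)"
        using heat_nonneg[OF elim(2), of a] by (auto simp: abs_mult intro!: mult_left_mono)
      also have "\<dots> \<le> (sqrt 2 ^ DIM('a) * exp (- \<delta>\<^sup>2 / (8 * e)) * heat (2 * e) a) * (2 * B)"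
        using heat_le_heat_double[OF elim(2) \<delta>(1), of a] False B by (intro mult_right_mono) auto
      also have "\<dots> = K * exp (- \<delta>\<^sup>2 / (8 * e)) * heat (2 * e) a" by (simp add: K_def)
      finally show ?thesis using heat_nonneg[OF elim(2), of a] \<eta>(1) by (simp add: add_increasing)
    qed
    have "(\<integral>a. heat e a * \<Phi> a \<partial>lebesgue) - \<Phi> 0 = (\<integral>a. heat e a * \<Phi> a \<partial>lebesgue) - (\<integral>a. heat e (a::'a) * \<Phi> 0 \<partial>lebesgue)"
      using integral_heat[OF elim(2), where 'a='a] by simp
    also have "\<dots> = (\<integral>a. heat e a * (\<Phi> a - \<Phi> 0) \<partial>lebesgue)"
      using int1 integrable_heat[OF elim(2), where 'a='a] by (simp add: right_diff_distrib)
    also have "\<bar>\<dots>\<bar> \<le> (\<integral>a. \<eta> * heat e a + K * exp (- \<delta>\<^sup>2 / (8 * e)) * heat (2 * e) (a::'a) \<partial>lebesgue)"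
      using pt int1 integrable_heat[OF elim(2), where 'a='a] integrable_heat[of "2*e", where 'a='a] elim(2)
      by (intro order.trans[OF integral_abs_bound] integral_mono) (auto simp: right_diff_distrib)
    also have "\<dots> = \<eta> + K * exp (- \<delta>\<^sup>2 / (8 * e))"
      using integrable_heat[OF elim(2), where 'a='a] integrable_heat[of "2*e", where 'a='a] elim(2)
        integral_heat[OF elim(2), where 'a='a] integral_heat[of "2*e", where 'a='a] by simp
    finally show ?case using elim(1) by (simp add: dist_real_def)
  qed
qed

subsection \<open>Square integrable functions and the Fourier transform\<close>

lemma lebesgue_measurable_cis_inner [measurable]: "(\<lambda>x. cis (x \<bullet> y)) \<in> borel_measurable lebesgue"
  by (intro borel_measurable_lebesgueI) measurable

lemma integrable_pair_bounded_mult: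
  fixes f :: "'a::euclidean_space \<Rightarrow> complex" and g :: "'b::euclidean_space \<Rightarrow> complex"
  assumes f: "integrable lebesgue f" and g: "integrable lebesgue g"
    and k: "k \<in> borel_measurable (lebesgue \<Otimes>\<^sub>M lebesgue)" and b: "\<And>p. norm (k p) \<le> C"
  shows "integrable (lebesgue \<Otimes>\<^sub>M lebesgue) (\<lambda>(x, y). k (x, y) * (f x * g y))"
proof -
  have [measurable]: "f \<in> borel_measurable lebesgue" "g \<in> borel_measurable lebesgue"
    using f g by auto
  note k [measurable]
  have 1: "integrable (lebesgue \<Otimes>\<^sub>M lebesgue) (\<lambda>(x, y). f x * g y)"
  proof (rule lebesgue_pair.Fubini_integrable)
    show "integrable lebesgue (\<lambda>x. \<integral>y. norm (case (x, y) of (x, y) \<Rightarrow> f x * g y) \<partial>lebesgue)"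
      using f g by (simp add: norm_mult)
    show "AE x in lebesgue. integrable lebesgue (\<lambda>y. case (x, y) of (x, y) \<Rightarrow> f x * g y)"
      using f g by simp
  qed measurable
  have C: "C \<ge> 0" using b[of undefined] norm_ge_zero order_trans by blast
  show ?thesis
  proof (rule Bochner_Integration.integrable_bound[OF integrable_mult_right[OF 1, of "of_real C"]])
    show "(\<lambda>(x, y). k (x, y) * (f x * g y)) \<in> borel_measurable (lebesgue \<Otimes>\<^sub>M lebesgue)"
      by measurable
    show "AE x in lebesgue \<Otimes>\<^sub>M lebesgue. norm (case x of (x, y) \<Rightarrow> k (x, y) * (f x * g y))
        \<le> norm (complex_of_real C * (case x of (x, y) \<Rightarrow> f x * g y))"
      using b C by (intro AE_I2) (auto simp: norm_mult split: prod.splits intro!: mult_right_mono)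
  qed
qed

lemma
  fixes f :: "'a::euclidean_space \<Rightarrow> 'b::{banach, second_countable_topology}"
  assumes "f \<in> borel_measurable borel"
  shows integrable_lborel_shift: "integrable lborel (\<lambda>x. f (c + x)) \<longleftrightarrow> integrable lborel f"
    and integral_lborel_shift: "(\<integral>x. f (c + x) \<partial>lborel) = (\<integral>x. f x \<partial>lborel)"
proof -
  have m: "(+) c \<in> lborel \<rightarrow>\<^sub>M borel"
    by (simp add: borel_measurable_add)
  show "integrable lborel (\<lambda>x. f (c + x)) \<longleftrightarrow> integrable lborel f"
    by (rule integrable_distr_eq[OF m assms, unfolded lborel_distr_plus, symmetric])
  show "(\<integral>x. f (c + x) \<partial>lborel) = (\<integral>x. f x \<partial>lborel)"
    by (rule integral_distr[OF m assms, unfolded lborel_distr_plus, symmetric])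
qed

lemma exp_eq_heat:
  assumes "c > 0"
  shows "gauss c x = sqrt (pi / c) ^ DIM('a) * heat (1 / (4 * c)) (x :: 'a::euclidean_space)"
  using assms by (simp add: heat_def)

lemma integrable_gauss:
  assumes "c > 0" shows "integrable lebesgue (\<lambda>x::'a::euclidean_space. gauss c x)"
  unfolding exp_eq_heat[OF assms] using assms by (intro integrable_mult_right integrable_heat) simp

lemma integral_gauss:
  assumes "c > 0"
  shows "(\<integral>x. gauss c (x::'a::euclidean_space) \<partial>lebesgue) = sqrt (pi / c) ^ DIM('a)"
  unfolding exp_eq_heat[OF assms] using assms by (simp add: integral_heat)

lemma integral_gauss_cis:
  fixes z :: "'a::euclidean_space"
  assumes "c > 0"
  shows "(\<integral>x. complex_of_real (gauss c x) * cis (x \<bullet> z) \<partial>lebesgue)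
      = sqrt (pi / c) ^ DIM('a) * exp (- ((norm z)\<^sup>2 / (4 * c)))"
proof -
  have "(\<integral>x. complex_of_real (gauss c x) * cis (x \<bullet> z) \<partial>lebesgue)
     = (\<integral>x. complex_of_real (sqrt (pi / c) ^ DIM('a)) * (complex_of_real (heat (1 / (4 * c)) x) * cis (x \<bullet> z)) \<partial>lebesgue)"
    unfolding exp_eq_heat[OF assms] by (simp add: mult_ac)
  also have "\<dots> = sqrt (pi / c) ^ DIM('a) * exp (- ((norm z)\<^sup>2 / (4 * c)))"
    using integral_heat_cis[of "1 / (4 * c)" z] assms by simp
  finally show ?thesis .
qed

lemma L2_measurable: "f \<in> L2 \<Longrightarrow> f \<in> borel_measurable lebesgue"
  by (simp add: L2_def)

lemma L2_norm_nonneg: "L2_norm f \<ge> 0"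
  by (simp add: L2_norm_def)

lemma norm_mult_le_sq: "norm (a * b :: 'b::real_normed_div_algebra) \<le> (norm a)\<^sup>2 + (norm b)\<^sup>2"
proof -
  have "0 \<le> norm a * norm b" "2 * (norm a * norm b) \<le> (norm a)\<^sup>2 + (norm b)\<^sup>2"
    using sum_squares_bound[of "norm a" "norm b"] by auto
  then show ?thesis unfolding norm_mult by linarith
qed

lemma
  assumes e: "e > 0"
  shows integrable_heat_shift: "integrable lebesgue (\<lambda>x. heat e (x - y :: 'a::euclidean_space))"
    and heat_shift_L2: "(\<lambda>x. heat e (x - y)) \<in> L2"
proof -
  have "integrable lborel (heat e :: 'a \<Rightarrow> real)"
    using integrable_heat[OF e, where 'a='a] by (simp add: integrable_completion)
  then have "integrable lborel (\<lambda>x. heat e (- y + x))"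
    by (subst integrable_lborel_shift) auto
  then show i: "integrable lebesgue (\<lambda>x. heat e (x - y))"
    by (subst integrable_completion) auto
  have m [measurable]: "(\<lambda>x. heat e (x - y)) \<in> borel_measurable lebesgue"
    by (intro borel_measurable_lebesgueI) measurable
  have "integrable lebesgue (\<lambda>x. (norm (heat e (x - y)))\<^sup>2)"
  proof (rule Bochner_Integration.integrable_bound[OF integrable_mult_right[OF i, of "heat e (0::'a)"]])
    show "AE x in lebesgue. norm ((norm (heat e (x - y)))\<^sup>2) \<le> norm (heat e (0::'a) * heat e (x - y))"
    proof (rule AE_I2)
      fix x
      have "heat e (x - y) \<le> heat e (0::'a)"
        using e by (simp add: heat_def divide_right_mono)
      then show "norm ((norm (heat e (x - y)))\<^sup>2) \<le> norm (heat e (0::'a) * heat e (x - y))"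
        using heat_nonneg[OF e, of "x - y"] heat_nonneg[OF e, of "0::'a"]
        by (simp add: power2_eq_square mult_right_mono)
    qed
  qed measurable
  with m show "(\<lambda>x. heat e (x - y)) \<in> L2" by (simp add: L2_def)
qed

lemma L2_mult_integrable:
  fixes f g :: "'a::euclidean_space \<Rightarrow> 'b::{real_normed_field,banach,second_countable_topology}"
  assumes "f \<in> L2" "g \<in> L2"
  shows "integrable lebesgue (\<lambda>x. f x * g x)"
proof (rule Bochner_Integration.integrable_bound)
  show "integrable lebesgue (\<lambda>x. (norm (f x))\<^sup>2 + (norm (g x))\<^sup>2)"
    using assms by (auto simp: L2_def)
  show "(\<lambda>x. f x * g x) \<in> borel_measurable lebesgue"
    using assms by (auto simp: L2_def)
  show "AE x in lebesgue. norm (f x * g x) \<le> norm ((norm (f x))\<^sup>2 + (norm (g x))\<^sup>2)"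
    using norm_mult_le_sq[of "f _" "g _"] by (intro AE_I2) (auto intro: order.trans)
qed

lemma L2_diff:
  fixes f g :: "'a::euclidean_space \<Rightarrow> 'b::{real_normed_field,banach,second_countable_topology}"
  assumes "f \<in> L2" "g \<in> L2"
  shows "(\<lambda>x. f x - g x) \<in> L2"
proof -
  have m: "(\<lambda>x. f x - g x) \<in> borel_measurable lebesgue"
    using assms by (auto simp: L2_def)
  have "integrable lebesgue (\<lambda>x. (norm (f x - g x))\<^sup>2)"
  proof (rule Bochner_Integration.integrable_bound)
    show "integrable lebesgue (\<lambda>x. 2 * (norm (f x))\<^sup>2 + 2 * (norm (g x))\<^sup>2)"
      using assms by (auto simp: L2_def)
    show "AE x in lebesgue. norm ((norm (f x - g x))\<^sup>2) \<le> norm (2 * (norm (f x))\<^sup>2 + 2 * (norm (g x))\<^sup>2)"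
    proof (rule AE_I2)
      fix x
      have "(norm (f x - g x))\<^sup>2 \<le> (norm (f x) + norm (g x))\<^sup>2"
        by (intro power_mono norm_triangle_ineq4) auto
      also have "\<dots> \<le> 2 * (norm (f x))\<^sup>2 + 2 * (norm (g x))\<^sup>2"
        using sum_squares_bound[of "norm (f x)" "norm (g x)"] by (simp add: power2_sum)
      finally show "norm ((norm (f x - g x))\<^sup>2) \<le> norm (2 * (norm (f x))\<^sup>2 + 2 * (norm (g x))\<^sup>2)"
        by simp
    qed
  qed (use m in measurable)
  with m show ?thesis by (simp add: L2_def)
qed

lemma L2_norm_zero_AE:
  assumes "f \<in> L2" "L2_norm f = 0"
  shows "AE x in lebesgue. f x = 0"
  using assms by (auto simp: L2_def L2_norm_def integral_nonneg_eq_0_iff_AE)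

lemma L2_Cauchy_Schwarz:
  fixes f g :: "'a::euclidean_space \<Rightarrow> 'b::{real_normed_field,banach,second_countable_topology}"
  assumes f: "f \<in> L2" and g: "g \<in> L2"
  shows "norm (\<integral>x. f x * g x \<partial>lebesgue) \<le> L2_norm f * L2_norm g"
proof -
  have [measurable]: "f \<in> borel_measurable lebesgue" "g \<in> borel_measurable lebesgue"
    using f g by (auto simp: L2_def)
  consider "L2_norm f = 0 \<or> L2_norm g = 0" | "L2_norm f > 0" "L2_norm g > 0"
    using L2_norm_nonneg[of f] L2_norm_nonneg[of g] by linarith
  then show ?thesis
  proof cases
    case 1
    then have "AE x in lebesgue. f x * g x = 0"
      using L2_norm_zero_AE[OF f] L2_norm_zero_AE[OF g] by auto
    then have "(\<integral>x. f x * g x \<partial>lebesgue) = 0"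
      by (rule integral_eq_zero_AE)
    then show ?thesis by (simp add: L2_norm_nonneg)
  next
    case 2
    define a b where "a = L2_norm f" and "b = L2_norm g"
    have ab: "a > 0" "b > 0" using 2 by (auto simp: a_def b_def)
    have a2: "(\<integral>x. (norm (f x))\<^sup>2 \<partial>lebesgue) = a\<^sup>2" and b2: "(\<integral>x. (norm (g x))\<^sup>2 \<partial>lebesgue) = b\<^sup>2"
      by (auto simp: a_def b_def L2_norm_def)
    have i: "integrable lebesgue (\<lambda>x. (norm (f x))\<^sup>2)" "integrable lebesgue (\<lambda>x. (norm (g x))\<^sup>2)"
      using f g by (auto simp: L2_def)
    have "norm (\<integral>x. f x * g x \<partial>lebesgue) \<le> (\<integral>x. norm (f x * g x) \<partial>lebesgue)"
      by (rule integral_norm_bound)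
    also have "\<dots> \<le> (\<integral>x. b / (2 * a) * (norm (f x))\<^sup>2 + a / (2 * b) * (norm (g x))\<^sup>2 \<partial>lebesgue)"
    proof (rule integral_mono)
      show "integrable lebesgue (\<lambda>x. norm (f x * g x))"
        using L2_mult_integrable[OF f g] by auto
      show "integrable lebesgue (\<lambda>x. b / (2 * a) * (norm (f x))\<^sup>2 + a / (2 * b) * (norm (g x))\<^sup>2)"
        using i by auto
      fix x
      have "0 \<le> (b * norm (f x) - a * norm (g x))\<^sup>2" by simp
      then show "norm (f x * g x) \<le> b / (2 * a) * (norm (f x))\<^sup>2 + a / (2 * b) * (norm (g x))\<^sup>2"
        using ab by (simp add: norm_mult field_simps power2_eq_square)
    qed
    also have "\<dots> = a * b"
      using i ab a2 b2 by (simp add: field_simps power2_eq_square)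
    finally show ?thesis by (simp add: a_def b_def)
  qed
qed

lemma L2_gauss_cis:
  assumes "c > 0"
  shows "(\<lambda>\<xi>::'a::euclidean_space. cis (\<xi> \<bullet> y) * complex_of_real (gauss c \<xi>)) \<in> L2"
proof -
  have "(\<lambda>\<xi>::'a. cis (\<xi> \<bullet> y) * complex_of_real (gauss c \<xi>)) \<in> borel_measurable lebesgue"
    by (intro borel_measurable_lebesgueI) measurable
  moreover have "(norm (cis (\<xi> \<bullet> y) * complex_of_real (gauss c \<xi>)))\<^sup>2 = gauss (2 * c) \<xi>" for \<xi> :: 'a
    by (simp add: norm_mult power2_eq_square flip: exp_add)
  ultimately show ?thesis
    using integrable_gauss[of "2 * c", where 'a='a] assms by (simp add: L2_def)
qed

lemma integrable_gauss_cis: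
  assumes "c > 0"
  shows "integrable lebesgue (\<lambda>\<xi>::'a::euclidean_space. cis (\<xi> \<bullet> y) * complex_of_real (gauss c \<xi>))"
proof (rule Bochner_Integration.integrable_bound[OF integrable_gauss[OF assms]])
  show "(\<lambda>\<xi>::'a. cis (\<xi> \<bullet> y) * complex_of_real (gauss c \<xi>)) \<in> borel_measurable lebesgue"
    by (intro borel_measurable_lebesgueI) measurable
qed (auto simp: norm_mult)

lemma L2_integrable_on_bounded:
  fixes f :: "'a::euclidean_space \<Rightarrow> 'b::{real_normed_field,banach,second_countable_topology}"
  assumes "f \<in> L2" "A \<in> lmeasurable"
  shows "integrable lebesgue (\<lambda>x. indicator A x *\<^sub>R f x)"
proof (rule Bochner_Integration.integrable_bound)
  show "integrable lebesgue (\<lambda>x. (norm (f x))\<^sup>2 + indicator A x)"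
    using assms by (auto simp: L2_def fmeasurable_def)
  show "(\<lambda>x. indicator A x *\<^sub>R f x) \<in> borel_measurable lebesgue"
    using assms by (auto simp: L2_def fmeasurable_def)
  have "t \<le> t\<^sup>2 + 1" for t :: real
    using sum_squares_bound[of t 1] zero_le_power2[of t] by (simp only: power_one mult_1_right)
  then show "AE x in lebesgue. norm (indicator A x *\<^sub>R f x) \<le> norm ((norm (f x))\<^sup>2 + indicator A x :: real)"
    by (intro AE_I2) (auto split: split_indicator)
qed

text \<open>Pairing with Gaussians takes the place of Plancherel's theorem: for truncations of \<open>f\<close> it is
  Fubini's theorem, and both sides are continuous in \<open>L\<^sup>2\<close>.\<close>

lemma
  fixes f F :: "'a::euclidean_space \<Rightarrow> complex"
  assumes "has_fourier f F" "e > 0"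
  shows has_fourier_gauss_integrable:
      "integrable lebesgue (\<lambda>\<xi>. F \<xi> * (cis (\<xi> \<bullet> y) * complex_of_real (gauss e \<xi>)))"
    and has_fourier_gauss:
      "(\<integral>\<xi>. F \<xi> * (cis (\<xi> \<bullet> y) * complex_of_real (gauss e \<xi>)) \<partial>lebesgue)
      = (2 * pi) ^ DIM('a) * (\<integral>x. f x * complex_of_real (heat e (x - y)) \<partial>lebesgue)"
proof -
  define \<phi> where "\<phi> = (\<lambda>\<xi>::'a. cis (\<xi> \<bullet> y) * complex_of_real (gauss e \<xi>))"
  define T where "T = (\<lambda>R \<xi>. LINT x:cball 0 R|lebesgue. cis (- (x \<bullet> \<xi>)) * f x)"
  have f: "f \<in> L2" and lim: "tendsto_L2 T F at_top"
    using assms(1) by (auto simp: has_fourier_def T_def)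
  have F: "F \<in> L2" and ev: "\<forall>\<^sub>F R in at_top. T R \<in> L2"
    and l0: "((\<lambda>R. L2_norm (\<lambda>x. T R x - F x)) \<longlongrightarrow> 0) at_top"
    using lim by (auto simp: tendsto_L2_def)
  have \<phi>: "\<phi> \<in> L2" "integrable lebesgue \<phi>"
    using L2_gauss_cis[OF assms(2)] integrable_gauss_cis[OF assms(2)] by (auto simp: \<phi>_def)
  show "integrable lebesgue (\<lambda>\<xi>. F \<xi> * (cis (\<xi> \<bullet> y) * complex_of_real (gauss e \<xi>)))"
    using L2_mult_integrable[OF F \<phi>(1)] by (simp add: \<phi>_def)
  have hat: "(\<integral>\<xi>. cis (- (x \<bullet> \<xi>)) * \<phi> \<xi> \<partial>lebesgue) = (2 * pi) ^ DIM('a) * complex_of_real (heat e (x - y))" for x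
  proof -
    have "(\<integral>\<xi>. cis (- (x \<bullet> \<xi>)) * \<phi> \<xi> \<partial>lebesgue)
       = (\<integral>\<xi>. complex_of_real (gauss e \<xi>) * cis (\<xi> \<bullet> (y - x)) \<partial>lebesgue)"
    proof (intro Bochner_Integration.integral_cong refl)
      fix \<xi>
      have "cis (- (x \<bullet> \<xi>)) * cis (\<xi> \<bullet> y) = cis (\<xi> \<bullet> (y - x))"
        by (simp add: cis_mult inner_diff_right inner_commute)
      then show "cis (- (x \<bullet> \<xi>)) * \<phi> \<xi> = complex_of_real (gauss e \<xi>) * cis (\<xi> \<bullet> (y - x))"
        unfolding \<phi>_def by (metis mult.assoc mult.commute)
    qed
    also have "\<dots> = sqrt (pi / e) ^ DIM('a) * exp (- ((norm (y - x))\<^sup>2 / (4 * e)))"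
      by (rule integral_gauss_cis[OF assms(2)])
    also have "sqrt (pi / e) ^ DIM('a) * exp (- ((norm (y - x))\<^sup>2 / (4 * e))) = (2 * pi) ^ DIM('a) * heat e (x - y)"
    proof -
      have "sqrt (pi / e) * sqrt (4 * pi * e) = sqrt ((2 * pi)\<^sup>2)"
        unfolding real_sqrt_mult[symmetric] using assms(2) by (simp add: power2_eq_square)
      then have "sqrt (pi / e) * sqrt (4 * pi * e) = 2 * pi" by (simp only: real_sqrt_abs) simp
      then have "(2 * pi) ^ DIM('a) = sqrt (pi / e) ^ DIM('a) * sqrt (4 * pi * e) ^ DIM('a)"
        by (metis power_mult_distrib)
      then show ?thesis unfolding heat_def by (simp add: norm_minus_commute[of x y])
    qed
    finally show ?thesis by simp
  qed
  have fub: "(\<integral>\<xi>. T R \<xi> * \<phi> \<xi> \<partial>lebesgue)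
      = (2 * pi) ^ DIM('a) * (\<integral>x. indicator (cball 0 R) x *\<^sub>R (f x * complex_of_real (heat e (x - y))) \<partial>lebesgue)" for R
  proof -
    let ?f = "\<lambda>x. indicator (cball 0 R) x *\<^sub>R f x"
    have i: "integrable lebesgue ?f"
      by (rule L2_integrable_on_bounded[OF f]) auto
    have c: "(\<lambda>p::'a\<times>'a. cis (- (fst p \<bullet> snd p))) \<in> borel_measurable (lebesgue \<Otimes>\<^sub>M lebesgue)"
      by (intro borel_measurable_pair_lebesgueI borel_measurable_continuous_onI continuous_intros)
    have ii: "integrable (lebesgue \<Otimes>\<^sub>M lebesgue) (\<lambda>(x, \<xi>). cis (- (x \<bullet> \<xi>)) * (?f x * \<phi> \<xi>))"
      using integrable_pair_bounded_mult[OF i \<phi>(2) c, of 1] by simp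
    have "(\<integral>\<xi>. T R \<xi> * \<phi> \<xi> \<partial>lebesgue) = (\<integral>\<xi>. (\<integral>x. cis (- (x \<bullet> \<xi>)) * (?f x * \<phi> \<xi>) \<partial>lebesgue) \<partial>lebesgue)"
    proof (intro Bochner_Integration.integral_cong refl)
      fix \<xi>
      have "T R \<xi> * \<phi> \<xi> = (\<integral>x. cis (- (x \<bullet> \<xi>)) * ?f x \<partial>lebesgue) * \<phi> \<xi>"
        unfolding T_def set_lebesgue_integral_def by (simp add: scaleR_conv_of_real mult_ac)
      also have "\<dots> = (\<integral>x. (cis (- (x \<bullet> \<xi>)) * ?f x) * \<phi> \<xi> \<partial>lebesgue)"
        by (rule integral_mult_left_zero[symmetric])
      finally show "T R \<xi> * \<phi> \<xi> = (\<integral>x. cis (- (x \<bullet> \<xi>)) * (?f x * \<phi> \<xi>) \<partial>lebesgue)"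
        by (simp only: mult.assoc)
    qed
    also have "\<dots> = (\<integral>x. (\<integral>\<xi>. cis (- (x \<bullet> \<xi>)) * (?f x * \<phi> \<xi>) \<partial>lebesgue) \<partial>lebesgue)"
      by (rule lebesgue_pair.Fubini_integral[OF ii])
    also have "\<dots> = (\<integral>x. ?f x * (\<integral>\<xi>. cis (- (x \<bullet> \<xi>)) * \<phi> \<xi> \<partial>lebesgue) \<partial>lebesgue)"
      by (intro Bochner_Integration.integral_cong refl trans[OF _ integral_mult_right_zero] mult.left_commute)
    also have "\<dots> = (\<integral>x. (2 * pi) ^ DIM('a) * (indicator (cball 0 R) x *\<^sub>R (f x * complex_of_real (heat e (x - y)))) \<partial>lebesgue)"
      unfolding hat by (intro Bochner_Integration.integral_cong refl) (simp add: scaleR_conv_of_real mult_ac)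
    finally show ?thesis unfolding integral_mult_right_zero .
  qed
  have heatL2: "(\<lambda>x. complex_of_real (heat e (x - y))) \<in> L2"
  proof -
    have "(\<lambda>x. complex_of_real (heat e (x - y))) \<in> borel_measurable lebesgue"
      by (intro borel_measurable_lebesgueI) measurable
    then show ?thesis using heat_shift_L2[OF assms(2), of y] by (simp add: L2_def)
  qed
  have fi: "integrable lebesgue (\<lambda>x. f x * complex_of_real (heat e (x - y)))"
    by (rule L2_mult_integrable[OF f heatL2])
  have "((\<lambda>R. (2 * pi) ^ DIM('a) * (\<integral>x. indicator (cball 0 R) x *\<^sub>R (f x * complex_of_real (heat e (x - y))) \<partial>lebesgue))
      \<longlongrightarrow> (2 * pi) ^ DIM('a) * (\<integral>x. f x * complex_of_real (heat e (x - y)) \<partial>lebesgue)) at_top"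
  proof (intro tendsto_intros integral_dominated_convergence_at_top[where w = "\<lambda>x. norm (f x * complex_of_real (heat e (x - y)))"])
    show "AE x in lebesgue. ((\<lambda>R. indicator (cball 0 R) x *\<^sub>R (f x * complex_of_real (heat e (x - y))))
        \<longlongrightarrow> f x * complex_of_real (heat e (x - y))) at_top"
    proof (intro AE_I2 tendsto_eventually)
      fix x :: 'a
      show "\<forall>\<^sub>F R in at_top. indicator (cball 0 R) x *\<^sub>R (f x * complex_of_real (heat e (x - y))) = f x * complex_of_real (heat e (x - y))"
        using eventually_ge_at_top[of "norm x"] by eventually_elim auto
    qed
    show "integrable lebesgue (\<lambda>x. norm (f x * complex_of_real (heat e (x - y))))"
      using fi by (rule integrable_norm)
    have m: "(\<lambda>x. f x * complex_of_real (heat e (x - y))) \<in> borel_measurable lebesgue"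
      using fi by auto
    then show "(\<lambda>x. f x * complex_of_real (heat e (x - y))) \<in> borel_measurable lebesgue" .
    show "(\<lambda>x. indicator (cball 0 R) x *\<^sub>R (f x * complex_of_real (heat e (x - y)))) \<in> borel_measurable lebesgue" for R
      using m by (intro borel_measurable_scaleR borel_measurable_indicator) auto
  qed (auto split: split_indicator)
  moreover have "((\<lambda>R. \<integral>\<xi>. T R \<xi> * \<phi> \<xi> \<partial>lebesgue) \<longlongrightarrow> (\<integral>\<xi>. F \<xi> * \<phi> \<xi> \<partial>lebesgue)) at_top"
  proof (rule Lim_transform_eventually[OF _ eventually_mono[OF ev]])
    have "((\<lambda>R. \<integral>\<xi>. (T R \<xi> - F \<xi>) * \<phi> \<xi> \<partial>lebesgue) \<longlongrightarrow> 0) at_top"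
    proof (rule Lim_null_comparison)
      show "\<forall>\<^sub>F R in at_top. norm (\<integral>\<xi>. (T R \<xi> - F \<xi>) * \<phi> \<xi> \<partial>lebesgue) \<le> L2_norm (\<lambda>x. T R x - F x) * L2_norm \<phi>"
        using ev by eventually_elim (intro L2_Cauchy_Schwarz L2_diff F \<phi>)
      show "((\<lambda>R. L2_norm (\<lambda>x. T R x - F x) * L2_norm \<phi>) \<longlongrightarrow> 0) at_top"
        using tendsto_mult[OF l0 tendsto_const[of "L2_norm \<phi>"]] by simp
    qed
    from tendsto_add[OF this tendsto_const[of "\<integral>\<xi>. F \<xi> * \<phi> \<xi> \<partial>lebesgue"]]
    show "((\<lambda>R. (\<integral>\<xi>. (T R \<xi> - F \<xi>) * \<phi> \<xi> \<partial>lebesgue) + (\<integral>\<xi>. F \<xi> * \<phi> \<xi> \<partial>lebesgue)) \<longlongrightarrow> (\<integral>\<xi>. F \<xi> * \<phi> \<xi> \<partial>lebesgue)) at_top"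
      by simp
    fix R assume "T R \<in> L2"
    then show "(\<integral>\<xi>. (T R \<xi> - F \<xi>) * \<phi> \<xi> \<partial>lebesgue) + (\<integral>\<xi>. F \<xi> * \<phi> \<xi> \<partial>lebesgue) = (\<integral>\<xi>. T R \<xi> * \<phi> \<xi> \<partial>lebesgue)"
      using L2_mult_integrable[of "T R" \<phi>] L2_mult_integrable[of F \<phi>] F \<phi>
      by (simp add: left_diff_distrib)
  qed
  ultimately have "(\<integral>\<xi>. F \<xi> * \<phi> \<xi> \<partial>lebesgue) = (2 * pi) ^ DIM('a) * (\<integral>x. f x * complex_of_real (heat e (x - y)) \<partial>lebesgue)"
    unfolding fub using tendsto_unique[OF trivial_limit_at_top_linorder] by blast
  then show "(\<integral>\<xi>. F \<xi> * (cis (\<xi> \<bullet> y) * complex_of_real (gauss e \<xi>)) \<partial>lebesgue)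
      = (2 * pi) ^ DIM('a) * (\<integral>x. f x * complex_of_real (heat e (x - y)) \<partial>lebesgue)"
    by (simp add: \<phi>_def)
qed

definition moll :: "real \<Rightarrow> ('a::euclidean_space \<Rightarrow> real) \<Rightarrow> 'a \<Rightarrow> real" where
  "moll e f y = (\<integral>x. f x * heat e (x - y) \<partial>lebesgue)"

lemma has_fourier_moll:
  fixes f :: "'a::euclidean_space \<Rightarrow> real"
  assumes "has_fourier (\<lambda>x. complex_of_real (f x)) F" "e > 0"
  shows "(\<integral>\<xi>. F \<xi> * (cis (\<xi> \<bullet> y) * complex_of_real (gauss e \<xi>)) \<partial>lebesgue)
      = complex_of_real ((2 * pi) ^ DIM('a) * moll e f y)"
  unfolding has_fourier_gauss[OF assms] moll_def by (simp flip: of_real_mult)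

lemma L2_AE_cong:
  assumes "f \<in> L2" "g \<in> borel_measurable lebesgue" "AE x in lebesgue. f x = g x"
  shows "g \<in> L2"
proof -
  have "integrable lebesgue (\<lambda>x. (norm (g x))\<^sup>2)"
    using assms by (subst integrable_cong_AE[of _ _ "\<lambda>x. (norm (f x))\<^sup>2"]) (auto simp: L2_def)
  with assms(2) show ?thesis by (simp add: L2_def)
qed

lemma AE_ge_of_cbox_integrals:
  fixes g :: "'a::euclidean_space \<Rightarrow> real"
  assumes int: "\<And>p q. integrable lebesgue (\<lambda>x. indicator (cbox p q) x *\<^sub>R g x)"
    and Q: "open Q"
    and ge: "\<And>p q. cbox p q \<subseteq> Q \<Longrightarrow> c * measure lebesgue (cbox p q) \<le> (\<integral>x. indicator (cbox p q) x *\<^sub>R g x \<partial>lebesgue)"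
  shows "AE x in lebesgue. x \<in> Q \<longrightarrow> c \<le> g x"
proof -
  have si: "set_integrable lebesgue (cbox p q) g" for p q
    using int unfolding set_integrable_def .
  obtain N where N: "negligible N"
    and lim: "\<And>x e. \<lbrakk>x \<notin> N; 0 < e\<rbrakk> \<Longrightarrow> \<exists>d>0. \<forall>h. 0 < h \<and> h < d \<longrightarrow>
         norm (integral (cbox x (x + h *\<^sub>R One)) g /\<^sub>R h ^ DIM('a) - g x) < e"
    using integrable_ccontinuous_explicit[of g] set_lebesgue_integral_eq_integral(1)[OF si] by blast
  have "c \<le> g x" if xQ: "x \<in> Q" and xN: "x \<notin> N" for x
  proof (rule field_le_epsilon)
    fix e :: real assume "e > 0"
    obtain d where d: "d > 0" "\<And>h. 0 < h \<Longrightarrow> h < d \<Longrightarrow> norm (integral (cbox x (x + h *\<^sub>R One)) g /\<^sub>R h ^ DIM('a) - g x) < e"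
      using lim[OF xN \<open>e > 0\<close>] by blast
    obtain r where r: "r > 0" "ball x r \<subseteq> Q"
      using Q xQ openE by blast
    define h where "h = min (d / 2) (r / (2 * real DIM('a)))"
    have h: "h > 0" "h < d" "h * real DIM('a) < r"
    proof -
      show "h > 0" "h < d" using d(1) r(1) by (auto simp: h_def)
      have "h * real DIM('a) \<le> r / (2 * real DIM('a)) * real DIM('a)"
        by (intro mult_right_mono) (auto simp: h_def)
      also have "\<dots> < r" using r(1) by simp
      finally show "h * real DIM('a) < r" .
    qed
    have "cbox x (x + h *\<^sub>R One) \<subseteq> ball x r"
    proof
      fix y assume y: "y \<in> cbox x (x + h *\<^sub>R One)"
      have "norm (y - x) \<le> (\<Sum>b\<in>Basis. \<bar>(y - x) \<bullet> b\<bar>)" by (rule norm_le_l1)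
      also have "\<dots> \<le> (\<Sum>b\<in>(Basis::'a set). h)"
      proof (rule sum_mono)
        fix b :: 'a assume b: "b \<in> Basis"
        then have "x \<bullet> b \<le> y \<bullet> b" "y \<bullet> b \<le> x \<bullet> b + h"
          using y by (auto simp: mem_box inner_add_left)
        then show "\<bar>(y - x) \<bullet> b\<bar> \<le> h" by (simp add: inner_diff_left)
      qed
      also have "\<dots> < r" using h(3) by (simp add: mult.commute)
      finally show "y \<in> ball x r" by (simp add: dist_norm norm_minus_commute)
    qed
    then have "c * measure lebesgue (cbox x (x + h *\<^sub>R One)) \<le> (\<integral>y. indicator (cbox x (x + h *\<^sub>R One)) y *\<^sub>R g y \<partial>lebesgue)"
      using r(2) by (intro ge) auto
    also have "\<dots> = integral (cbox x (x + h *\<^sub>R One)) g"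
      using set_lebesgue_integral_eq_integral(2)[OF si] by (simp add: set_lebesgue_integral_def)
    also have "measure lebesgue (cbox x (x + h *\<^sub>R One)) = h ^ DIM('a)"
      using h(1) by (simp add: content_cbox inner_add_left)
    finally have "c \<le> integral (cbox x (x + h *\<^sub>R One)) g /\<^sub>R h ^ DIM('a)"
      using h(1) by (simp add: field_simps)
    then show "c \<le> g x + e" using d(2)[OF h(1,2)] by (simp add: abs_if split: if_splits)
  qed
  then have "AE x in lebesgue. x \<notin> N \<longrightarrow> (x \<in> Q \<longrightarrow> c \<le> g x)" by blast
  moreover have "AE x in lebesgue. x \<notin> N"
    using N by (simp add: AE_not_in negligible_iff_null_sets)
  ultimately show ?thesis by auto
qed

lemma moll_cbox_limit:
  fixes g :: "'a::euclidean_space \<Rightarrow> real" and p q :: 'a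
  assumes g: "g \<in> L2" and gb [measurable]: "g \<in> borel_measurable borel"
  defines "B \<equiv> cbox p q"
  shows "((\<lambda>e. \<integral>y. indicator B y * moll e g y \<partial>lebesgue) \<longlongrightarrow> (\<integral>x. indicator B x *\<^sub>R g x \<partial>lebesgue)) (at_right 0)"
    and "e > 0 \<Longrightarrow> integrable lebesgue (\<lambda>y. indicator B y * moll e g y)"
proof -
  define \<Phi> where "\<Phi> = (\<lambda>a. \<integral>y. indicator B y * g (a + y) \<partial>lborel)"
  have [measurable]: "B \<in> sets borel" by (auto simp: B_def)
  have sq: "integrable lborel (\<lambda>x. (g x)\<^sup>2)"
    using g by (simp add: L2_def integrable_completion)
  have sqs: "integrable lborel (\<lambda>x. (g (a + x))\<^sup>2)" and sqi: "(\<integral>x. (g (a + x))\<^sup>2 \<partial>lborel) = (\<integral>x. (g x)\<^sup>2 \<partial>lborel)" for a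
    using integrable_lborel_shift[of "\<lambda>x. (g x)\<^sup>2" a] integral_lborel_shift[of "\<lambda>x. (g x)\<^sup>2" a] sq by auto
  have indi: "integrable lborel (\<lambda>x. indicator B x :: real)"
    unfolding B_def by (rule integrable_real_indicator) (auto simp: emeasure_lborel_cbox_eq)
  have le: "\<bar>indicator B y * t\<bar> \<le> indicator B y + t\<^sup>2" for y :: 'a and t :: real
  proof -
    have "\<bar>t\<bar> \<le> 1 + t\<^sup>2" using sum_squares_bound[of "\<bar>t\<bar>" 1] by simp
    then show ?thesis by (auto split: split_indicator)
  qed
  have ii: "integrable lborel (\<lambda>y. indicator B y * g (a + y))" for a
    by (rule Bochner_Integration.integrable_bound[OF Bochner_Integration.integrable_add[OF indi sqs[of a]]])
       (use le in \<open>auto intro: order.trans\<close>)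
  define K where "K = (\<integral>x. indicator B x + (g x)\<^sup>2 \<partial>lborel)"
  have K: "(\<integral>y. \<bar>indicator B y * g (a + y)\<bar> \<partial>lborel) \<le> K" for a
  proof -
    have "(\<integral>y. \<bar>indicator B y * g (a + y)\<bar> \<partial>lborel) \<le> (\<integral>y. indicator B y + (g (a + y))\<^sup>2 \<partial>lborel)"
      using ii indi sqs le by (intro integral_mono) auto
    also have "\<dots> = K" using indi sqs sq by (simp add: K_def sqi)
    finally show ?thesis .
  qed
  have \<Phi>m [measurable]: "\<Phi> \<in> borel_measurable borel"
    unfolding \<Phi>_def by measurable
  have \<Phi>b: "\<bar>\<Phi> a\<bar> \<le> K" for a
    unfolding \<Phi>_def by (rule order.trans[OF integral_abs_bound K])
  have cont: "isCont \<Phi> 0"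
    unfolding continuous_at_sequentially
  proof (intro allI impI)
    fix X :: "nat \<Rightarrow> 'a" assume X: "X \<longlonglongrightarrow> 0"
    then obtain M where M: "\<And>n. norm (X n) \<le> M" "M > 0"
      using convergent_imp_Bseq[of X] by (auto simp: convergent_def Bseq_def)
    obtain R where R: "\<And>y. y \<in> B \<Longrightarrow> norm y \<le> R"
      using bounded_cbox[of p q] unfolding B_def bounded_iff by blast
    have eq: "\<Phi> a = (\<integral>x. indicator B (x - a) * g x \<partial>lborel)" for a
    proof -
      have "(\<integral>x. indicator B (x - a) * g x \<partial>lborel) = (\<integral>x. indicator B ((a + x) - a) * g (a + x) \<partial>lborel)"
        by (rule integral_lborel_shift[symmetric]) measurable
      then show ?thesis by (simp add: \<Phi>_def)
    qed
    have "(\<lambda>n. \<integral>x. indicator B (x - X n) * g x \<partial>lborel) \<longlonglongrightarrow> (\<integral>x. indicator B x * g x \<partial>lborel)"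
    proof (rule integral_dominated_convergence[where w = "\<lambda>x. indicator (cball 0 (R + M)) x + (g x)\<^sup>2"])
      show "integrable lborel (\<lambda>x. indicator (cball 0 (R + M)) x + (g x)\<^sup>2)"
        using sq by (intro Bochner_Integration.integrable_add integrable_real_indicator)
          (use emeasure_bounded_finite[OF bounded_cball, of "0::'a" "R + M"] in auto)
      have "AE x in lebesgue. x \<notin> frontier B"
        unfolding B_def using negligible_convex_frontier[OF convex_box(1)]
        by (intro AE_not_in) (simp add: negligible_iff_null_sets)
      then have "AE x in lborel. x \<notin> frontier B"
        by (simp add: AE_completion_iff)
      then show "AE x in lborel. (\<lambda>n. indicator B (x - X n) * g x) \<longlonglongrightarrow> indicator B x * g x"
      proof eventually_elim
        case (elim x)
        have lim: "(\<lambda>n. x - X n) \<longlonglongrightarrow> x" using tendsto_diff[OF tendsto_const[of x] X] by simp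
        have "\<forall>\<^sub>F n in sequentially. indicator B (x - X n) = (indicator B x :: real)"
        proof (cases "x \<in> B")
          case True
          then have "x \<in> interior B" using elim by (simp add: frontier_def B_def)
          then have "\<forall>\<^sub>F n in sequentially. x - X n \<in> interior B"
            using lim topological_tendstoD by fastforce
          then show ?thesis by eventually_elim (use True interior_subset[of B] in auto)
        next
          case False
          then have "x \<in> - B" "open (- B)" by (auto simp: B_def)
          then have "\<forall>\<^sub>F n in sequentially. x - X n \<in> - B"
            using lim topological_tendstoD by blast
          then show ?thesis by eventually_elim (use False in auto)
        qed
        then show ?case by (intro tendsto_eventually) (auto elim: eventually_mono)
      qed
      fix n
      show "AE x in lborel. norm (indicator B (x - X n) * g x) \<le> indicator (cball 0 (R + M)) x + (g x)\<^sup>2"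
      proof (rule AE_I2)
        fix x
        have "\<bar>g x\<bar> \<le> 1 + (g x)\<^sup>2" using sum_squares_bound[of "\<bar>g x\<bar>" 1] by simp
        moreover have "norm x \<le> R + M" if "x - X n \<in> B"
          using R[OF that] M(1)[of n] norm_triangle_ineq[of "x - X n" "X n"] by simp
        ultimately show "norm (indicator B (x - X n) * g x) \<le> indicator (cball 0 (R + M)) x + (g x)\<^sup>2"
          by (auto split: split_indicator)
      qed
    qed measurable
    then show "(\<Phi> \<circ> X) \<longlonglongrightarrow> \<Phi> 0" by (simp add: comp_def eq)
  qed
  have fub: "(\<integral>y. indicator B y * moll e g y \<partial>lebesgue) = (\<integral>a. heat e a * \<Phi> a \<partial>lebesgue)
      \<and> integrable lebesgue (\<lambda>y. indicator B y * moll e g y)" if "e > 0" for e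
  proof -
    have h: "integrable lborel (heat e :: 'a \<Rightarrow> real)"
      using integrable_heat[OF that] by (simp add: integrable_completion)
    have ip: "integrable (lborel \<Otimes>\<^sub>M lborel) (\<lambda>(a, y). heat e a * (indicator B y * g (a + y)))"
    proof (rule lborel_pair.Fubini_integrable)
      show "integrable lborel (\<lambda>a. \<integral>y. norm (case (a, y) of (a, y) \<Rightarrow> heat e a * (indicator B y * g (a + y))) \<partial>lborel)"
      proof (rule Bochner_Integration.integrable_bound[OF integrable_mult_right[OF h, of K]])
        show "AE a in lborel. norm (\<integral>y. norm (case (a, y) of (a, y) \<Rightarrow> heat e a * (indicator B y * g (a + y))) \<partial>lborel) \<le> norm (K * heat e a)"
        proof (rule AE_I2)
          fix a :: 'a
          have "(\<integral>y. norm (case (a, y) of (a, y) \<Rightarrow> heat e a * (indicator B y * g (a + y))) \<partial>lborel)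
              = heat e a * (\<integral>y. \<bar>indicator B y * g (a + y)\<bar> \<partial>lborel)"
            using heat_nonneg[OF that, of a] by (simp add: abs_mult)
          also have "\<dots> \<le> heat e a * K" by (intro mult_left_mono K heat_nonneg[OF that])
          finally have *: "(\<integral>y. norm (case (a, y) of (a, y) \<Rightarrow> heat e a * (indicator B y * g (a + y))) \<partial>lborel) \<le> heat e a * K" .
          have "0 \<le> (\<integral>y. norm (case (a, y) of (a, y) \<Rightarrow> heat e a * (indicator B y * g (a + y))) \<partial>lborel)"
            by (rule integral_nonneg_AE) auto
          with * show "norm (\<integral>y. norm (case (a, y) of (a, y) \<Rightarrow> heat e a * (indicator B y * g (a + y))) \<partial>lborel) \<le> norm (K * heat e a)"
            by (simp add: mult.commute)
        qed
      qed measurable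
      show "AE a in lborel. integrable lborel (\<lambda>y. case (a, y) of (a, y) \<Rightarrow> heat e a * (indicator B y * g (a + y)))"
        using ii by simp
    qed measurable
    have mm: "moll e g y = (\<integral>a. heat e a * g (a + y) \<partial>lborel)" for y
    proof -
      have "moll e g y = (\<integral>x. g x * heat e (x - y) \<partial>lborel)"
        unfolding moll_def by (rule integral_completion) measurable
      also have "\<dots> = (\<integral>x. g (y + x) * heat e ((y + x) - y) \<partial>lborel)"
        by (rule integral_lborel_shift[symmetric]) measurable
      finally show ?thesis by (simp add: mult.commute add.commute)
    qed
    have eqy: "(\<integral>a. (case (a, y) of (a, y) \<Rightarrow> heat e a * (indicator B y * g (a + y))) \<partial>lborel) = indicator B y * moll e g y" for y
    proof -
      have "(\<integral>a. (case (a, y) of (a, y) \<Rightarrow> heat e a * (indicator B y * g (a + y))) \<partial>lborel)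
          = (\<integral>a. indicator B y * (heat e a * g (a + y)) \<partial>lborel)"
        by (simp add: mult.left_commute)
      then show ?thesis by (simp add: mm)
    qed
    have 1: "integrable lborel (\<lambda>y. indicator B y * moll e g y)"
      using lborel_pair.integrable_snd[of "\<lambda>a y. heat e a * (indicator B y * g (a + y))"] ip eqy by simp
    have "(\<integral>y. indicator B y * moll e g y \<partial>lborel) = (\<integral>a. heat e a * \<Phi> a \<partial>lborel)"
      using lborel_pair.Fubini_integral[OF ip] eqy by (simp add: \<Phi>_def)
    moreover have m1: "(\<lambda>y. indicator B y * moll e g y) \<in> borel_measurable lborel"
      using 1 by auto
    moreover have m2: "(\<lambda>a. heat e a * \<Phi> a) \<in> borel_measurable lborel" by measurable
    ultimately show ?thesis
      using 1 by (simp only: integral_completion integrable_completion simp_thms)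
  qed
  show "e > 0 \<Longrightarrow> integrable lebesgue (\<lambda>y. indicator B y * moll e g y)"
    using fub by blast
  have "((\<lambda>e. \<integral>a. heat e a * \<Phi> a \<partial>lebesgue) \<longlongrightarrow> \<Phi> 0) (at_right 0)"
    by (rule heat_approx_identity[OF borel_measurable_lebesgueI[OF \<Phi>m] \<Phi>b cont])
  moreover have "\<Phi> 0 = (\<integral>x. indicator B x *\<^sub>R g x \<partial>lebesgue)"
    unfolding \<Phi>_def by (subst integral_completion) auto
  moreover have "\<forall>\<^sub>F e in at_right 0. (\<integral>a. heat e a * \<Phi> a \<partial>lebesgue) = (\<integral>y. indicator B y * moll e g y \<partial>lebesgue)"
    using eventually_at_right_less[of 0] by eventually_elim (use fub in auto)
  ultimately show "((\<lambda>e. \<integral>y. indicator B y * moll e g y \<partial>lebesgue) \<longlongrightarrow> (\<integral>x. indicator B x *\<^sub>R g x \<partial>lebesgue)) (at_right 0)"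
    using Lim_transform_eventually by fastforce
qed

lemma AE_ge_of_moll_ge:
  fixes g :: "'a::euclidean_space \<Rightarrow> real"
  assumes g: "g \<in> L2" and Q: "open Q" and "e0 > 0"
    and ge: "\<And>e y. 0 < e \<Longrightarrow> e < e0 \<Longrightarrow> y \<in> Q \<Longrightarrow> c \<le> moll e g y"
  shows "AE x in lebesgue. x \<in> Q \<longrightarrow> c \<le> g x"
proof -
  obtain g' where g' [measurable]: "g' \<in> borel_measurable borel" and AEb: "AE x in lborel. g x = g' x"
    using completion_ex_borel_measurable_real[OF L2_measurable[OF g]] by auto
  have AE: "AE x in lebesgue. g x = g' x" by (rule AE_completion[OF AEb])
  have g'2: "g' \<in> L2" by (rule L2_AE_cong[OF g borel_measurable_lebesgueI[OF g'] AE])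
  have me: "moll e g y = moll e g' y" for e y
  proof -
    have [measurable]: "g \<in> borel_measurable lebesgue" "g' \<in> borel_measurable lebesgue"
        "(\<lambda>x. heat e (x - y)) \<in> borel_measurable lebesgue"
      using L2_measurable[OF g] L2_measurable[OF g'2] by (auto intro!: borel_measurable_lebesgueI)
    show ?thesis unfolding moll_def using AE by (intro integral_cong_AE) auto
  qed
  have "AE x in lebesgue. x \<in> Q \<longrightarrow> c \<le> g' x"
  proof (rule AE_ge_of_cbox_integrals[OF _ Q])
    show "integrable lebesgue (\<lambda>x. indicator (cbox p q) x *\<^sub>R g' x)" for p q
      by (rule L2_integrable_on_bounded[OF g'2]) auto
    fix p q assume pq: "cbox p q \<subseteq> Q"
    show "c * measure lebesgue (cbox p q) \<le> (\<integral>x. indicator (cbox p q) x *\<^sub>R g' x \<partial>lebesgue)"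
    proof (rule tendsto_lowerbound[OF moll_cbox_limit(1)[OF g'2 g']])
      have "\<forall>\<^sub>F e in at_right 0. e < e0" "\<forall>\<^sub>F e::real in at_right 0. 0 < e"
        using \<open>e0 > 0\<close> by (auto simp: eventually_at_right_less eventually_at_right[OF \<open>e0 > 0\<close>])
      then show "\<forall>\<^sub>F e in at_right 0. c * measure lebesgue (cbox p q) \<le> (\<integral>y. indicator (cbox p q) y * moll e g' y \<partial>lebesgue)"
      proof eventually_elim
        case (elim e)
        have "c * measure lebesgue (cbox p q) = (\<integral>y. c * indicator (cbox p q) y \<partial>lebesgue)"
          by simp
        also have "\<dots> \<le> (\<integral>y. indicator (cbox p q) y * moll e g' y \<partial>lebesgue)"
          using ge[OF elim(2,1)] pq me moll_cbox_limit(2)[OF g'2 g' elim(2)]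
            lmeasurable_cbox[of p q]
          by (intro integral_mono integrable_mult_right integrable_real_indicator)
             (auto simp: fmeasurable_def split: split_indicator)
        finally show ?case .
      qed
    qed simp
  qed
  with AE show ?thesis by auto
qed

lemma has_fourier_L1:
  fixes f F :: "'a::euclidean_space \<Rightarrow> complex"
  assumes h: "has_fourier f F" and f: "integrable lebesgue f"
  shows "AE \<xi> in lebesgue. F \<xi> = (\<integral>x. cis (- (x \<bullet> \<xi>)) * f x \<partial>lebesgue)"
proof -
  define T where "T = (\<lambda>R \<xi>. LINT x:cball 0 R|lebesgue. cis (- (x \<bullet> \<xi>)) * f x)"
  define G where "G = (\<lambda>\<xi>. \<integral>x. cis (- (x \<bullet> \<xi>)) * f x \<partial>lebesgue)"
  have lim: "tendsto_L2 T F at_top"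
    using h by (auto simp: has_fourier_def T_def)
  have F: "F \<in> L2" and ev: "\<forall>\<^sub>F R in at_top. T R \<in> L2"
    and l0: "((\<lambda>R. L2_norm (\<lambda>x. T R x - F x)) \<longlongrightarrow> 0) at_top"
    using lim by (auto simp: tendsto_L2_def)
  obtain N where N: "\<And>R. R \<ge> N \<Longrightarrow> T R \<in> L2"
    using ev by (auto simp: eventually_at_top_linorder)
  define S where "S = (\<lambda>n::nat. \<lambda>\<xi>. T (real n + N) \<xi> - F \<xi>)"
  have S: "S n \<in> L2" for n unfolding S_def using N F by (intro L2_diff) auto
  have fl: "filterlim (\<lambda>n. real n + N) at_top sequentially"
    by real_asymp
  have "(\<lambda>n. (L2_norm (S n))\<^sup>2) \<longlonglongrightarrow> 0"
    using tendsto_power[OF filterlim_compose[OF l0 fl], of 2] by (simp add: S_def)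
  then have "(\<lambda>n. \<integral>x. norm ((norm (S n x))\<^sup>2) \<partial>lebesgue) \<longlonglongrightarrow> 0"
    by (simp add: L2_norm_def)
  then obtain r where r: "strict_mono r" "AE x in lebesgue. (\<lambda>n. (norm (S (r n) x))\<^sup>2) \<longlonglongrightarrow> 0"
    using tendsto_L1_AE_subseq[of lebesgue "\<lambda>n x. (norm (S n x))\<^sup>2"] S by (auto simp: L2_def)
  have ptw: "(\<lambda>n. T (real n + N) \<xi>) \<longlonglongrightarrow> G \<xi>" for \<xi>
    unfolding T_def G_def set_lebesgue_integral_def
  proof (rule integral_dominated_convergence[where w = "\<lambda>x. norm (f x)"])
    have [measurable]: "f \<in> borel_measurable lebesgue" using f by auto
    have [measurable]: "(\<lambda>x. cis (- (x \<bullet> \<xi>))) \<in> borel_measurable lebesgue"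
      by (intro borel_measurable_lebesgueI) measurable
    show "(\<lambda>x. cis (- (x \<bullet> \<xi>)) * f x) \<in> borel_measurable lebesgue" by measurable
    show "(\<lambda>x. indicator (cball 0 (real n + N)) x *\<^sub>R (cis (- (x \<bullet> \<xi>)) * f x)) \<in> borel_measurable lebesgue" for n
      by (intro borel_measurable_scaleR borel_measurable_indicator) auto
    show "integrable lebesgue (\<lambda>x. norm (f x))" using f by (rule integrable_norm)
    show "AE x in lebesgue. (\<lambda>n. indicator (cball 0 (real n + N)) x *\<^sub>R (cis (- (x \<bullet> \<xi>)) * f x)) \<longlonglongrightarrow> cis (- (x \<bullet> \<xi>)) * f x"
    proof (intro AE_I2 tendsto_eventually)
      fix x :: 'a
      have "\<forall>\<^sub>F n in sequentially. norm x \<le> real n + N"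
        using fl by (auto simp: filterlim_at_top)
      then show "\<forall>\<^sub>F n in sequentially. indicator (cball 0 (real n + N)) x *\<^sub>R (cis (- (x \<bullet> \<xi>)) * f x) = cis (- (x \<bullet> \<xi>)) * f x"
        by eventually_elim auto
    qed
  qed (auto simp: norm_mult split: split_indicator)
  from r(2) show ?thesis
  proof eventually_elim
    case (elim \<xi>)
    have "(\<lambda>n. norm (S (r n) \<xi>)) \<longlonglongrightarrow> 0"
      using tendsto_real_sqrt[OF elim] by simp
    then have "(\<lambda>n. S (r n) \<xi>) \<longlonglongrightarrow> 0" by (rule tendsto_norm_zero_cancel)
    moreover have "(\<lambda>n. S (r n) \<xi>) \<longlonglongrightarrow> G \<xi> - F \<xi>"
      unfolding S_def using LIMSEQ_subseq_LIMSEQ[OF ptw r(1)] by (intro tendsto_diff) (auto simp: comp_def)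
    ultimately show ?case using LIMSEQ_unique by (fastforce simp: G_def)
  qed
qed

subsection \<open>Multipliers with a positive kernel in a cone\<close>

definition fint :: "('a::euclidean_space \<Rightarrow> complex) \<Rightarrow> 'a \<Rightarrow> complex" where
  "fint F z = (\<integral>\<xi>. F \<xi> * cis (\<xi> \<bullet> z) \<partial>lebesgue)"

text \<open>A way to say, without mentioning the kernel, that the multiplier \<open>m\<close> is the convolution with a
  positive measure of mass \<open>m 0\<close> supported in the ball of radius \<open>\<tau>\<close>.  In this form positivity and
  finite propagation speed pass to pointwise limits.\<close>

definition cone_mult :: "real \<Rightarrow> ('a::euclidean_space \<Rightarrow> real) \<Rightarrow> bool" where
  "cone_mult \<tau> m \<longleftrightarrow> m \<in> borel_measurable borel \<and> (\<exists>C. \<forall>\<xi>. \<bar>m \<xi>\<bar> \<le> C) \<and>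
    (\<forall>F y B. integrable lebesgue F \<longrightarrow> (\<forall>z\<in>cball y \<tau>. B \<le> Re (fint F z)) \<longrightarrow>
      m 0 * B \<le> Re (fint (\<lambda>\<xi>. complex_of_real (m \<xi>) * F \<xi>) y))"

lemma integrable_bounded_mult:
  fixes F :: "'a::euclidean_space \<Rightarrow> complex"
  assumes "integrable lebesgue F" "m \<in> borel_measurable borel" "\<And>\<xi>. norm (m \<xi> :: complex) \<le> C"
  shows "integrable lebesgue (\<lambda>\<xi>. m \<xi> * F \<xi>)"
proof (rule Bochner_Integration.integrable_bound[OF integrable_mult_right[OF assms(1), of "of_real C"]])
  have [measurable]: "F \<in> borel_measurable lebesgue" "m \<in> borel_measurable lebesgue"
    using assms by (auto intro: borel_measurable_lebesgueI)
  show "(\<lambda>\<xi>. m \<xi> * F \<xi>) \<in> borel_measurable lebesgue" by measurable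
  have "C \<ge> 0" using assms(3)[of 0] norm_ge_zero order_trans by blast
  then show "AE x in lebesgue. norm (m x * F x) \<le> norm (complex_of_real C * F x)"
    using assms(3) by (intro AE_I2) (auto simp: norm_mult intro!: mult_right_mono)
qed

lemma integrable_fint:
  fixes F :: "'a::euclidean_space \<Rightarrow> complex"
  assumes "integrable lebesgue F"
  shows "integrable lebesgue (\<lambda>\<xi>. F \<xi> * cis (\<xi> \<bullet> z))"
  using integrable_bounded_mult[OF assms, of "\<lambda>\<xi>. cis (\<xi> \<bullet> z)" 1] by (simp add: mult.commute)

lemma cone_mult_integrable:
  assumes "cone_mult \<tau> m" "integrable lebesgue F"
  shows "integrable lebesgue (\<lambda>\<xi>. complex_of_real (m \<xi>) * F \<xi>)"
proof -
  obtain C where "m \<in> borel_measurable borel" "\<And>\<xi>. \<bar>m \<xi>\<bar> \<le> C"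
    using assms(1) by (auto simp: cone_mult_def)
  then show ?thesis
    by (intro integrable_bounded_mult[OF assms(2), where C = C]) auto
qed

lemma cone_multD:
  assumes "cone_mult \<tau> m" "integrable lebesgue F" "\<And>z. norm (z - y) \<le> \<tau> \<Longrightarrow> B \<le> Re (fint F z)"
  shows "m 0 * B \<le> Re (fint (\<lambda>\<xi>. complex_of_real (m \<xi>) * F \<xi>) y)"
  using assms by (auto simp: cone_mult_def dist_norm norm_minus_commute)

lemma cone_mult_mult:
  assumes 1: "cone_mult \<tau>1 m1" and 2: "cone_mult \<tau>2 m2"
  shows "cone_mult (\<tau>1 + \<tau>2) (\<lambda>\<xi>. m1 \<xi> * m2 \<xi>)"
proof -
  obtain C1 C2 where C: "\<And>\<xi>. \<bar>m1 \<xi>\<bar> \<le> C1" "\<And>\<xi>. \<bar>m2 \<xi>\<bar> \<le> C2"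
    using 1 2 by (auto simp: cone_mult_def)
  have "\<bar>m1 \<xi> * m2 \<xi>\<bar> \<le> C1 * C2" for \<xi>
    using C(1)[of \<xi>] C(2)[of \<xi>] by (auto simp: abs_mult intro!: mult_mono)
  moreover have "m1 0 * m2 0 * B \<le> Re (fint (\<lambda>\<xi>. complex_of_real (m1 \<xi> * m2 \<xi>) * F \<xi>) y)"
    if F: "integrable lebesgue F" and B: "\<forall>z\<in>cball y (\<tau>1 + \<tau>2). B \<le> Re (fint F z)" for F y B
  proof -
    have "m2 0 * B \<le> Re (fint (\<lambda>\<xi>. complex_of_real (m2 \<xi>) * F \<xi>) z)" if z: "norm (z - y) \<le> \<tau>1" for z
    proof (rule cone_multD[OF 2 F])
      fix w assume "norm (w - z) \<le> \<tau>2"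
      then have "w \<in> cball y (\<tau>1 + \<tau>2)"
        using z norm_triangle_ineq[of "w - z" "z - y"] by (simp add: dist_norm norm_minus_commute)
      then show "B \<le> Re (fint F w)" using B by blast
    qed
    from cone_multD[OF 1 cone_mult_integrable[OF 2 F] this] show ?thesis
      by (simp add: mult.assoc)
  qed
  ultimately show ?thesis using 1 2 unfolding cone_mult_def by (auto intro: borel_measurable_times)
qed

lemma cone_mult_scale:
  assumes 1: "cone_mult \<tau> m" and c: "c \<ge> 0"
  shows "cone_mult \<tau> (\<lambda>\<xi>. c * m \<xi>)"
proof -
  obtain C where C: "\<And>\<xi>. \<bar>m \<xi>\<bar> \<le> C" using 1 by (auto simp: cone_mult_def)
  have "\<bar>c * m \<xi>\<bar> \<le> c * C" for \<xi>
    using C[of \<xi>] c by (auto simp: abs_mult intro!: mult_left_mono)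
  moreover have "c * m 0 * B \<le> Re (fint (\<lambda>\<xi>. complex_of_real (c * m \<xi>) * F \<xi>) y)"
    if F: "integrable lebesgue F" and B: "\<forall>z\<in>cball y \<tau>. B \<le> Re (fint F z)" for F y B
  proof -
    have "fint (\<lambda>\<xi>. complex_of_real (c * m \<xi>) * F \<xi>) y = c * fint (\<lambda>\<xi>. complex_of_real (m \<xi>) * F \<xi>) y"
      by (simp add: fint_def mult.assoc)
    moreover have "m 0 * B \<le> Re (fint (\<lambda>\<xi>. complex_of_real (m \<xi>) * F \<xi>) y)"
      using 1 F B by (auto simp: cone_mult_def)
    ultimately show ?thesis using c by (simp add: mult_left_mono mult.assoc)
  qed
  ultimately show ?thesis using 1 unfolding cone_mult_def by (auto intro: borel_measurable_times)
qed

lemma cone_mult_add: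
  assumes 1: "cone_mult \<tau> m1" and 2: "cone_mult \<tau> m2"
  shows "cone_mult \<tau> (\<lambda>\<xi>. m1 \<xi> + m2 \<xi>)"
proof -
  obtain C1 C2 where C: "\<And>\<xi>. \<bar>m1 \<xi>\<bar> \<le> C1" "\<And>\<xi>. \<bar>m2 \<xi>\<bar> \<le> C2"
    using 1 2 by (auto simp: cone_mult_def)
  have "\<bar>m1 \<xi> + m2 \<xi>\<bar> \<le> C1 + C2" for \<xi>
    using C(1)[of \<xi>] C(2)[of \<xi>] by linarith
  moreover have "(m1 0 + m2 0) * B \<le> Re (fint (\<lambda>\<xi>. complex_of_real (m1 \<xi> + m2 \<xi>) * F \<xi>) y)"
    if F: "integrable lebesgue F" and B: "\<forall>z\<in>cball y \<tau>. B \<le> Re (fint F z)" for F y B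
  proof -
    have "fint (\<lambda>\<xi>. complex_of_real (m1 \<xi> + m2 \<xi>) * F \<xi>) y
        = fint (\<lambda>\<xi>. complex_of_real (m1 \<xi>) * F \<xi>) y + fint (\<lambda>\<xi>. complex_of_real (m2 \<xi>) * F \<xi>) y"
      unfolding fint_def
      by (subst Bochner_Integration.integral_add[symmetric])
         (auto intro!: integrable_fint cone_mult_integrable[OF 1 F] cone_mult_integrable[OF 2 F] simp: ring_distribs)
    moreover have "m1 0 * B \<le> Re (fint (\<lambda>\<xi>. complex_of_real (m1 \<xi>) * F \<xi>) y)"
      "m2 0 * B \<le> Re (fint (\<lambda>\<xi>. complex_of_real (m2 \<xi>) * F \<xi>) y)"
      using 1 2 F B by (auto simp: cone_mult_def)
    ultimately show ?thesis by (simp add: ring_distribs)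
  qed
  ultimately show ?thesis using 1 2 unfolding cone_mult_def by (auto intro: borel_measurable_add)
qed

lemma cone_mult_limit:
  fixes m :: "nat \<Rightarrow> 'a::euclidean_space \<Rightarrow> real"
  assumes cm: "\<And>k. cone_mult \<tau> (m k)" and lim: "\<And>\<xi>. (\<lambda>k. m k \<xi>) \<longlonglongrightarrow> M \<xi>"
    and C: "\<And>k \<xi>. \<bar>m k \<xi>\<bar> \<le> C"
  shows "cone_mult \<tau> M"
proof -
  have mk [measurable]: "m k \<in> borel_measurable borel" for k using cm by (simp add: cone_mult_def)
  have M [measurable]: "M \<in> borel_measurable borel"
    by (rule borel_measurable_LIMSEQ_real[OF lim mk])
  have "\<bar>M \<xi>\<bar> \<le> C" for \<xi>
    by (rule LIMSEQ_le_const2[OF tendsto_rabs[OF lim]]) (use C in auto)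
  moreover have "M 0 * B \<le> Re (fint (\<lambda>\<xi>. complex_of_real (M \<xi>) * F \<xi>) y)"
    if F: "integrable lebesgue F" and B: "\<forall>z\<in>cball y \<tau>. B \<le> Re (fint F z)" for F y B
  proof -
    have [measurable]: "F \<in> borel_measurable lebesgue" using F by auto
    have [measurable]: "(\<lambda>x. complex_of_real (M x)) \<in> borel_measurable lebesgue"
      "(\<lambda>x. complex_of_real (m k x)) \<in> borel_measurable lebesgue" for k
      by (intro borel_measurable_lebesgueI; measurable)+
    have "(\<lambda>k. fint (\<lambda>\<xi>. complex_of_real (m k \<xi>) * F \<xi>) y) \<longlonglongrightarrow> fint (\<lambda>\<xi>. complex_of_real (M \<xi>) * F \<xi>) y"
      unfolding fint_def
    proof (rule integral_dominated_convergence[where w = "\<lambda>\<xi>. C * norm (F \<xi>)"])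
      show "integrable lebesgue (\<lambda>\<xi>. C * norm (F \<xi>))"
        using F by (intro integrable_mult_right integrable_norm)
      show "AE \<xi> in lebesgue. (\<lambda>k. complex_of_real (m k \<xi>) * F \<xi> * cis (\<xi> \<bullet> y)) \<longlonglongrightarrow> complex_of_real (M \<xi>) * F \<xi> * cis (\<xi> \<bullet> y)"
        using lim by (intro AE_I2 tendsto_intros)
      show "AE \<xi> in lebesgue. norm (complex_of_real (m k \<xi>) * F \<xi> * cis (\<xi> \<bullet> y)) \<le> C * norm (F \<xi>)" for k
        using C by (intro AE_I2) (auto simp: norm_mult intro!: mult_right_mono)
    qed measurable
    then have "(\<lambda>k. Re (fint (\<lambda>\<xi>. complex_of_real (m k \<xi>) * F \<xi>) y)) \<longlonglongrightarrow> Re (fint (\<lambda>\<xi>. complex_of_real (M \<xi>) * F \<xi>) y)"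
      by (rule tendsto_Re)
    moreover have "(\<lambda>k. m k 0 * B) \<longlonglongrightarrow> M 0 * B"
      by (intro tendsto_intros lim)
    moreover have "m k 0 * B \<le> Re (fint (\<lambda>\<xi>. complex_of_real (m k \<xi>) * F \<xi>) y)" for k
      using cm[of k] F B by (auto simp: cone_mult_def)
    ultimately show ?thesis by (intro LIMSEQ_le[of "\<lambda>k. m k 0 * B"]) auto
  qed
  ultimately show ?thesis using M unfolding cone_mult_def by blast
qed

lemma cone_mult_integral:
  fixes m :: "real \<Rightarrow> 'a::euclidean_space \<Rightarrow> real"
  assumes meas [measurable]: "(\<lambda>(s, \<xi>). m s \<xi>) \<in> borel_measurable borel"
    and C: "\<And>s \<xi>. s \<in> {0..t} \<Longrightarrow> \<bar>m s \<xi>\<bar> \<le> C"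
    and cm: "\<And>s. s \<in> {0..t} \<Longrightarrow> cone_mult \<tau> (m s)" and t: "t \<ge> 0"
  shows "cone_mult \<tau> (\<lambda>\<xi>. \<integral>s. indicator {0..t} s * m s \<xi> \<partial>lborel)"
proof -
  define k where "k = (\<lambda>(s, \<xi>). indicator {0..t} s * m s \<xi>)"
  have kb: "\<bar>k p\<bar> \<le> C" for p
    using C[of 0 0] t C[of "fst p" "snd p"] by (cases p) (auto simp: k_def split: split_indicator)
  have meas2: "(\<lambda>(s, \<xi>). m s \<xi>) \<in> borel_measurable (borel \<Otimes>\<^sub>M borel)"
    using meas by (simp add: borel_prod)
  have km: "k \<in> borel_measurable (borel \<Otimes>\<^sub>M borel)"
    unfolding k_def using meas2 by measurable
  have kl: "k \<in> borel_measurable (lborel \<Otimes>\<^sub>M borel)"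
    using km by (simp cong: measurable_cong_sets sets_pair_measure_cong)
  have kp: "(\<lambda>p. complex_of_real (k p)) \<in> borel_measurable (lebesgue \<Otimes>\<^sub>M lebesgue)"
    by (rule borel_measurable_pair_lebesgueI) (use km in \<open>simp add: borel_prod\<close>)
  have sw: "(\<lambda>(\<xi>, s). k (s, \<xi>)) \<in> borel_measurable (borel \<Otimes>\<^sub>M lborel)"
    using measurable_pair_swap[OF kl] by simp
  let ?M = "\<lambda>\<xi>. \<integral>s. k (s, \<xi>) \<partial>lborel"
  have Mm: "?M \<in> borel_measurable borel"
    using lborel.borel_measurable_lebesgue_integral[OF sw] by simp
  have inti: "integrable lborel (indicator {0..t} :: real \<Rightarrow> real)"
    using t by simp
  have Mb: "\<bar>?M \<xi>\<bar> \<le> C * t" for \<xi>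
  proof -
    have "\<bar>?M \<xi>\<bar> \<le> (\<integral>s. \<bar>k (s, \<xi>)\<bar> \<partial>lborel)" by (rule integral_abs_bound)
    also have "\<dots> \<le> (\<integral>s. C * indicator {0..t} s \<partial>lborel)"
    proof (rule integral_mono')
      show "\<bar>k (s, \<xi>)\<bar> \<le> C * indicator {0..t} s" for s
        using kb[of "(s, \<xi>)"] by (auto simp: k_def split: split_indicator)
      show "0 \<le> C * indicator {0..t} s" for s :: real
        using kb[of "(s, \<xi>)"] by (auto split: split_indicator)
    qed (use inti in simp)
    finally show ?thesis using t by simp
  qed
  have main: "?M 0 * B \<le> Re (fint (\<lambda>\<xi>. complex_of_real (?M \<xi>) * F \<xi>) y)"
    if F: "integrable lebesgue F" and B: "\<forall>z\<in>cball y \<tau>. B \<le> Re (fint F z)" for F y B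
  proof -
    let ?f = "\<lambda>s::real. complex_of_real (indicator {0..t} s)"
    let ?g = "\<lambda>\<xi>. F \<xi> * cis (\<xi> \<bullet> y)"
    have lmi: "integrable lebesgue (indicator {0..t} :: real \<Rightarrow> real)"
      by (subst integrable_completion) (use inti in auto)
    then have fi: "integrable lebesgue ?f" by (rule integrable_of_real)
    have ii: "integrable (lebesgue \<Otimes>\<^sub>M lebesgue) (\<lambda>(s, \<xi>). complex_of_real (k (s, \<xi>)) * (?f s * ?g \<xi>))"
      using integrable_pair_bounded_mult[OF fi integrable_fint[OF F] kp, of C] kb by simp
    have ki: "complex_of_real (k (s, \<xi>)) * (?f s * w) = complex_of_real (k (s, \<xi>)) * w" for s \<xi> w
      by (auto simp: k_def split: split_indicator)
    have Mr: "?M \<xi> = (\<integral>s. k (s, \<xi>) \<partial>lebesgue)" for \<xi>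
    proof -
      have "(\<lambda>s. k (s, \<xi>)) \<in> borel_measurable lborel"
        using measurable_compose[OF measurable_Pair2' kl] by simp
      then show ?thesis by (rule integral_completion[symmetric])
    qed
    have Meq: "complex_of_real (?M \<xi>) = (\<integral>s. complex_of_real (k (s, \<xi>)) \<partial>lebesgue)" for \<xi>
      unfolding Mr by (rule integral_complex_of_real[symmetric])
    have "fint (\<lambda>\<xi>. complex_of_real (?M \<xi>) * F \<xi>) y
        = (\<integral>\<xi>. (\<integral>s. complex_of_real (k (s, \<xi>)) * (?f s * ?g \<xi>) \<partial>lebesgue) \<partial>lebesgue)"
      unfolding fint_def Meq ki by (simp add: mult.assoc)
    also have "\<dots> = (\<integral>s. (\<integral>\<xi>. complex_of_real (k (s, \<xi>)) * (?f s * ?g \<xi>) \<partial>lebesgue) \<partial>lebesgue)"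
      by (rule lebesgue_pair.Fubini_integral[OF ii])
    finally have eq: "fint (\<lambda>\<xi>. complex_of_real (?M \<xi>) * F \<xi>) y
       = (\<integral>s. (\<integral>\<xi>. complex_of_real (k (s, \<xi>)) * (?f s * ?g \<xi>) \<partial>lebesgue) \<partial>lebesgue)" .
    have isum: "integrable lebesgue (\<lambda>s. \<integral>\<xi>. complex_of_real (k (s, \<xi>)) * (?f s * ?g \<xi>) \<partial>lebesgue)"
      using lebesgue_pair.integrable_fst[OF ii] by simp
    have k0: "integrable lebesgue (\<lambda>s. k (s, 0) * B)"
    proof -
      have "integrable lborel (\<lambda>s. k (s, 0))"
      proof (rule Bochner_Integration.integrable_bound[OF integrable_mult_right[OF inti, of C]])
        show "(\<lambda>s. k (s, 0)) \<in> borel_measurable lborel"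
          using measurable_compose[OF measurable_Pair2' kl] by simp
        show "AE s in lborel. norm (k (s, 0)) \<le> norm (C * indicator {0..t} s)"
          using C[of _ 0] by (intro AE_I2) (auto simp: k_def intro: order.trans[OF _ abs_ge_self] split: split_indicator)
      qed
      then show ?thesis by (intro integrable_mult_left) (subst integrable_completion, auto)
    qed
    have "?M 0 * B = (\<integral>s. k (s, 0) * B \<partial>lebesgue)"
      unfolding Mr by (rule integral_mult_left_zero[symmetric])
    also have "\<dots> \<le> (\<integral>s. Re (\<integral>\<xi>. complex_of_real (k (s, \<xi>)) * (?f s * ?g \<xi>) \<partial>lebesgue) \<partial>lebesgue)"
    proof (rule integral_mono[OF k0])
      show "integrable lebesgue (\<lambda>s. Re (\<integral>\<xi>. complex_of_real (k (s, \<xi>)) * (?f s * ?g \<xi>) \<partial>lebesgue))"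
        using isum by (rule integrable_Re)
      fix s
      show "k (s, 0) * B \<le> Re (\<integral>\<xi>. complex_of_real (k (s, \<xi>)) * (?f s * ?g \<xi>) \<partial>lebesgue)"
      proof (cases "s \<in> {0..t}")
        case True
        have "m s 0 * B \<le> Re (fint (\<lambda>\<xi>. complex_of_real (m s \<xi>) * F \<xi>) y)"
          using cm[OF True] F B by (auto simp: cone_mult_def)
        then show ?thesis unfolding ki using True by (simp add: k_def fint_def mult.assoc)
      next
        case False
        then show ?thesis by (simp add: k_def)
      qed
    qed
    also have "\<dots> = Re (fint (\<lambda>\<xi>. complex_of_real (?M \<xi>) * F \<xi>) y)"
      unfolding eq by (rule integral_Re[OF isum])
    finally show ?thesis .
  qed
  have "cone_mult \<tau> ?M"
    unfolding cone_mult_def using Mm Mb main by blast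
  then show ?thesis by (simp add: k_def)
qed

subsection \<open>The wave propagator in dimension at most three\<close>

lemma lborel_distr_orthogonal:
  fixes f :: "real^'n::{finite,wellorder} \<Rightarrow> real^'n::{finite,wellorder}"
  assumes f: "orthogonal_transformation f"
  shows "distr lborel borel f = lborel"
proof (rule lborel_eqI[symmetric])
  have fm: "f \<in> borel_measurable borel"
    by (intro borel_measurable_continuous_onI linear_continuous_on linear_conv_bounded_linear[THEN iffD1])
       (rule orthogonal_transformation_linear[OF f])
  fix l u :: "real^'n::{finite,wellorder}"
  assume lu: "\<And>b. b \<in> Basis \<Longrightarrow> l \<bullet> b \<le> u \<bullet> b"
  have g: "orthogonal_transformation (inv f)" by (rule orthogonal_transformation_inv[OF f])
  have eq: "f -` box l u = inv f ` box l u"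
    by (rule bij_vimage_eq_inv_image[OF orthogonal_transformation_bij[OF f]])
  have b: "f -` box l u \<in> sets borel" using measurable_sets_borel[OF fm, of "box l u"] by simp
  have lm: "inv f ` box l u \<in> lmeasurable" "measure lebesgue (inv f ` box l u) = measure lebesgue (box l u)"
    using measurable_orthogonal_image[OF g, of "box l u"] measure_orthogonal_image[OF g, of "box l u"] by auto
  have "emeasure (distr lborel borel f) (box l u) = emeasure lborel (f -` box l u)"
    using fm by (subst emeasure_distr) auto
  also have "\<dots> = emeasure lebesgue (f -` box l u)"
    using b by (simp add: emeasure_completion)
  also have "\<dots> = ennreal (measure lebesgue (box l u))"
    unfolding eq lm(2)[symmetric] by (rule emeasure_eq_measure2[OF lm(1)])
  also have "measure lebesgue (box l u) = (\<Prod>b\<in>Basis. (u - l) \<bullet> b)"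
    using lu by (simp add: measure_lborel_box)
  finally show "emeasure (distr lborel borel f) (box l u) = ennreal (\<Prod>b\<in>Basis. (u - l) \<bullet> b)" .
qed simp

definition vec3 :: "real \<times> (real \<times> real) \<Rightarrow> real^3" where
  "vec3 p = vector [fst p, fst (snd p), snd (snd p)]"

lemma vec3_nth [simp]: "vec3 p $ 1 = fst p" "vec3 p $ 2 = fst (snd p)" "vec3 p $ 3 = snd (snd p)"
  by (auto simp: vec3_def)

lemma vec3_measurable [measurable]: "vec3 \<in> borel \<rightarrow>\<^sub>M borel"
proof -
  have "linear vec3"
    by (auto intro!: linearI simp: vec_eq_iff forall_3)
  then show ?thesis
    by (intro borel_measurable_continuous_onI linear_continuous_on) (simp add: linear_conv_bounded_linear)
qed

lemma lborel_distr_vec3: "distr lborel borel vec3 = lborel"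
proof (rule lborel_eqI[symmetric])
  fix l u :: "real^3"
  assume lu: "\<And>b. b \<in> Basis \<Longrightarrow> l \<bullet> b \<le> u \<bullet> b"
  then have le: "l $ i \<le> u $ i" for i
    using axis_in_Basis_iff[of i "1::real"] by (force simp: inner_axis Basis_vec_def)
  have "vec3 -` box l u = {l$1<..<u$1} \<times> ({l$2<..<u$2} \<times> {l$3<..<u$3})"
    by (auto simp: mem_box_cart forall_3)
  then have "emeasure (distr lborel borel vec3) (box l u)
      = emeasure (lborel \<Otimes>\<^sub>M (lborel :: (real \<times> real) measure)) ({l$1<..<u$1} \<times> ({l$2<..<u$2} \<times> {l$3<..<u$3}))"
    by (subst emeasure_distr) (auto simp: lborel_prod)
  also have "\<dots> = ennreal (u$1 - l$1) * (ennreal (u$2 - l$2) * ennreal (u$3 - l$3))"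
  proof -
    have "emeasure (lborel :: (real \<times> real) measure) ({l$2<..<u$2} \<times> {l$3<..<u$3}) = ennreal (u$2 - l$2) * ennreal (u$3 - l$3)"
      unfolding lborel_prod[symmetric] using le by (subst lborel.emeasure_pair_measure_Times) auto
    moreover have "{l$2<..<u$2} \<times> {l$3<..<u$3} \<in> sets (lborel :: (real \<times> real) measure)"
      by (simp add: borel_Times)
    ultimately show ?thesis
      using le by (subst lborel.emeasure_pair_measure_Times) auto
  qed
  also have "\<dots> = ennreal (\<Prod>i\<in>UNIV. (u - l) $ i)"
  proof -
    have "(\<Prod>i\<in>UNIV. (u - l) $ i) = (u$1 - l$1) * ((u$2 - l$2) * (u$3 - l$3))"
      unfolding UNIV_3 by simp
    then show ?thesis using le by (simp add: ennreal_mult)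
  qed
  also have "(\<Prod>i\<in>UNIV. (u - l) $ i) = (\<Prod>b\<in>Basis. (u - l) \<bullet> b)"
    by (simp add: Basis_vec_def cart_eq_inner_axis axis_eq_axis prod.UNION_disjoint)
  finally show "emeasure (distr lborel borel vec3) (box l u) = ennreal (\<Prod>b\<in>Basis. (u - l) \<bullet> b)" .
qed simp

text \<open>The Fourier transform of the indicator of the ball of radius \<open>r\<close> in \<open>\<real>\<^sup>3\<close> at a point of norm \<open>\<rho>\<close>.\<close>

definition ball_hat :: "real \<Rightarrow> real \<Rightarrow> real" where
  "ball_hat r \<rho> = (if \<rho> = 0 then 4 * pi * r ^ 3 / 3 else 4 * pi * (sin (r * \<rho>) - r * \<rho> * cos (r * \<rho>)) / \<rho> ^ 3)"

lemma integral_slices: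
  assumes r: "r \<ge> 0"
  shows "(\<integral>a. complex_of_real (pi * (r\<^sup>2 - a\<^sup>2) * indicator {-r..r} a) * cis (\<rho> * a) \<partial>lborel) = complex_of_real (ball_hat r \<rho>)"
proof -
  have ir: "has_bochner_integral lborel (\<lambda>a. pi * (r\<^sup>2 - a\<^sup>2) * cos (\<rho> * a) * indicator {-r..r} a) (ball_hat r \<rho>)"
  proof (cases "\<rho> = 0")
    case True
    have "has_bochner_integral lborel (\<lambda>a. pi * (r\<^sup>2 - a\<^sup>2) * cos (\<rho> * a) * indicator {-r..r} a)
        ((\<lambda>a. pi * (r\<^sup>2 * a - a ^ 3 / 3)) r - (\<lambda>a. pi * (r\<^sup>2 * a - a ^ 3 / 3)) (-r))"
      using r True by (intro has_bochner_integral_FTC_Icc_real) (auto intro!: derivative_eq_intros continuous_intros)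
    moreover have "(\<lambda>a. pi * (r\<^sup>2 * a - a ^ 3 / 3)) r - (\<lambda>a. pi * (r\<^sup>2 * a - a ^ 3 / 3)) (-r) = ball_hat r \<rho>"
      using True by (simp add: ball_hat_def power2_eq_square power3_eq_cube field_simps)
    ultimately show ?thesis by simp
  next
    case False
    let ?F = "\<lambda>a. pi * ((r\<^sup>2 - a\<^sup>2) * sin (\<rho> * a) / \<rho> - 2 * a * cos (\<rho> * a) / \<rho>\<^sup>2 + 2 * sin (\<rho> * a) / \<rho> ^ 3)"
    have "has_bochner_integral lborel (\<lambda>a. pi * (r\<^sup>2 - a\<^sup>2) * cos (\<rho> * a) * indicator {-r..r} a) (?F r - ?F (-r))"
    proof (rule has_bochner_integral_FTC_Icc_real)
      show "DERIV ?F a :> pi * (r\<^sup>2 - a\<^sup>2) * cos (\<rho> * a)" for a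
        using False by (auto intro!: derivative_eq_intros simp: field_simps power2_eq_square power3_eq_cube)
      show "isCont (\<lambda>a. pi * (r\<^sup>2 - a\<^sup>2) * cos (\<rho> * a)) a" for a
        by (intro continuous_intros)
    qed (use r in simp)
    moreover have "?F r - ?F (-r) = ball_hat r \<rho>"
      using False by (simp add: ball_hat_def power2_eq_square power3_eq_cube field_simps)
    ultimately show ?thesis by simp
  qed
  have ii: "has_bochner_integral lborel (\<lambda>a. pi * (r\<^sup>2 - a\<^sup>2) * sin (\<rho> * a) * indicator {-r..r} a) 0"
  proof (cases "\<rho> = 0")
    case False
    let ?F = "\<lambda>a. pi * (- (r\<^sup>2 - a\<^sup>2) * cos (\<rho> * a) / \<rho> - 2 * a * sin (\<rho> * a) / \<rho>\<^sup>2 - 2 * cos (\<rho> * a) / \<rho> ^ 3)"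
    have "has_bochner_integral lborel (\<lambda>a. pi * (r\<^sup>2 - a\<^sup>2) * sin (\<rho> * a) * indicator {-r..r} a) (?F r - ?F (-r))"
    proof (rule has_bochner_integral_FTC_Icc_real)
      show "DERIV ?F a :> pi * (r\<^sup>2 - a\<^sup>2) * sin (\<rho> * a)" for a
        using False by (auto intro!: derivative_eq_intros simp: field_simps power2_eq_square power3_eq_cube)
      show "isCont (\<lambda>a. pi * (r\<^sup>2 - a\<^sup>2) * sin (\<rho> * a)) a" for a
        by (intro continuous_intros)
    qed (use r in simp)
    then show ?thesis by simp
  qed (simp add: has_bochner_integral_zero)
  have "has_bochner_integral lborel (\<lambda>a. complex_of_real (pi * (r\<^sup>2 - a\<^sup>2) * cos (\<rho> * a) * indicator {-r..r} a)
       + \<i> * complex_of_real (pi * (r\<^sup>2 - a\<^sup>2) * sin (\<rho> * a) * indicator {-r..r} a))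
      (complex_of_real (ball_hat r \<rho>) + \<i> * complex_of_real 0)"
    by (intro has_bochner_integral_add has_bochner_integral_mult_right has_bochner_integral_of_real ir ii)
  moreover have "complex_of_real (pi * (r\<^sup>2 - a\<^sup>2) * cos (\<rho> * a) * indicator {-r..r} a)
       + \<i> * complex_of_real (pi * (r\<^sup>2 - a\<^sup>2) * sin (\<rho> * a) * indicator {-r..r} a)
     = complex_of_real (pi * (r\<^sup>2 - a\<^sup>2) * indicator {-r..r} a) * cis (\<rho> * a)" for a
    by (simp add: complex_eq_iff)
  ultimately have "has_bochner_integral lborel (\<lambda>a. complex_of_real (pi * (r\<^sup>2 - a\<^sup>2) * indicator {-r..r} a) * cis (\<rho> * a))
      (complex_of_real (ball_hat r \<rho>))"
    by simp
  then show ?thesis by (rule has_bochner_integral_integral_eq)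
qed

lemma ball_fourier:
  fixes \<eta> :: "real^3"
  assumes r: "r \<ge> 0"
  shows "(\<integral>x. complex_of_real (indicator (cball 0 r) x) * cis (x \<bullet> \<eta>) \<partial>lebesgue) = complex_of_real (ball_hat r (norm \<eta>))"
proof -
  define \<rho> where "\<rho> = norm \<eta>"
  obtain f :: "real^3 \<Rightarrow> real^3" where f: "orthogonal_transformation f" and fe: "f (\<rho> *\<^sub>R axis 1 1) = \<eta>"
    by (rule orthogonal_transformation_exists[of "\<rho> *\<^sub>R axis 1 1" \<eta>]) (auto simp: \<rho>_def)
  have fm [measurable]: "f \<in> borel_measurable borel"
    by (intro borel_measurable_continuous_onI linear_continuous_on linear_conv_bounded_linear[THEN iffD1])
       (rule orthogonal_transformation_linear[OF f])
  have cb [measurable]: "cball 0 r \<in> sets (borel :: (real^3) measure)" by simp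
  have [measurable]: "(\<lambda>x::real^3. x $ 1) \<in> borel_measurable borel"
    by (intro borel_measurable_continuous_onI continuous_intros)
  let ?g = "\<lambda>x::real^3. complex_of_real (indicator (cball 0 r) x) * cis (x \<bullet> \<eta>)"
  have gm: "?g \<in> borel_measurable borel"
    using cb by measurable
  let ?h = "\<lambda>x::real^3. complex_of_real (indicator (cball 0 r) x) * cis (\<rho> * x $ 1)"
  have hm: "?h \<in> borel_measurable borel"
    using cb by measurable
  have "(\<integral>x. ?g x \<partial>lebesgue) = (\<integral>x. ?g x \<partial>lborel)" by (rule integral_completion) (use gm in simp)
  also have "\<dots> = (\<integral>x. ?g (f x) \<partial>lborel)"
    by (subst lborel_distr_orthogonal[OF f, symmetric], subst integral_distr) (use gm in auto)
  also have "\<dots> = (\<integral>x. ?h x \<partial>lborel)"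
  proof (intro Bochner_Integration.integral_cong refl)
    fix x
    have "f x \<bullet> \<eta> = x \<bullet> (\<rho> *\<^sub>R axis 1 1)"
      using f unfolding fe[symmetric] orthogonal_transformation_def by blast
    then show "?g (f x) = ?h x"
      using orthogonal_transformation_norm[OF f, of x] by (simp add: inner_axis indicator_def)
  qed
  also have "\<dots> = (\<integral>p. ?h (vec3 p) \<partial>lborel)"
    by (subst lborel_distr_vec3[symmetric], subst integral_distr) (use hm in auto)
  also have "\<dots> = (\<integral>p. (case p of (a, q) \<Rightarrow> complex_of_real (indicator {p :: real \<times> (real \<times> real). (fst p)\<^sup>2 + (norm (snd p))\<^sup>2 \<le> r\<^sup>2} (a, q)) * cis (\<rho> * a)) \<partial>(lborel \<Otimes>\<^sub>M lborel))"
    unfolding lborel_prod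
  proof (intro Bochner_Integration.integral_cong refl)
    fix p :: "real \<times> (real \<times> real)"
    have "norm (vec3 p) \<le> r \<longleftrightarrow> (norm (vec3 p))\<^sup>2 \<le> r\<^sup>2"
      using abs_le_square_iff[of "norm (vec3 p)" r] r by simp
    also have "(norm (vec3 p))\<^sup>2 = (fst p)\<^sup>2 + (norm (snd p))\<^sup>2"
      unfolding power2_norm_eq_inner by (simp add: inner_vec_def sum_3 power2_eq_square inner_prod_def)
    finally show "?h (vec3 p) = (case p of (a, q) \<Rightarrow> complex_of_real (indicator {p :: real \<times> (real \<times> real). (fst p)\<^sup>2 + (norm (snd p))\<^sup>2 \<le> r\<^sup>2} (a, q)) * cis (\<rho> * a))"
      by (cases p) (simp add: indicator_def)
  qed
  also have "\<dots> = (\<integral>a. (\<integral>q. complex_of_real (indicator {p :: real \<times> (real \<times> real). (fst p)\<^sup>2 + (norm (snd p))\<^sup>2 \<le> r\<^sup>2} (a, q)) * cis (\<rho> * a) \<partial>lborel) \<partial>lborel)"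
  proof (subst lborel_pair.integral_fst'[symmetric])
    let ?A = "{p :: real \<times> (real \<times> real). (fst p)\<^sup>2 + (norm (snd p))\<^sup>2 \<le> r\<^sup>2}"
    have A [measurable]: "?A \<in> sets borel"
      by (intro borel_closed closed_Collect_le continuous_intros)
    have c [measurable]: "(\<lambda>p::real \<times> (real \<times> real). cis (\<rho> * fst p)) \<in> borel_measurable borel"
      by (intro borel_measurable_continuous_onI continuous_intros)
    have Ab: "?A \<subseteq> cball 0 r"
    proof
      fix p :: "real \<times> (real \<times> real)" assume "p \<in> ?A"
      then have "(norm p)\<^sup>2 \<le> r\<^sup>2" by (simp add: norm_prod_def[of p])
      then show "p \<in> cball 0 r" using abs_le_square_iff[of "norm p" r] r by simp
    qed
    have "integrable (lborel :: (real \<times> (real \<times> real)) measure) (indicator ?A :: _ \<Rightarrow> real)"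
      using emeasure_bounded_finite[OF bounded_subset[OF bounded_cball Ab]] A by (intro integrable_real_indicator) auto
    then have "integrable (lborel :: (real \<times> (real \<times> real)) measure) (\<lambda>p. cis (\<rho> * fst p) * complex_of_real (indicator ?A p))"
    proof (rule Bochner_Integration.integrable_bound)
      show "(\<lambda>p. cis (\<rho> * fst p) * complex_of_real (indicator ?A p)) \<in> borel_measurable lborel"
        by measurable
    qed (auto simp: norm_mult)
    then show "integrable (lborel \<Otimes>\<^sub>M lborel) (\<lambda>p. case p of (a, q) \<Rightarrow> complex_of_real (indicator ?A (a, q)) * cis (\<rho> * a))"
      unfolding lborel_prod by (simp add: case_prod_beta mult.commute)
  qed simp
  also have "\<dots> = (\<integral>a. complex_of_real (pi * (r\<^sup>2 - a\<^sup>2) * indicator {-r..r} a) * cis (\<rho> * a) \<partial>lborel)"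
  proof (intro Bochner_Integration.integral_cong refl)
    fix a :: real
    show "(\<integral>q. complex_of_real (indicator {p :: real \<times> (real \<times> real). (fst p)\<^sup>2 + (norm (snd p))\<^sup>2 \<le> r\<^sup>2} (a, q :: real \<times> real)) * cis (\<rho> * a) \<partial>lborel)
       = complex_of_real (pi * (r\<^sup>2 - a\<^sup>2) * indicator {-r..r} a) * cis (\<rho> * a)"
    proof (cases "a \<in> {-r..r}")
      case True
      then have ar: "a\<^sup>2 \<le> r\<^sup>2" using abs_le_square_iff[of a r] by auto
      have real_le_rsqrt_iff: "norm q \<le> sqrt (r\<^sup>2 - a\<^sup>2) \<longleftrightarrow> (norm q)\<^sup>2 \<le> r\<^sup>2 - a\<^sup>2" for q :: "real \<times> real"
        by (metis norm_ge_zero real_le_rsqrt real_sqrt_ge_0_iff real_sqrt_le_iff real_sqrt_abs abs_norm_cancel)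
      have "indicator {p :: real \<times> (real \<times> real). (fst p)\<^sup>2 + (norm (snd p))\<^sup>2 \<le> r\<^sup>2} (a, q) = (indicator (cball 0 (sqrt (r\<^sup>2 - a\<^sup>2))) q :: real)" for q :: "real \<times> real"
        using ar by (simp add: indicator_def real_le_rsqrt_iff algebra_simps)
      moreover have "(\<integral>q. complex_of_real (indicator (cball 0 (sqrt (r\<^sup>2 - a\<^sup>2))) (q :: real \<times> real)) \<partial>lborel) = complex_of_real (pi * (r\<^sup>2 - a\<^sup>2))"
        using ar content_cball[of "sqrt (r\<^sup>2 - a\<^sup>2)" "0 :: real \<times> real"] by (simp add: unit_ball_vol_2)
      ultimately show ?thesis using True by simp
    next
      case False
      then have "a\<^sup>2 > r\<^sup>2" using abs_le_square_iff[of a r] r by (auto simp: abs_le_iff)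
      then have "\<not> a\<^sup>2 + (norm q)\<^sup>2 \<le> r\<^sup>2" for q :: "real \<times> real"
        using zero_le_power2[of "norm q"] by linarith
      then show ?thesis using False by simp
    qed
  qed
  also have "\<dots> = complex_of_real (ball_hat r \<rho>)" by (rule integral_slices[OF r])
  finally show ?thesis by (simp add: \<rho>_def)
qed

definition wave :: "real \<Rightarrow> 'a::euclidean_space \<Rightarrow> real" where
  "wave t \<xi> = (if \<xi> = 0 then t else sin (t * norm \<xi>) / norm \<xi>)"

lemma ball_hat_measurable [measurable]: "ball_hat r \<in> borel_measurable borel"
  unfolding ball_hat_def by measurable

lemma DERIV_ball_hat:
  "((\<lambda>r. ball_hat r (norm \<xi>)) has_real_derivative 4 * pi * t * wave t \<xi>) (at t)"
proof (cases "\<xi> = 0")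
  case True
  then show ?thesis
    by (auto simp: ball_hat_def wave_def power2_eq_square intro!: derivative_eq_intros)
next
  case False
  then show ?thesis
    by (auto simp: ball_hat_def wave_def field_simps power2_eq_square power3_eq_cube intro!: derivative_eq_intros)
qed

lemma integrable_ball: "integrable lebesgue (\<lambda>x::'a::euclidean_space. complex_of_real (indicator (cball 0 r) x))"
proof -
  have "integrable lebesgue (indicator (cball 0 r) :: 'a \<Rightarrow> real)"
    using lmeasurable_cball[of "0::'a" r] by (intro integrable_real_indicator) (auto simp: fmeasurable_def)
  then show ?thesis by (rule integrable_of_real)
qed

text \<open>Descent: an isometry \<open>A\<close> into \<open>\<real>\<^sup>3\<close> turns the characters of \<open>\<real>\<^sup>3\<close> into characters of a space of
  dimension at most three, so averages over balls of \<open>\<real>\<^sup>3\<close> are averages of translations there.\<close>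

lemma shell_fint:
  fixes A :: "'a::euclidean_space \<Rightarrow> real^3"
  assumes A: "linear A" "\<And>\<xi>. norm (A \<xi>) = norm \<xi>" and F: "integrable lebesgue F" and r: "r \<ge> 0"
  shows "fint (\<lambda>\<xi>. complex_of_real (ball_hat r (norm \<xi>)) * F \<xi>) y
      = (\<integral>x. complex_of_real (indicator (cball 0 r) x) * fint F (y + adjoint A x) \<partial>lebesgue)"
    and "integrable lebesgue (\<lambda>x. complex_of_real (indicator (cball 0 r) x) * fint F (y + adjoint A x))"
proof -
  let ?f = "\<lambda>x::real^3. complex_of_real (indicator (cball 0 r) x)"
  let ?g = "\<lambda>\<xi>. F \<xi> * cis (\<xi> \<bullet> y)"
  let ?k = "\<lambda>p. cis (fst p \<bullet> A (snd p))"
  have bl: "bounded_linear A" using A(1) by (simp add: linear_conv_bounded_linear)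
  have km: "?k \<in> borel_measurable (lebesgue \<Otimes>\<^sub>M lebesgue)"
    by (intro borel_measurable_pair_lebesgueI borel_measurable_continuous_onI continuous_intros
        bounded_linear.continuous_on[OF bl])
  have ii: "integrable (lebesgue \<Otimes>\<^sub>M lebesgue) (\<lambda>(x, \<xi>). cis (x \<bullet> A \<xi>) * (?f x * ?g \<xi>))"
    using integrable_pair_bounded_mult[OF integrable_ball integrable_fint[OF F] km, of 1] by simp
  have inner: "(\<integral>\<xi>. cis (x \<bullet> A \<xi>) * (?f x * ?g \<xi>) \<partial>lebesgue) = ?f x * fint F (y + adjoint A x)" for x
  proof -
    have "cis (x \<bullet> A \<xi>) * (?f x * ?g \<xi>) = ?f x * (F \<xi> * cis (\<xi> \<bullet> (y + adjoint A x)))" for \<xi>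
    proof -
      have "x \<bullet> A \<xi> = \<xi> \<bullet> adjoint A x" by (metis adjoint_works[OF A(1)] inner_commute)
      then have "cis (\<xi> \<bullet> (y + adjoint A x)) = cis (\<xi> \<bullet> y) * cis (x \<bullet> A \<xi>)"
        by (simp add: inner_add_right cis_mult)
      then show ?thesis by (simp only: mult_ac)
    qed
    then show ?thesis unfolding fint_def by (simp only: integral_mult_right_zero)
  qed
  have "fint (\<lambda>\<xi>. complex_of_real (ball_hat r (norm \<xi>)) * F \<xi>) y
      = (\<integral>\<xi>. (\<integral>x. cis (x \<bullet> A \<xi>) * (?f x * ?g \<xi>) \<partial>lebesgue) \<partial>lebesgue)"
    unfolding fint_def
  proof (intro Bochner_Integration.integral_cong refl)
    fix \<xi>
    have "(\<integral>x. cis (x \<bullet> A \<xi>) * (?f x * ?g \<xi>) \<partial>lebesgue) = (\<integral>x. (?f x * cis (x \<bullet> A \<xi>)) * ?g \<xi> \<partial>lebesgue)"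
      by (simp only: mult_ac)
    also have "\<dots> = complex_of_real (ball_hat r (norm \<xi>)) * ?g \<xi>"
      using ball_fourier[OF r, of "A \<xi>"] A(2)[of \<xi>] by simp
    finally show "complex_of_real (ball_hat r (norm \<xi>)) * F \<xi> * cis (\<xi> \<bullet> y) = (\<integral>x. cis (x \<bullet> A \<xi>) * (?f x * ?g \<xi>) \<partial>lebesgue)"
      by (simp add: mult.assoc)
  qed
  also have "\<dots> = (\<integral>x. (\<integral>\<xi>. cis (x \<bullet> A \<xi>) * (?f x * ?g \<xi>) \<partial>lebesgue) \<partial>lebesgue)"
    by (rule lebesgue_pair.Fubini_integral[OF ii])
  finally show "fint (\<lambda>\<xi>. complex_of_real (ball_hat r (norm \<xi>)) * F \<xi>) y
      = (\<integral>x. ?f x * fint F (y + adjoint A x) \<partial>lebesgue)"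
    unfolding inner .
  show "integrable lebesgue (\<lambda>x. ?f x * fint F (y + adjoint A x))"
    using lebesgue_pair.integrable_fst[OF ii] unfolding inner .
qed

lemma cone_mult_shell:
  assumes d: "DIM('a::euclidean_space) \<le> 3" and r: "0 \<le> s" "s \<le> r"
  shows "cone_mult r (\<lambda>\<xi>::'a. ball_hat r (norm \<xi>) - ball_hat s (norm \<xi>))"
    and "\<bar>ball_hat r (norm (\<xi>::'a)) - ball_hat s (norm \<xi>)\<bar> \<le> ball_hat r 0 - ball_hat s 0"
proof -
  obtain A :: "'a \<Rightarrow> real^3" where A: "linear A" and nA: "\<And>x. norm (A x) = norm x"
    using isometry_subset_subspace[of "UNIV :: 'a set" "UNIV :: (real^3) set"] d by auto
  have r0: "r \<ge> 0" using r by simp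
  let ?f = "\<lambda>r x::real^3. complex_of_real (indicator (cball 0 r) x)"
  have sub: "cball 0 s \<subseteq> cball (0::real^3) r" using r by auto
  have fint_ball: "integrable lebesgue (\<lambda>x::real^3. ?f r x * cis (x \<bullet> \<eta>))" for r and \<eta> :: "real^3"
    by (rule integrable_fint[OF integrable_ball])
  have indi: "integrable lebesgue (indicator (cball 0 r) :: real^3 \<Rightarrow> real)" for r
    using lmeasurable_cball[of "0::real^3" r] by (intro integrable_real_indicator) (auto simp: fmeasurable_def)
  have vol: "(\<integral>x. indicator (cball 0 r) (x::real^3) \<partial>lebesgue) = ball_hat r 0" if "r \<ge> 0" for r
    using ball_fourier[OF that, of 0] by simp
  have bd: "\<bar>ball_hat r (norm (\<xi>::'a)) - ball_hat s (norm \<xi>)\<bar> \<le> ball_hat r 0 - ball_hat s 0" for \<xi>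
  proof -
    have "complex_of_real (ball_hat r (norm \<xi>) - ball_hat s (norm \<xi>))
        = (\<integral>x. ?f r x * cis (x \<bullet> A \<xi>) - ?f s x * cis (x \<bullet> A \<xi>) \<partial>lebesgue)"
      using ball_fourier[OF r0, of "A \<xi>"] ball_fourier[OF r(1), of "A \<xi>"] fint_ball by (simp add: nA)
    also have "norm \<dots> \<le> (\<integral>x. norm (?f r x * cis (x \<bullet> A \<xi>) - ?f s x * cis (x \<bullet> A \<xi>)) \<partial>lebesgue)"
      by (rule integral_norm_bound)
    also have "\<dots> = (\<integral>x. indicator (cball 0 r) x - indicator (cball 0 s) (x::real^3) \<partial>lebesgue)"
    proof (intro Bochner_Integration.integral_cong refl)
      fix x :: "real^3"
      have "norm (?f r x * cis (x \<bullet> A \<xi>) - ?f s x * cis (x \<bullet> A \<xi>)) = norm (?f r x - ?f s x)"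
        by (simp add: norm_mult flip: left_diff_distrib)
      also have "\<dots> = indicator (cball 0 r) x - indicator (cball 0 s) x"
        using sub by (auto simp: indicator_def)
      finally show "norm (?f r x * cis (x \<bullet> A \<xi>) - ?f s x * cis (x \<bullet> A \<xi>)) = indicator (cball 0 r) x - indicator (cball 0 s) x" .
    qed
    also have "\<dots> = ball_hat r 0 - ball_hat s 0"
      using indi vol[OF r0] vol[OF r(1)] by simp
    finally show ?thesis by (simp only: norm_of_real)
  qed
  then show "\<bar>ball_hat r (norm (\<xi>::'a)) - ball_hat s (norm \<xi>)\<bar> \<le> ball_hat r 0 - ball_hat s 0" .
  have adj: "norm (adjoint A x) \<le> norm x" for x
  proof -
    have "(norm (adjoint A x))\<^sup>2 = x \<bullet> A (adjoint A x)"
      unfolding power2_norm_eq_inner by (metis adjoint_works[OF A] inner_commute)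
    also have "\<dots> \<le> norm x * norm (adjoint A x)"
      using norm_cauchy_schwarz[of x "A (adjoint A x)"] by (simp add: nA)
    finally show ?thesis
      by (cases "adjoint A x = 0") (auto simp: power2_eq_square)
  qed
  have main: "(ball_hat r (norm (0::'a)) - ball_hat s (norm (0::'a))) * B
      \<le> Re (fint (\<lambda>\<xi>. complex_of_real (ball_hat r (norm \<xi>) - ball_hat s (norm \<xi>)) * F \<xi>) y)"
    if F: "integrable lebesgue F" and B: "\<forall>z\<in>cball y r. B \<le> Re (fint F z)" for F and y :: 'a and B
  proof -
    let ?m = "\<lambda>r \<xi>::'a. complex_of_real (ball_hat r (norm \<xi>))"
    have bh: "integrable lebesgue (\<lambda>\<xi>. ?m r \<xi> * F \<xi>)" if "0 \<le> r" for r
    proof (rule integrable_bounded_mult[OF F])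
      show "norm (?m r \<xi>) \<le> ball_hat r 0" for \<xi>
      proof -
        have "norm (?m r \<xi>) \<le> (\<integral>x. norm (?f r x * cis (x \<bullet> A \<xi>)) \<partial>lebesgue)"
          using ball_fourier[OF that, of "A \<xi>"] integral_norm_bound[of lebesgue "\<lambda>x. ?f r x * cis (x \<bullet> A \<xi>)"] by (simp add: nA)
        also have "\<dots> = ball_hat r 0"
          using vol[OF that] by (simp add: norm_mult)
        finally show ?thesis .
      qed
    qed measurable
    have "fint (\<lambda>\<xi>. complex_of_real (ball_hat r (norm \<xi>) - ball_hat s (norm \<xi>)) * F \<xi>) y
        = fint (\<lambda>\<xi>. ?m r \<xi> * F \<xi>) y - fint (\<lambda>\<xi>. ?m s \<xi> * F \<xi>) y"
      unfolding fint_def using integrable_fint[OF bh[OF r0], of y] integrable_fint[OF bh[OF r(1)], of y]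
      by (simp add: left_diff_distrib flip: Bochner_Integration.integral_diff)
    also have "\<dots> = (\<integral>x. ?f r x * fint F (y + adjoint A x) \<partial>lebesgue) - (\<integral>x. ?f s x * fint F (y + adjoint A x) \<partial>lebesgue)"
      using shell_fint(1)[OF A nA F r0] shell_fint(1)[OF A nA F r(1)] by simp
    also have "\<dots> = (\<integral>x. (?f r x - ?f s x) * fint F (y + adjoint A x) \<partial>lebesgue)"
      using shell_fint(2)[OF A nA F r0] shell_fint(2)[OF A nA F r(1)] by (simp add: left_diff_distrib)
    finally have eq: "fint (\<lambda>\<xi>. complex_of_real (ball_hat r (norm \<xi>) - ball_hat s (norm \<xi>)) * F \<xi>) y
        = (\<integral>x. (?f r x - ?f s x) * fint F (y + adjoint A x) \<partial>lebesgue)" .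
    have it: "integrable lebesgue (\<lambda>x. (?f r x - ?f s x) * fint F (y + adjoint A x))"
      using shell_fint(2)[OF A nA F r0] shell_fint(2)[OF A nA F r(1)] by (simp add: left_diff_distrib)
    have "(ball_hat r 0 - ball_hat s 0) * B = (\<integral>x. (indicator (cball 0 r) x - indicator (cball 0 s) (x::real^3)) * B \<partial>lebesgue)"
      using indi vol[OF r0] vol[OF r(1)] by simp
    also have "\<dots> \<le> (\<integral>x. Re ((?f r x - ?f s x) * fint F (y + adjoint A x)) \<partial>lebesgue)"
    proof (rule integral_mono)
      show "integrable lebesgue (\<lambda>x. (indicator (cball 0 r) x - indicator (cball 0 s) (x::real^3)) * B)"
        using indi by (intro integrable_mult_left Bochner_Integration.integrable_diff)
      show "integrable lebesgue (\<lambda>x. Re ((?f r x - ?f s x) * fint F (y + adjoint A x)))"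
        by (rule integrable_Re[OF it])
      fix x :: "real^3"
      have rf: "?f r x - ?f s x = complex_of_real (indicator (cball 0 r) x - indicator (cball 0 s) x)"
        by simp
      show "(indicator (cball 0 r) x - indicator (cball 0 s) x) * B \<le> Re ((?f r x - ?f s x) * fint F (y + adjoint A x))"
      proof (cases "x \<in> cball 0 r")
        case True
        then have "y + adjoint A x \<in> cball y r" using adj[of x] by (simp add: dist_norm)
        then have "B \<le> Re (fint F (y + adjoint A x))" using B by blast
        moreover have "0 \<le> (indicator (cball 0 r) x - indicator (cball 0 s) x :: real)"
          using sub by (auto simp: indicator_def)
        ultimately show ?thesis unfolding rf by (simp add: mult_left_mono del: of_real_diff)
      next
        case False
        then have "x \<notin> cball 0 s" using sub by blast
        then show ?thesis using False by simp
      qed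
    qed
    also have "\<dots> = Re (fint (\<lambda>\<xi>. complex_of_real (ball_hat r (norm \<xi>) - ball_hat s (norm \<xi>)) * F \<xi>) y)"
      unfolding eq by (rule integral_Re[OF it])
    finally show ?thesis by simp
  qed
  have "(\<lambda>\<xi>::'a. ball_hat r (norm \<xi>) - ball_hat s (norm \<xi>)) \<in> borel_measurable borel"
    by measurable
  then show "cone_mult r (\<lambda>\<xi>::'a. ball_hat r (norm \<xi>) - ball_hat s (norm \<xi>))"
    unfolding cone_mult_def using bd main by blast
qed

lemma cone_mult_wave:
  assumes d: "DIM('a::euclidean_space) \<le> 3" and t: "t \<ge> 0"
  shows "cone_mult t (wave t :: 'a \<Rightarrow> real)"
proof (cases "t = 0")
  case True
  then have "wave t = (\<lambda>_::'a. 0)" by (auto simp: wave_def)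
  then show ?thesis by (auto simp: cone_mult_def fint_def)
next
  case False
  then have t: "t > 0" using t by simp
  define h where "h = (\<lambda>k::nat. t / real (Suc k))"
  have h: "h k > 0" "h k \<le> t" for k using t by (auto simp: h_def field_simps)
  have h0: "h \<longlonglongrightarrow> 0" unfolding h_def by (rule lim_const_over_n[THEN LIMSEQ_Suc])
  define m where "m = (\<lambda>k (\<xi>::'a). 1 / (4 * pi * t * h k) * (ball_hat t (norm \<xi>) - ball_hat (t - h k) (norm \<xi>)))"
  show ?thesis
  proof (rule cone_mult_limit[where m = m and C = t])
    show "cone_mult t (m k)" for k
      unfolding m_def using h[of k] t by (intro cone_mult_scale cone_mult_shell[OF d]) auto
    show "(\<lambda>k. m k \<xi>) \<longlonglongrightarrow> wave t \<xi>" for \<xi>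
    proof -
      have "((\<lambda>h. (ball_hat (t + h) (norm \<xi>) - ball_hat t (norm \<xi>)) / h) \<longlongrightarrow> 4 * pi * t * wave t \<xi>) (at 0)"
        using DERIV_ball_hat[of \<xi> t] by (simp add: DERIV_def)
      moreover have "filterlim (\<lambda>k. - h k) (at 0) sequentially"
        using h h0 by (auto simp: filterlim_at tendsto_minus_cancel_left[symmetric] less_imp_neq[symmetric] intro!: always_eventually)
      ultimately have "(\<lambda>k. (ball_hat (t + - h k) (norm \<xi>) - ball_hat t (norm \<xi>)) / (- h k)) \<longlonglongrightarrow> 4 * pi * t * wave t \<xi>"
        by (rule filterlim_compose)
      then have "(\<lambda>k. 1 / (4 * pi * t) * ((ball_hat (t + - h k) (norm \<xi>) - ball_hat t (norm \<xi>)) / (- h k))) \<longlonglongrightarrow> 1 / (4 * pi * t) * (4 * pi * t * wave t \<xi>)"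
        by (intro tendsto_intros)
      moreover have "1 / (4 * pi * t) * ((ball_hat (t + - h k) (norm \<xi>) - ball_hat t (norm \<xi>)) / (- h k)) = m k \<xi>" for k
        using h[of k] t by (simp add: m_def field_simps)
      ultimately show ?thesis using t by simp
    qed
    show "\<bar>m k \<xi>\<bar> \<le> t" for k \<xi>
    proof -
      have "\<bar>m k \<xi>\<bar> \<le> 1 / (4 * pi * t * h k) * (ball_hat t 0 - ball_hat (t - h k) 0)"
        unfolding m_def abs_mult using h[of k] t cone_mult_shell(2)[OF d, of "t - h k" t \<xi>]
        by (intro mult_mono) auto
      also have "ball_hat t 0 - ball_hat (t - h k) 0 \<le> 4 * pi * t\<^sup>2 * h k"
      proof -
        have "t ^ 3 - (t - h k) ^ 3 = h k * (3 * t\<^sup>2 - 3 * t * h k + (h k)\<^sup>2)"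
          by (simp add: power2_eq_square power3_eq_cube algebra_simps)
        also have "\<dots> \<le> h k * (3 * t\<^sup>2)"
        proof (rule mult_left_mono)
          have "(h k)\<^sup>2 \<le> t * h k" using h[of k] by (simp add: power2_eq_square)
          moreover have "0 \<le> t * h k" using h[of k] t by simp
          ultimately show "3 * t\<^sup>2 - 3 * t * h k + (h k)\<^sup>2 \<le> 3 * t\<^sup>2" by linarith
        qed (use h[of k] in simp)
        finally have "(4 * pi / 3) * (t ^ 3 - (t - h k) ^ 3) \<le> (4 * pi / 3) * (h k * (3 * t\<^sup>2))"
          by (rule mult_left_mono) simp
        then show ?thesis by (simp add: ball_hat_def algebra_simps)
      qed
      finally show ?thesis
        using h[of k] t by (simp add: divide_right_mono mult_left_mono field_simps power2_eq_square)
    qed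
  qed
qed

subsection \<open>The damped wave kernel\<close>

lemma wave_measurable_pair [measurable]:
  "(\<lambda>(s, \<xi>). wave s \<xi>) \<in> borel_measurable (borel \<Otimes>\<^sub>M (borel :: 'a::euclidean_space measure))"
  unfolding wave_def by measurable

lemma abs_wave_le: "\<bar>wave t \<xi>\<bar> \<le> \<bar>t\<bar>"
proof (cases "\<xi> = 0")
  case False
  have "\<bar>sin (t * norm \<xi>)\<bar> \<le> \<bar>t\<bar> * norm \<xi>"
    using abs_sin_x_le_abs_x[of "t * norm \<xi>"] by (simp add: abs_mult)
  then show ?thesis using False by (simp add: wave_def divide_le_eq)
qed (simp add: wave_def)

text \<open>The function \<open>z t = exp (t / 2) * K_hat t \<xi>\<close> solves \<open>z'' + \<bar>\<xi>\<bar>\<^sup>2 z = z / 4\<close>; these are the Picard iterates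
  of its Duhamel formula over the wave equation.\<close>

primrec picard :: "nat \<Rightarrow> real \<Rightarrow> 'a::euclidean_space \<Rightarrow> real" where
  "picard 0 t \<xi> = 0"
| "picard (Suc k) t \<xi> = wave t \<xi> + 1 / 4 * (\<integral>s. indicator {0..t} s * (wave (t - s) \<xi> * picard k s \<xi>) \<partial>lborel)"

lemma picard_measurable_pair [measurable]:
  "(\<lambda>(s, \<xi>). picard k s \<xi>) \<in> borel_measurable (borel \<Otimes>\<^sub>M (borel :: 'a::euclidean_space measure))"
proof (induction k)
  case (Suc k)
  note Suc [measurable]
  have "(\<lambda>(p, s). indicator {0..fst p} s * (wave (fst p - s) (snd p) * picard k s (snd p)))
      \<in> borel_measurable ((borel \<Otimes>\<^sub>M (borel :: 'a measure)) \<Otimes>\<^sub>M lborel)"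
    unfolding indicator_def atLeastAtMost_iff by measurable
  from lborel.borel_measurable_lebesgue_integral[OF this]
  have [measurable]: "(\<lambda>p. \<integral>s. indicator {0..fst p} s * (wave (fst p - s) (snd p) * picard k s (snd p)) \<partial>lborel)
      \<in> borel_measurable (borel \<Otimes>\<^sub>M (borel :: 'a measure))"
    by simp
  show ?case
    unfolding picard.simps case_prod_beta by measurable
qed simp

lemma picard_measurable_time [measurable]: "(\<lambda>s. picard k s \<xi>) \<in> borel_measurable borel"
  using measurable_compose[OF measurable_Pair2'[of \<xi> borel borel] picard_measurable_pair[of k]] by simp

lemma wave_measurable_time [measurable]: "(\<lambda>s. wave s \<xi>) \<in> borel_measurable borel"
  unfolding wave_def by measurable

lemma has_integral_exp_Icc:
  fixes t T :: real
  assumes "0 \<le> t" "0 < T"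
  shows "has_bochner_integral lborel (\<lambda>s. (T / 4 * exp (T * s / 4)) * indicator {0..t} s) (exp (T * t / 4) - 1)"
proof -
  have "has_bochner_integral lborel (\<lambda>s. (T / 4 * exp (T * s / 4)) * indicator {0..t} s) (exp (T * t / 4) - exp (T * 0 / 4))"
    by (rule has_bochner_integral_FTC_Icc_real) (use assms in \<open>auto intro!: derivative_eq_intros continuous_intros\<close>)
  then show ?thesis by simp
qed

lemma abs_picard_le:
  assumes T: "0 < T"
  shows "0 \<le> t \<Longrightarrow> t \<le> T \<Longrightarrow> \<bar>picard k t \<xi>\<bar> \<le> T * exp (T * t / 4)"
proof (induction k arbitrary: t)
  case (Suc k)
  note I = has_integral_exp_Icc[OF Suc.prems(1) T]
  have "\<bar>\<integral>s. indicator {0..t} s * (wave (t - s) \<xi> * picard k s \<xi>) \<partial>lborel\<bar>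
      \<le> (\<integral>s. \<bar>indicator {0..t} s * (wave (t - s) \<xi> * picard k s \<xi>)\<bar> \<partial>lborel)"
    by (rule integral_abs_bound)
  also have "\<dots> \<le> (\<integral>s. 4 * T * ((T / 4 * exp (T * s / 4)) * indicator {0..t} s) \<partial>lborel)"
  proof (rule integral_mono')
    show "integrable lborel (\<lambda>s. 4 * T * ((T / 4 * exp (T * s / 4)) * indicator {0..t} s))"
      using I unfolding has_bochner_integral_iff by (intro integrable_mult_right) blast
    fix s
    show "\<bar>indicator {0..t} s * (wave (t - s) \<xi> * picard k s \<xi>)\<bar> \<le> 4 * T * ((T / 4 * exp (T * s / 4)) * indicator {0..t} s)"
    proof (cases "s \<in> {0..t}")
      case True
      have "\<bar>wave (t - s) \<xi>\<bar> \<le> T" using abs_wave_le[of "t - s" \<xi>] True Suc.prems by simp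
      moreover have "\<bar>picard k s \<xi>\<bar> \<le> T * exp (T * s / 4)" using True Suc by auto
      ultimately have "\<bar>wave (t - s) \<xi>\<bar> * \<bar>picard k s \<xi>\<bar> \<le> T * (T * exp (T * s / 4))"
        using T by (intro mult_mono) auto
      then show ?thesis using True by (simp add: abs_mult)
    qed simp
    show "0 \<le> 4 * T * ((T / 4 * exp (T * s / 4)) * indicator {0..t} s)" using T by simp
  qed
  also have "\<dots> = 4 * T * (exp (T * t / 4) - 1)"
    using has_bochner_integral_integral_eq[OF I] by (simp only: integral_mult_right_zero)
  finally have "\<bar>1 / 4 * (\<integral>s. indicator {0..t} s * (wave (t - s) \<xi> * picard k s \<xi>) \<partial>lborel)\<bar> \<le> T * (exp (T * t / 4) - 1)"
    by simp
  moreover have "\<bar>wave t \<xi>\<bar> \<le> T" using abs_wave_le[of t \<xi>] Suc.prems by simp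
  ultimately show ?case unfolding picard.simps right_diff_distrib by linarith
qed (use T in simp)

lemma integrable_picard:
  assumes "0 \<le> t"
  shows "integrable lborel (\<lambda>s. indicator {0..t} s * (wave (t - s) \<xi> * picard k s \<xi>))"
proof -
  have "integrable lborel (\<lambda>s. ((t + 1) * ((t + 1) * exp ((t + 1) * t / 4))) * indicator {0..t} s)"
    using assms by simp
  then show ?thesis
  proof (rule Bochner_Integration.integrable_bound)
    show "AE s in lborel. norm (indicator {0..t} s * (wave (t - s) \<xi> * picard k s \<xi>))
        \<le> norm (((t + 1) * ((t + 1) * exp ((t + 1) * t / 4))) * indicator {0..t} s)"
    proof (rule AE_I2)
      fix s
      show "norm (indicator {0..t} s * (wave (t - s) \<xi> * picard k s \<xi>))
        \<le> norm (((t + 1) * ((t + 1) * exp ((t + 1) * t / 4))) * indicator {0..t} s)"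
      proof (cases "s \<in> {0..t}")
        case True
        have "\<bar>wave (t - s) \<xi>\<bar> \<le> t + 1" using abs_wave_le[of "t - s" \<xi>] True by simp
        moreover have "\<bar>picard k s \<xi>\<bar> \<le> (t + 1) * exp ((t + 1) * t / 4)"
        proof -
          have "\<bar>picard k s \<xi>\<bar> \<le> (t + 1) * exp ((t + 1) * s / 4)"
            using True assms by (intro abs_picard_le) auto
          also have "\<dots> \<le> (t + 1) * exp ((t + 1) * t / 4)"
            using True assms by (intro mult_left_mono) (auto intro!: mult_left_mono)
          finally show ?thesis .
        qed
        ultimately have "\<bar>wave (t - s) \<xi>\<bar> * \<bar>picard k s \<xi>\<bar> \<le> (t + 1) * ((t + 1) * exp ((t + 1) * t / 4))"
          using assms by (intro mult_mono) auto
        then show ?thesis using True assms by (simp add: abs_mult)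
      qed simp
    qed
    show "(\<lambda>s. indicator {0..t} s * (wave (t - s) \<xi> * picard k s \<xi>)) \<in> borel_measurable lborel"
      by measurable
  qed
qed

lemma cone_mult_picard:
  assumes d: "DIM('a::euclidean_space) \<le> 3"
  shows "t \<ge> 0 \<Longrightarrow> cone_mult t (picard k t :: 'a \<Rightarrow> real)"
proof (induction k arbitrary: t)
  case 0
  have "picard 0 t = (\<lambda>_::'a. 0)" by auto
  then show ?case by (auto simp: cone_mult_def fint_def)
next
  case (Suc k)
  have "cone_mult t (\<lambda>\<xi>::'a. \<integral>s. indicator {0..t} s * (wave (t - s) \<xi> * picard k s \<xi>) \<partial>lborel)"
  proof (rule cone_mult_integral)
    show "(\<lambda>(s, \<xi>::'a). wave (t - s) \<xi> * picard k s \<xi>) \<in> borel_measurable borel"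
      unfolding borel_prod[symmetric] by measurable
    show "cone_mult t (\<lambda>\<xi>::'a. wave (t - s) \<xi> * picard k s \<xi>)" if "s \<in> {0..t}" for s
      using cone_mult_mult[OF cone_mult_wave[OF d, of "t - s"] Suc.IH[of s]] that by simp
    show "\<bar>wave (t - s) \<xi> * picard k s \<xi>\<bar> \<le> (t + 1) * ((t + 1) * exp ((t + 1) * t / 4))"
      if s: "s \<in> {0..t}" for s and \<xi> :: 'a
    proof -
      have "\<bar>wave (t - s) \<xi>\<bar> \<le> t + 1" using abs_wave_le[of "t - s" \<xi>] s by simp
      moreover have "\<bar>picard k s \<xi>\<bar> \<le> (t + 1) * exp ((t + 1) * t / 4)"
      proof -
        have "\<bar>picard k s \<xi>\<bar> \<le> (t + 1) * exp ((t + 1) * s / 4)"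
          using s Suc.prems by (intro abs_picard_le) auto
        also have "\<dots> \<le> (t + 1) * exp ((t + 1) * t / 4)"
          using s Suc.prems by (intro mult_left_mono) (auto intro!: mult_left_mono)
        finally show ?thesis .
      qed
      ultimately show ?thesis
        unfolding abs_mult using Suc.prems by (intro mult_mono) auto
    qed
  qed (use Suc.prems in simp)
  then have "cone_mult t (\<lambda>\<xi>::'a. wave t \<xi> + 1 / 4 * (\<integral>s. indicator {0..t} s * (wave (t - s) \<xi> * picard k s \<xi>) \<partial>lborel))"
    using Suc.prems by (intro cone_mult_add cone_mult_wave[OF d] cone_mult_scale) auto
  moreover have "picard (Suc k) t = (\<lambda>\<xi>::'a. wave t \<xi> + 1 / 4 * (\<integral>s. indicator {0..t} s * (wave (t - s) \<xi> * picard k s \<xi>) \<partial>lborel))"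
    by (rule ext) simp
  ultimately show ?case by simp
qed

lemma K_hat_ode:
  fixes \<xi> :: "'a::euclidean_space"
  defines "z \<equiv> \<lambda>t. exp (t / 2) * K_hat t \<xi>"
  obtains z' where "\<And>t. (z has_real_derivative z' t) (at t)"
    "\<And>t. (z' has_real_derivative (1 / 4 - (norm \<xi>)\<^sup>2) * z t) (at t)" "z 0 = 0" "z' 0 = 1"
proof -
  have ee: "exp (t / 2) * (exp (- (t / 2)) * c) = c" for t c :: real
    by (simp add: mult.assoc[symmetric] flip: exp_add)
  consider "norm \<xi> < 1 / 2" | "norm \<xi> > 1 / 2" | "norm \<xi> = 1 / 2" by linarith
  then show thesis
  proof cases
    case 1
    define \<sigma> where "\<sigma> = sqrt (1 / 4 - (norm \<xi>)\<^sup>2)"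
    have "(norm \<xi>)\<^sup>2 < (1 / 2)\<^sup>2" using 1 by (intro power_strict_mono) auto
    then have \<sigma>: "\<sigma> > 0" "\<sigma>\<^sup>2 = 1 / 4 - (norm \<xi>)\<^sup>2" by (auto simp: \<sigma>_def power2_eq_square)
    have z: "z = (\<lambda>t. sinh (t * \<sigma>) / \<sigma>)"
    proof
      fix t
      have "z t = exp (t / 2) * (exp (- (t / 2)) * (sinh (t * \<sigma>) / \<sigma>))"
        using 1 by (simp add: z_def K_hat_def \<sigma>_def)
      then show "z t = sinh (t * \<sigma>) / \<sigma>" by (simp only: ee)
    qed
    show thesis
    proof (rule that[of "\<lambda>t. cosh (t * \<sigma>)"])
      show "(z has_real_derivative cosh (t * \<sigma>)) (at t)" for t
        unfolding z using \<sigma>(1) by (auto intro!: derivative_eq_intros)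
      show "((\<lambda>t. cosh (t * \<sigma>)) has_real_derivative (1 / 4 - (norm \<xi>)\<^sup>2) * z t) (at t)" for t
        unfolding z \<sigma>(2)[symmetric] using \<sigma>(1) by (auto intro!: derivative_eq_intros simp: power2_eq_square)
    qed (auto simp: z)
  next
    case 2
    define \<sigma> where "\<sigma> = sqrt ((norm \<xi>)\<^sup>2 - 1 / 4)"
    have "(1 / 2)\<^sup>2 < (norm \<xi>)\<^sup>2" using 2 by (intro power_strict_mono) auto
    then have \<sigma>: "\<sigma> > 0" "\<sigma>\<^sup>2 = (norm \<xi>)\<^sup>2 - 1 / 4" by (auto simp: \<sigma>_def power2_eq_square)
    have z: "z = (\<lambda>t. sin (t * \<sigma>) / \<sigma>)"
    proof
      fix t
      have "z t = exp (t / 2) * (exp (- (t / 2)) * (sin (t * \<sigma>) / \<sigma>))"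
        using 2 by (simp add: z_def K_hat_def \<sigma>_def)
      then show "z t = sin (t * \<sigma>) / \<sigma>" by (simp only: ee)
    qed
    have s2: "1 / 4 - (norm \<xi>)\<^sup>2 = - \<sigma>\<^sup>2" using \<sigma>(2) by simp
    show thesis
    proof (rule that[of "\<lambda>t. cos (t * \<sigma>)"])
      show "(z has_real_derivative cos (t * \<sigma>)) (at t)" for t
        unfolding z using \<sigma>(1) by (auto intro!: derivative_eq_intros)
      show "((\<lambda>t. cos (t * \<sigma>)) has_real_derivative (1 / 4 - (norm \<xi>)\<^sup>2) * z t) (at t)" for t
        unfolding z s2 using \<sigma>(1) by (auto intro!: derivative_eq_intros simp: power2_eq_square)
    qed (auto simp: z)
  next
    case 3
    have z: "z = (\<lambda>t. t)"
      using 3 by (auto simp: z_def K_hat_def fun_eq_iff simp flip: exp_add)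
    have n2: "1 / 4 - (norm \<xi>)\<^sup>2 = 0" unfolding 3 by (simp add: power2_eq_square)
    show thesis
      by (rule that[of "\<lambda>_. 1"]) (auto simp: z n2 intro!: derivative_eq_intros)
  qed
qed

lemma K_hat_Volterra:
  fixes \<xi> :: "'a::euclidean_space"
  defines "z \<equiv> \<lambda>t. exp (t / 2) * K_hat t \<xi>"
  assumes t: "t \<ge> 0"
  shows "has_bochner_integral lborel (\<lambda>s. (1 / 4 * (wave (t - s) \<xi> * z s)) * indicator {0..t} s) (z t - wave t \<xi>)"
    and "continuous_on UNIV z"
proof -
  obtain z' where z': "\<And>t. (z has_real_derivative z' t) (at t)"
    "\<And>t. (z' has_real_derivative (1 / 4 - (norm \<xi>)\<^sup>2) * z t) (at t)" "z 0 = 0" "z' 0 = 1"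
    using K_hat_ode[of \<xi>] unfolding z_def by blast
  define c where "c = (\<lambda>t. cos (t * norm \<xi>))"
  have w: "((\<lambda>t. wave t \<xi>) has_real_derivative c t) (at t)" for t
    by (cases "\<xi> = 0") (auto simp: wave_def c_def intro!: derivative_eq_intros)
  have c: "(c has_real_derivative - (norm \<xi>)\<^sup>2 * wave t \<xi>) (at t)" for t
    by (cases "\<xi> = 0") (auto simp: wave_def c_def power2_eq_square intro!: derivative_eq_intros)
  have zc: "isCont z s" for s using z'(1) DERIV_isCont by blast
  then show "continuous_on UNIV z" by (simp add: continuous_at_imp_continuous_on)
  have wc: "isCont (\<lambda>s. wave (t - s) \<xi>) s" for s
  proof -
    have "isCont (\<lambda>t. wave t \<xi>) (t - s)" using w DERIV_isCont by blast
    then show ?thesis using isCont_o2[of s "\<lambda>s. t - s" "\<lambda>t. wave t \<xi>"] by simp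
  qed
  let ?F = "\<lambda>s. wave (t - s) \<xi> * z' s + c (t - s) * z s"
  have "has_bochner_integral lborel (\<lambda>s. (1 / 4 * (wave (t - s) \<xi> * z s)) * indicator {0..t} s) (?F t - ?F 0)"
  proof (rule has_bochner_integral_FTC_Icc_real[OF t])
    fix s
    have w1: "((\<lambda>s. wave (t - s) \<xi>) has_real_derivative c (t - s) * (- 1)) (at s)"
      by (rule DERIV_chain2[OF w]) (auto intro!: derivative_eq_intros)
    have c1: "((\<lambda>s. c (t - s)) has_real_derivative (- (norm \<xi>)\<^sup>2 * wave (t - s) \<xi>) * (- 1)) (at s)"
      by (rule DERIV_chain2[OF c]) (auto intro!: derivative_eq_intros)
    show "(?F has_real_derivative 1 / 4 * (wave (t - s) \<xi> * z s)) (at s)"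
      by (rule DERIV_cong[OF DERIV_add[OF DERIV_mult[OF w1 z'(2)] DERIV_mult[OF c1 z'(1)]]])
         (simp add: algebra_simps)
    show "isCont (\<lambda>s. 1 / 4 * (wave (t - s) \<xi> * z s)) s"
      by (intro continuous_intros wc zc)
  qed
  moreover have "?F t - ?F 0 = z t - wave t \<xi>"
    using z'(3,4) by (simp add: c_def) (simp add: wave_def)
  ultimately show "has_bochner_integral lborel (\<lambda>s. (1 / 4 * (wave (t - s) \<xi> * z s)) * indicator {0..t} s) (z t - wave t \<xi>)"
    by simp
qed

lemma picard_error:
  fixes \<xi> :: "'a::euclidean_space"
  assumes T: "T > 0" and Z: "\<And>s. 0 \<le> s \<Longrightarrow> s \<le> T \<Longrightarrow> \<bar>exp (s / 2) * K_hat s \<xi>\<bar> \<le> Z"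
  shows "0 \<le> t \<Longrightarrow> t \<le> T \<Longrightarrow> \<bar>exp (t / 2) * K_hat t \<xi> - picard k t \<xi>\<bar> \<le> Z * ((T / 4) ^ k * t ^ k / fact k)"
proof (induction k arbitrary: t)
  case 0
  then show ?case using Z by simp
next
  case (Suc k)
  define z where "z = (\<lambda>t. exp (t / 2) * K_hat t \<xi>)"
  have Z0: "Z \<ge> 0" using Z[of 0] T by (auto intro: order.trans[OF abs_ge_zero])
  have zz: "exp (t / 2) * K_hat t \<xi> = z t" for t by (simp add: z_def)
  note V = K_hat_Volterra(1)[OF Suc.prems(1), of \<xi>, unfolded zz]
  have Vi: "integrable lborel (\<lambda>s. (1 / 4 * (wave (t - s) \<xi> * z s)) * indicator {0..t} s)"
    "z t - wave t \<xi> = (\<integral>s. (1 / 4 * (wave (t - s) \<xi> * z s)) * indicator {0..t} s \<partial>lborel)"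
    using V unfolding has_bochner_integral_iff by auto
  let ?C = "T * (Z * ((T / 4) ^ k / fact k)) / 4"
  have I: "has_bochner_integral lborel (\<lambda>s. (?C * s ^ k) * indicator {0..t} s)
      ((\<lambda>s. ?C * (s ^ Suc k / real (Suc k))) t - (\<lambda>s. ?C * (s ^ Suc k / real (Suc k))) 0)"
  proof (rule has_bochner_integral_FTC_Icc_real[OF Suc.prems(1)])
    have "((\<lambda>s. C * (s ^ Suc k / real (Suc k))) has_real_derivative C * s ^ k) (at s)" for C s :: real
      by (auto intro!: derivative_eq_intros simp del: power_Suc of_nat_Suc)
    then show "((\<lambda>s. ?C * (s ^ Suc k / real (Suc k))) has_real_derivative ?C * s ^ k) (at s)" for s .
    show "isCont (\<lambda>s. ?C * s ^ k) s" for s by (intro continuous_intros) auto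
  qed
  have ip: "integrable lborel (\<lambda>s. 1 / 4 * (indicator {0..t} s * (wave (t - s) \<xi> * picard k s \<xi>)))"
    by (intro integrable_mult_right integrable_picard Suc.prems)
  have eq: "z t - picard (Suc k) t \<xi> = (\<integral>s. (1 / 4 * (wave (t - s) \<xi> * z s)) * indicator {0..t} s
       - 1 / 4 * (indicator {0..t} s * (wave (t - s) \<xi> * picard k s \<xi>)) \<partial>lborel)"
    using Vi ip by simp
  have "\<bar>z t - picard (Suc k) t \<xi>\<bar> \<le> (\<integral>s. \<bar>(1 / 4 * (wave (t - s) \<xi> * z s)) * indicator {0..t} s
       - 1 / 4 * (indicator {0..t} s * (wave (t - s) \<xi> * picard k s \<xi>))\<bar> \<partial>lborel)"
    unfolding eq by (rule integral_abs_bound)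
  also have "\<dots> \<le> (\<integral>s. (?C * s ^ k) * indicator {0..t} s \<partial>lborel)"
  proof (rule integral_mono')
    show "integrable lborel (\<lambda>s. (?C * s ^ k) * indicator {0..t} s)"
      using I unfolding has_bochner_integral_iff by blast
    fix s
    show "\<bar>(1 / 4 * (wave (t - s) \<xi> * z s)) * indicator {0..t} s
       - 1 / 4 * (indicator {0..t} s * (wave (t - s) \<xi> * picard k s \<xi>))\<bar> \<le> (?C * s ^ k) * indicator {0..t} s"
    proof (cases "s \<in> {0..t}")
      case True
      have "\<bar>wave (t - s) \<xi>\<bar> \<le> T" using abs_wave_le[of "t - s" \<xi>] True Suc.prems by simp
      moreover have "\<bar>z s - picard k s \<xi>\<bar> \<le> Z * ((T / 4) ^ k * s ^ k / fact k)"
        using Suc.IH[of s] True Suc.prems by (auto simp: z_def)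
      ultimately have "\<bar>wave (t - s) \<xi>\<bar> * \<bar>z s - picard k s \<xi>\<bar> \<le> T * (Z * ((T / 4) ^ k * s ^ k / fact k))"
        using T by (intro mult_mono) auto
      moreover have "\<bar>1 / 4 * (wave (t - s) \<xi> * z s) - 1 / 4 * (wave (t - s) \<xi> * picard k s \<xi>)\<bar>
          = 1 / 4 * (\<bar>wave (t - s) \<xi>\<bar> * \<bar>z s - picard k s \<xi>\<bar>)"
      proof -
        have "1 / 4 * (w * a) - 1 / 4 * (w * b) = 1 / 4 * (w * (a - b))" for w a b :: real
          by (simp add: algebra_simps)
        then show ?thesis by (simp only: abs_mult)
      qed
      moreover have "1 / 4 * (T * (Z * (A * B / f))) = T * (Z * (A / f)) / 4 * B" for A B f :: real
        by simp
      then have "1 / 4 * (T * (Z * ((T / 4) ^ k * s ^ k / fact k))) = ?C * s ^ k" .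
      moreover have "indicator {0..t} s = (1 :: real)" using True by simp
      ultimately show ?thesis by (simp only: mult_1_left mult_1_right)
    qed simp
    show "0 \<le> (?C * s ^ k) * indicator {0..t} s" using T Z0 by (auto split: split_indicator)
  qed
  also have "\<dots> = ?C * (t ^ Suc k / real (Suc k))"
    using has_bochner_integral_integral_eq[OF I] by simp
  also have "\<dots> = Z * ((T / 4) ^ Suc k * t ^ Suc k / fact (Suc k))"
    by (simp add: field_simps)
  finally show ?case by (simp add: z_def)
qed

lemma cone_mult_K_hat:
  assumes d: "DIM('a::euclidean_space) \<le> 3" and t: "t \<ge> 0"
  shows "cone_mult t (K_hat t :: 'a \<Rightarrow> real)"
proof -
  have "cone_mult t (\<lambda>\<xi>::'a. exp (t / 2) * K_hat t \<xi>)"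
  proof (rule cone_mult_limit[where m = "\<lambda>k. picard k t" and C = "(t + 1) * exp ((t + 1) * t / 4)"])
    show "cone_mult t (picard k t :: 'a \<Rightarrow> real)" for k by (rule cone_mult_picard[OF d t])
    show "\<bar>picard k t (\<xi>::'a)\<bar> \<le> (t + 1) * exp ((t + 1) * t / 4)" for k \<xi>
      using t by (intro abs_picard_le) auto
    fix \<xi> :: 'a
    have "continuous_on {0..t + 1} (\<lambda>s. exp (s / 2) * K_hat s \<xi>)"
      using K_hat_Volterra(2)[OF t, of \<xi>] continuous_on_subset by blast
    then have "bounded ((\<lambda>s. exp (s / 2) * K_hat s \<xi>) ` {0..t + 1})"
      by (intro compact_imp_bounded compact_continuous_image) auto
    then obtain Z where Z: "\<forall>s\<in>{0..t + 1}. \<bar>exp (s / 2) * K_hat s \<xi>\<bar> \<le> Z"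
      by (auto simp: bounded_iff)
    have err: "\<bar>exp (t / 2) * K_hat t \<xi> - picard k t \<xi>\<bar> \<le> Z * (((t + 1) / 4 * t) ^ k / fact k)" for k
    proof -
      have "\<bar>exp (t / 2) * K_hat t \<xi> - picard k t \<xi>\<bar> \<le> Z * (((t + 1) / 4) ^ k * t ^ k / fact k)"
        using Z t by (intro picard_error) auto
      then show ?thesis by (simp only: power_mult_distrib[symmetric])
    qed
    have "(\<lambda>k. Z * (((t + 1) / 4 * t) ^ k / fact k)) \<longlonglongrightarrow> Z * 0"
    proof (intro tendsto_intros)
      have "(\<lambda>k. x ^ k / fact k) \<longlonglongrightarrow> 0" for x :: real
        using summable_LIMSEQ_zero[OF summable_exp[of x]] by (simp add: field_simps)
      then show "(\<lambda>k. ((t + 1) / 4 * t) ^ k / fact k) \<longlonglongrightarrow> 0" .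
    qed
    then have "(\<lambda>k. Z * (((t + 1) / 4 * t) ^ k / fact k)) \<longlonglongrightarrow> 0" by simp
    then have "(\<lambda>k. exp (t / 2) * K_hat t \<xi> - picard k t \<xi>) \<longlonglongrightarrow> 0"
      by (rule Lim_null_comparison[rotated]) (use err in simp)
    from tendsto_diff[OF tendsto_const[of "exp (t / 2) * K_hat t \<xi>"] this]
    show "(\<lambda>k. picard k t \<xi>) \<longlonglongrightarrow> exp (t / 2) * K_hat t \<xi>" by simp
  qed
  then have "cone_mult t (\<lambda>\<xi>::'a. exp (- t / 2) * (exp (t / 2) * K_hat t \<xi>))"
    by (rule cone_mult_scale) simp
  then show ?thesis by (simp add: mult.assoc[symmetric] flip: exp_add)
qed

lemma K_hat_zero: "K_hat t 0 = 1 - exp (- t)"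
proof -
  have "K_hat t (0::'a::euclidean_space) = exp (- t / 2) * sinh (t * sqrt (1 / 4)) / sqrt (1 / 4)"
    by (simp add: K_hat_def)
  also have "sqrt (1 / 4) = (1 / 2 :: real)"
    by (rule real_sqrt_unique) (auto simp: power2_eq_square)
  also have "exp (- t / 2) * sinh (t * (1 / 2)) / (1 / 2) = 1 - exp (- t)"
    by (simp add: sinh_field_def field_simps flip: exp_add)
  finally show ?thesis .
qed

subsection \<open>Comparison with the heat kernel\<close>

lemma mult_exp_minus_le_one: "x * exp (- x) \<le> (1::real)"
proof -
  have "x \<le> exp x" using exp_ge_add_one_self[of x] by linarith
  then show ?thesis by (simp add: exp_minus field_simps)
qed

text \<open>With \<open>s = sqrt (1 / 4 - \<bar>\<xi>\<bar>\<^sup>2)\<close> and \<open>d = 1 / 2 - s\<close> one has \<open>\<bar>\<xi>\<bar>\<^sup>2 = d - d\<^sup>2\<close>, so the decay rate \<open>d\<close> of the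
  slow mode differs from \<open>\<bar>\<xi>\<bar>\<^sup>2\<close> only by \<open>O(\<bar>\<xi>\<bar>\<^sup>4)\<close>.\<close>

lemma K_hat_low:
  fixes \<xi> :: "'a::euclidean_space"
  assumes t: "t > 0" and r: "norm \<xi> \<le> 1 / 4"
  shows "\<bar>K_hat t \<xi> - gauss t \<xi>\<bar> \<le> 20 / t * gauss (t / 4) \<xi>"
proof -
  define q where "q = (norm \<xi>)\<^sup>2"
  have "(norm \<xi>)\<^sup>2 \<le> (1 / 4)\<^sup>2" using r by (intro power_mono) auto
  then have q: "0 \<le> q" "q \<le> 1 / 16" by (auto simp: q_def power2_eq_square)
  define s where "s = sqrt (1 / 4 - q)"
  have s2: "s\<^sup>2 = 1 / 4 - q" using q by (simp add: s_def)
  have s: "2 / 5 \<le> s" "s \<le> 1 / 2"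
  proof -
    show "2 / 5 \<le> s" unfolding s_def by (rule real_le_rsqrt) (use q in \<open>simp add: power2_eq_square\<close>)
    show "s \<le> 1 / 2" unfolding s_def by (rule real_le_lsqrt) (use q in \<open>auto simp: power2_eq_square\<close>)
  qed
  define d where "d = 1 / 2 - s"
  have d: "0 \<le> d" "d \<le> 1 / 10" using s by (auto simp: d_def)
  have qd: "q = d - d\<^sup>2" using s2 by (simp add: d_def power2_eq_square algebra_simps)
  have d2: "d \<le> 2 * q"
  proof -
    have "d * d \<le> 1 / 10 * d" using d by (intro mult_right_mono) auto
    then show ?thesis using qd d by (simp add: power2_eq_square)
  qed
  have qled: "q \<le> d" using qd by simp
  have K: "K_hat t \<xi> = (exp (- (t * d)) - exp (- (t / 2) - t * s)) / (2 * s)"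
  proof -
    have "norm \<xi> < 1 / 2" using r by simp
    then have "K_hat t \<xi> = exp (- (t / 2)) * sinh (t * s) / s"
      by (simp add: K_hat_def s_def q_def)
    also have "\<dots> = (exp (- (t / 2) + t * s) - exp (- (t / 2) - t * s)) / (2 * s)"
      unfolding exp_add exp_diff by (simp add: sinh_field_def field_simps exp_minus)
    also have "- (t / 2) + t * s = - (t * d)" by (simp add: d_def algebra_simps)
    finally show ?thesis .
  qed
  define E where "E = exp (- (t * q))"
  have E: "E > 0" by (simp add: E_def)
  have Ed: "exp (- (t * d)) \<le> E" using qled t by (simp add: E_def)
  have T1: "\<bar>exp (- (t * d)) * (1 / (2 * s) - 1)\<bar> \<le> 5 * q * E"
  proof -
    have "1 / (2 * s) - 1 = d / s" using s by (simp add: d_def field_simps)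
    moreover have "d / s \<le> 5 * q"
    proof -
      have "d / s \<le> d / (2 / 5)" using s d by (intro divide_left_mono) auto
      also have "\<dots> = 5 / 2 * d" by simp
      also have "\<dots> \<le> 5 * q" using d2 by linarith
      finally show ?thesis .
    qed
    moreover have "0 \<le> d / s" using s d by auto
    ultimately have "0 \<le> 1 / (2 * s) - 1" "1 / (2 * s) - 1 \<le> 5 * q" by (simp_all only:)
    then have "exp (- (t * d)) * (1 / (2 * s) - 1) \<le> E * (5 * q)" "0 \<le> exp (- (t * d)) * (1 / (2 * s) - 1)"
      using Ed E by (auto intro: mult_mono)
    then show ?thesis by (simp add: mult_ac)
  qed
  have T2: "\<bar>exp (- (t * d)) - E\<bar> \<le> 4 * t * q\<^sup>2 * E"
  proof -
    have "exp (- (t * d)) = E * exp (- (t * d\<^sup>2))"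
      unfolding E_def exp_add[symmetric] by (simp add: qd algebra_simps)
    moreover have "1 - t * d\<^sup>2 \<le> exp (- (t * d\<^sup>2))"
      using exp_ge_add_one_self[of "- (t * d\<^sup>2)"] by simp
    ultimately have "E * (1 - t * d\<^sup>2) \<le> exp (- (t * d))" using E by simp
    then have "E - exp (- (t * d)) \<le> E * (t * d\<^sup>2)" by (simp add: algebra_simps)
    also have "d\<^sup>2 \<le> (2 * q)\<^sup>2" using d d2 by (intro power_mono) auto
    then have "E * (t * d\<^sup>2) \<le> E * (t * (2 * q)\<^sup>2)" using E t by simp
    finally show ?thesis using Ed by (simp add: power2_eq_square mult_ac)
  qed
  have T3: "\<bar>exp (- (t / 2) - t * s) / (2 * s)\<bar> \<le> 5 / t * E"
  proof -
    have "exp (- (t / 2) - t * s) / (2 * s) \<le> exp (- (t / 2) - t * s) / (4 / 5)"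
      using s by (intro divide_left_mono) auto
    also have "\<dots> \<le> exp (- (t / 2)) / (4 / 5)" using s t by (intro divide_right_mono) auto
    also have "exp (- (t / 2)) = exp (- (t / 4)) * exp (- (t / 4))" by (simp flip: exp_add)
    also have "exp (- (t / 4)) * exp (- (t / 4)) \<le> (4 / t) * E"
    proof (rule mult_mono)
      show "exp (- (t / 4)) \<le> 4 / t" using mult_exp_minus_le_one[of "t / 4"] t by (simp add: field_simps)
      show "exp (- (t / 4)) \<le> E" using q t by (simp add: E_def)
    qed (use t in auto)
    finally have "exp (- (t / 2) - t * s) / (2 * s) \<le> 5 / t * E" by (simp add: divide_right_mono)
    moreover have "0 \<le> exp (- (t / 2) - t * s) / (2 * s)" using s by simp
    ultimately show ?thesis by simp
  qed
  have "K_hat t \<xi> - E = exp (- (t * d)) * (1 / (2 * s) - 1) + (exp (- (t * d)) - E) - exp (- (t / 2) - t * s) / (2 * s)"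
    unfolding K by (simp add: diff_divide_distrib algebra_simps)
  then have "\<bar>K_hat t \<xi> - E\<bar> \<le> 5 * q * E + 4 * t * q\<^sup>2 * E + 5 / t * E"
    using T1 T2 T3 by linarith
  also have "\<dots> = 1 / t * ((5 + 5 * (t * q) + 4 * (t * q)\<^sup>2) * E)"
    using t by (simp add: field_simps power2_eq_square)
  also have "\<dots> \<le> 1 / t * ((20 * exp (3 / 4 * (t * q))) * E)"
  proof (intro mult_left_mono mult_right_mono)
    have "0 \<le> t * q" using t q by simp
    moreover from this have "1 + 3 / 4 * (t * q) + (3 / 4 * (t * q))\<^sup>2 / 2 \<le> exp (3 / 4 * (t * q))"
      by (intro exp_lower_Taylor_quadratic) simp
    moreover have "0 \<le> (t * q)\<^sup>2" by simp
    moreover have "5 + 5 * x + 4 * x\<^sup>2 \<le> 20 * y"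
      if a: "0 \<le> x" "1 + 3 / 4 * x + (3 / 4 * x)\<^sup>2 / 2 \<le> y" "0 \<le> x\<^sup>2" for x y :: real
    proof -
      have "(3 / 4 * x)\<^sup>2 / 2 = 9 / 32 * x\<^sup>2" by (simp add: power2_eq_square)
      then show ?thesis using a by linarith
    qed
    ultimately show "5 + 5 * (t * q) + 4 * (t * q)\<^sup>2 \<le> 20 * exp (3 / 4 * (t * q))"
      by blast
  qed (use t E in auto)
  also have "exp (3 / 4 * (t * q)) * E = exp (- (t / 4 * q))"
    unfolding E_def exp_add[symmetric] by (simp add: algebra_simps)
  then have "1 / t * ((20 * exp (3 / 4 * (t * q))) * E) = 20 / t * exp (- (t / 4 * q))"
    by (simp add: mult.assoc)
  finally show ?thesis by (simp add: E_def q_def)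
qed

lemma K_hat_high:
  fixes \<xi> :: "'a::euclidean_space"
  assumes t: "t \<ge> 0" and r: "norm \<xi> \<ge> 1 / 4"
  shows "\<bar>K_hat t \<xi>\<bar> \<le> 4 * (1 + t) * exp (- (t / 20)) / (1 + norm \<xi>)"
proof -
  have suff: "\<bar>K_hat t \<xi>\<bar> \<le> 4 * (1 + t) * exp (- (t / 20)) / (1 + norm \<xi>)"
    if "\<bar>K_hat t \<xi>\<bar> \<le> c * exp (- (t / 20))" "c * (1 + norm \<xi>) \<le> 4 * (1 + t)" for c
  proof -
    have "c \<le> 4 * (1 + t) / (1 + norm \<xi>)"
      using that(2) by (subst pos_le_divide_eq) (auto intro: add_pos_nonneg)
    then have "c * exp (- (t / 20)) \<le> 4 * (1 + t) / (1 + norm \<xi>) * exp (- (t / 20))"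
      by (intro mult_right_mono) auto
    then show ?thesis using that(1) by simp
  qed
  have small: "t * (1 + norm \<xi>) \<le> 4 * (1 + t)" if "norm \<xi> \<le> 1"
    using mult_left_mono[of "1 + norm \<xi>" 2 t] that t by simp
  have e: "exp (- (t / 2)) \<le> exp (- (t / 20))" using t by simp
  consider "norm \<xi> < 1 / 2" | "norm \<xi> = 1 / 2" | "norm \<xi> > 1 / 2" by linarith
  then show ?thesis
  proof cases
    case 1
    define s where "s = sqrt (1 / 4 - (norm \<xi>)\<^sup>2)"
    have "(norm \<xi>)\<^sup>2 < (1 / 2)\<^sup>2" "(1 / 4)\<^sup>2 \<le> (norm \<xi>)\<^sup>2"
      using 1 r by (auto intro!: power_strict_mono power_mono)
    then have q: "(norm \<xi>)\<^sup>2 < 1 / 4" "1 / 16 \<le> (norm \<xi>)\<^sup>2" by (auto simp: power2_eq_square)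
    have s: "0 < s" "s \<le> 9 / 20"
    proof -
      show "0 < s" using q by (simp add: s_def)
      show "s \<le> 9 / 20" unfolding s_def by (rule real_le_lsqrt) (use q in \<open>auto simp: power2_eq_square\<close>)
    qed
    have sh: "0 \<le> sinh (t * s)" "sinh (t * s) \<le> t * s * exp (t * s)"
    proof -
      show "0 \<le> sinh (t * s)" using s t by simp
      have "1 - 2 * (t * s) \<le> exp (- (2 * (t * s)))" using exp_ge_add_one_self[of "- (2 * (t * s))"] by simp
      then have "exp (t * s) * (1 - 2 * (t * s)) \<le> exp (t * s) * exp (- (2 * (t * s)))"
        by (intro mult_left_mono) auto
      also have "\<dots> = exp (- (t * s))" by (simp flip: exp_add)
      finally show "sinh (t * s) \<le> t * s * exp (t * s)"
        by (simp add: sinh_field_def algebra_simps)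
    qed
    have "\<bar>K_hat t \<xi>\<bar> = exp (- (t / 2)) * (sinh (t * s) / s)"
      using 1 s sh by (simp add: K_hat_def s_def abs_mult)
    also have "\<dots> \<le> exp (- (t / 2)) * (t * exp (t * s))"
      using s sh by (intro mult_left_mono) (auto simp: divide_le_eq mult_ac)
    also have "\<dots> = t * exp (- (t / 2) + t * s)" unfolding exp_add by simp
    also have "\<dots> \<le> t * exp (- (t / 20))"
    proof -
      have "t * s \<le> t * (9 / 20)" using s t by (intro mult_left_mono) auto
      then show ?thesis using t by (intro mult_left_mono) auto
    qed
    finally show ?thesis using small 1 by (intro suff) auto
  next
    case 2
    have "\<bar>K_hat t \<xi>\<bar> = t * exp (- (t / 2))" using 2 t by (simp add: K_hat_def abs_mult)
    also have "\<dots> \<le> t * exp (- (t / 20))" using e t by (intro mult_left_mono) auto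
    finally show ?thesis
    proof (rule suff)
      show "t * (1 + norm \<xi>) \<le> 4 * (1 + t)" by (rule small) (simp add: 2)
    qed
  next
    case 3
    define s where "s = sqrt ((norm \<xi>)\<^sup>2 - 1 / 4)"
    have "(1 / 2)\<^sup>2 < (norm \<xi>)\<^sup>2" using 3 by (intro power_strict_mono) auto
    then have q: "1 / 4 < (norm \<xi>)\<^sup>2" by (simp add: power2_eq_square)
    then have s: "0 < s" by (simp add: s_def)
    have K: "\<bar>K_hat t \<xi>\<bar> = exp (- (t / 2)) * (\<bar>sin (t * s)\<bar> / s)"
      using 3 s by (simp add: K_hat_def s_def abs_mult)
    show ?thesis
    proof (cases "norm \<xi> \<le> 1")
      case True
      have "\<bar>sin (t * s)\<bar> / s \<le> t"
        using abs_sin_x_le_abs_x[of "t * s"] s t by (simp add: divide_le_eq abs_mult)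
      then have "\<bar>K_hat t \<xi>\<bar> \<le> exp (- (t / 20)) * t"
        unfolding K using e s by (intro mult_mono) auto
      then show ?thesis using small True by (intro suff[of t]) (auto simp: mult.commute)
    next
      case False
      then have "1 < (norm \<xi>)\<^sup>2" by (simp add: one_less_power)
      then have "norm \<xi> / 2 \<le> s"
        unfolding s_def by (intro real_le_rsqrt) (simp add: power_divide)
      then have "1 / s \<le> 1 / (norm \<xi> / 2)"
        using False s by (intro divide_left_mono mult_pos_pos) auto
      also have "\<dots> = 2 / norm \<xi>" by simp
      also have "2 / norm \<xi> \<le> 4 / (1 + norm \<xi>)"
      proof (rule mult_imp_div_pos_le)
        have "2 \<le> 4 * norm \<xi> / (1 + norm \<xi>)" using False by (intro mult_imp_le_div_pos) auto
        then show "2 \<le> 4 / (1 + norm \<xi>) * norm \<xi>" by simp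
      qed (use False in linarith)
      finally have i: "1 / s \<le> 4 / (1 + norm \<xi>)" .
      have "\<bar>sin (t * s)\<bar> / s \<le> 1 / s" using s by (intro divide_right_mono) auto
      then have "\<bar>sin (t * s)\<bar> / s \<le> 4 / (1 + norm \<xi>)" using i by linarith
      then have "\<bar>K_hat t \<xi>\<bar> \<le> exp (- (t / 20)) * (4 / (1 + norm \<xi>))"
        unfolding K using e s by (intro mult_mono) auto
      moreover have "1 + norm \<xi> \<noteq> 0" using norm_ge_zero[of \<xi>] by linarith
      then have "4 / (1 + norm \<xi>) * (1 + norm \<xi>) = 4" by (rule nonzero_eq_divide_eq[THEN iffD1, OF _ refl])
      ultimately show ?thesis
        using t by (intro suff[of "4 / (1 + norm \<xi>)"]) (simp_all only: mult.commute, simp)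
    qed
  qed
qed

lemma K_hat_heat_diff:
  fixes \<xi> :: "'a::euclidean_space"
  assumes t: "t \<ge> 1"
  shows "\<bar>K_hat t \<xi> - gauss t \<xi>\<bar>
    \<le> 20 / t * gauss (t / 4) \<xi> + 9 * (1 + t) * exp (- (t / 20)) * (1 / (1 + norm \<xi>))"
proof (cases "norm \<xi> \<le> 1 / 4")
  case True
  have "0 \<le> 9 * (1 + t) * exp (- (t / 20)) * (1 / (1 + norm \<xi>))" using t by (simp add: add_nonneg_nonneg)
  then show ?thesis using K_hat_low[of t \<xi>] True t by linarith
next
  case False
  have p: "1 + norm \<xi> > 0" using norm_ge_zero[of \<xi>] by linarith
  have "(1 / 4)\<^sup>2 \<le> (norm \<xi>)\<^sup>2" using False by (intro power_mono) auto
  then have q: "1 / 16 \<le> (norm \<xi>)\<^sup>2" by (simp add: power2_eq_square)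
  have "t * (1 / 20 + (norm \<xi>)\<^sup>2 / 5) \<le> t * (norm \<xi>)\<^sup>2" using q t by (intro mult_left_mono) auto
  moreover have "1 * ((norm \<xi>)\<^sup>2 / 5) \<le> t * ((norm \<xi>)\<^sup>2 / 5)" using t by (intro mult_right_mono) auto
  ultimately have "gauss t \<xi> \<le> exp (- (t / 20) + - ((norm \<xi>)\<^sup>2 / 5))"
    by (simp add: algebra_simps)
  also have "\<dots> = exp (- (t / 20)) * exp (- ((norm \<xi>)\<^sup>2 / 5))" by (rule exp_add)
  also have "\<dots> \<le> exp (- (t / 20)) * (5 / (1 + norm \<xi>))"
  proof (rule mult_left_mono)
    have "1 + norm \<xi> \<le> 5 + (norm \<xi>)\<^sup>2"
    proof -
      have "2 * norm \<xi> \<le> (norm \<xi>)\<^sup>2 + 1" using sum_squares_bound[of "norm \<xi>" 1] by simp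
      then show ?thesis using norm_ge_zero[of \<xi>] by linarith
    qed
    then have "(1 + norm \<xi>) / 5 \<le> (5 + (norm \<xi>)\<^sup>2) / 5" by (rule divide_right_mono) simp
    also have "\<dots> = 1 + (norm \<xi>)\<^sup>2 / 5" by (simp add: add_divide_distrib)
    also have "\<dots> \<le> exp ((norm \<xi>)\<^sup>2 / 5)" by (rule exp_ge_add_one_self)
    finally have "(1 + norm \<xi>) / 5 \<le> exp ((norm \<xi>)\<^sup>2 / 5)" .
    then show "exp (- ((norm \<xi>)\<^sup>2 / 5)) \<le> 5 / (1 + norm \<xi>)"
      using p by (simp add: exp_minus field_simps)
  qed simp
  also have "\<dots> \<le> 5 * (1 + t) * exp (- (t / 20)) * (1 / (1 + norm \<xi>))"
    using t p by (simp add: field_simps)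
  finally have 1: "gauss t \<xi> \<le> 5 * (1 + t) * exp (- (t / 20)) * (1 / (1 + norm \<xi>))" .
  have 2: "\<bar>K_hat t \<xi>\<bar> \<le> 4 * (1 + t) * exp (- (t / 20)) * (1 / (1 + norm \<xi>))"
    using K_hat_high[of t \<xi>] t False by simp
  have 3: "0 \<le> 20 / t * gauss (t / 4) \<xi>" using t by simp
  have "4 * (1 + t) * exp (- (t / 20)) * (1 / (1 + norm \<xi>)) + 5 * (1 + t) * exp (- (t / 20)) * (1 / (1 + norm \<xi>))
     = 9 * (1 + t) * exp (- (t / 20)) * (1 / (1 + norm \<xi>))"
    by (simp add: add_divide_distrib[symmetric] algebra_simps)
  moreover have "0 \<le> gauss t \<xi>" by simp
  ultimately show ?thesis using 1 2 3 by linarith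
qed

lemma K_hat_measurable:
  assumes "DIM('a::euclidean_space) \<le> 3" "t \<ge> 0"
  shows "K_hat t \<in> borel_measurable (borel :: 'a measure)"
  using cone_mult_K_hat[OF assms] by (simp add: cone_mult_def)

lemma
  fixes F :: "'a::euclidean_space \<Rightarrow> complex"
  assumes d: "DIM('a) \<le> 3" and m: "F \<in> borel_measurable lebesgue" and b: "\<And>\<xi>. norm (F \<xi>) \<le> M"
    and i: "integrable lebesgue (\<lambda>\<xi>. 1 / (1 + norm \<xi>) * norm (F \<xi>))"
  shows integrable_K_hat_heat_diff: "\<And>t. t \<ge> 1 \<Longrightarrow> integrable lebesgue (\<lambda>\<xi>. \<bar>K_hat t \<xi> - gauss t \<xi>\<bar> * norm (F \<xi>))"
    and K_hat_heat_error: "((\<lambda>t. sqrt t ^ DIM('a) * (\<integral>\<xi>. \<bar>K_hat t \<xi> - gauss t \<xi>\<bar> * norm (F \<xi>) \<partial>lebesgue)) \<longlongrightarrow> 0) at_top"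
proof -
  define J where "J = (\<integral>\<xi>. 1 / (1 + norm \<xi>) * norm (F \<xi>) \<partial>lebesgue)"
  define D where "D = (\<lambda>t \<xi>. \<bar>K_hat t (\<xi>::'a) - gauss t \<xi>\<bar> * norm (F \<xi>))"
  define B where "B = (\<lambda>t \<xi>. (20 / t * M) * gauss (t / 4) (\<xi>::'a) + (9 * (1 + t) * exp (- (t / 20))) * (1 / (1 + norm \<xi>) * norm (F \<xi>)))"
  have M: "M \<ge> 0" using b[of 0] norm_ge_zero order_trans by blast
  have J: "J \<ge> 0" unfolding J_def by (intro integral_nonneg_AE) (auto intro!: AE_I2 mult_nonneg_nonneg add_nonneg_nonneg)
  have DB: "D t \<xi> \<le> B t \<xi>" if t: "t \<ge> 1" for t \<xi>
  proof -
    have "D t \<xi> \<le> (20 / t * gauss (t / 4) \<xi> + 9 * (1 + t) * exp (- (t / 20)) * (1 / (1 + norm \<xi>))) * norm (F \<xi>)"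
      unfolding D_def by (intro mult_right_mono K_hat_heat_diff[OF t]) auto
    also have "\<dots> = 20 / t * gauss (t / 4) \<xi> * norm (F \<xi>) + 9 * (1 + t) * exp (- (t / 20)) * (1 / (1 + norm \<xi>)) * norm (F \<xi>)"
      by (rule distrib_right)
    also have "20 / t * gauss (t / 4) \<xi> * norm (F \<xi>) \<le> 20 / t * gauss (t / 4) \<xi> * M"
      using t b by (intro mult_left_mono) auto
    finally show ?thesis by (simp add: B_def mult_ac)
  qed
  have Bi: "integrable lebesgue (B t)" if "t \<ge> 1" for t
    unfolding B_def using that by (intro Bochner_Integration.integrable_add integrable_mult_right i integrable_gauss) auto
  have Di: "integrable lebesgue (D t)" if t: "t \<ge> 1" for t
  proof (rule Bochner_Integration.integrable_bound[OF Bi[OF t]])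
    have "K_hat t \<in> borel_measurable (lebesgue :: 'a measure)"
      using t by (intro borel_measurable_lebesgueI K_hat_measurable[OF d]) auto
    moreover have "(\<lambda>\<xi>::'a. gauss t \<xi>) \<in> borel_measurable lebesgue"
      by (intro borel_measurable_lebesgueI) measurable
    ultimately show "D t \<in> borel_measurable lebesgue" unfolding D_def using m by measurable
    show "AE \<xi> in lebesgue. norm (D t \<xi>) \<le> norm (B t \<xi>)"
    proof (rule AE_I2)
      fix \<xi>
      have "0 \<le> D t \<xi>" by (simp add: D_def)
      then show "norm (D t \<xi>) \<le> norm (B t \<xi>)" using DB[OF t, of \<xi>] by simp
    qed
  qed
  then show "\<And>t. t \<ge> 1 \<Longrightarrow> integrable lebesgue (\<lambda>\<xi>. \<bar>K_hat t \<xi> - gauss t \<xi>\<bar> * norm (F \<xi>))"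
    unfolding D_def .
  have est: "sqrt t ^ DIM('a) * (\<integral>\<xi>. D t \<xi> \<partial>lebesgue) \<le> 20 * M * sqrt (4 * pi) ^ DIM('a) / t + J * (t\<^sup>2 * (9 * (1 + t) * exp (- (t / 20))))"
    if t: "t \<ge> 1" for t
  proof -
    have "(\<integral>\<xi>. D t \<xi> \<partial>lebesgue) \<le> (\<integral>\<xi>. B t \<xi> \<partial>lebesgue)"
      using DB[OF t] by (intro integral_mono Di Bi t) auto
    also have "\<dots> = (20 / t * M) * sqrt (pi / (t / 4)) ^ DIM('a) + (9 * (1 + t) * exp (- (t / 20))) * J"
      unfolding B_def J_def using t i integrable_gauss[of "t / 4", where 'a='a]
      by (subst Bochner_Integration.integral_add) (auto simp: integral_gauss simp del: times_divide_eq_left)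
    finally have "sqrt t ^ DIM('a) * (\<integral>\<xi>. D t \<xi> \<partial>lebesgue)
      \<le> sqrt t ^ DIM('a) * ((20 / t * M) * sqrt (pi / (t / 4)) ^ DIM('a) + (9 * (1 + t) * exp (- (t / 20))) * J)"
      using t by (intro mult_left_mono) auto
    also have "\<dots> = 20 * M / t * (sqrt t * sqrt (pi / (t / 4))) ^ DIM('a) + sqrt t ^ DIM('a) * (9 * (1 + t) * exp (- (t / 20)) * J)"
      by (simp add: power_mult_distrib algebra_simps)
    also have "sqrt t * sqrt (pi / (t / 4)) = sqrt (4 * pi)"
      unfolding real_sqrt_mult[symmetric] using t by simp
    also have "sqrt t ^ DIM('a) * (9 * (1 + t) * exp (- (t / 20)) * J) \<le> t\<^sup>2 * (9 * (1 + t) * exp (- (t / 20)) * J)"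
    proof (rule mult_right_mono)
      have "sqrt t ^ DIM('a) \<le> sqrt t ^ 4" using d t by (intro power_increasing) auto
      also have "\<dots> = t\<^sup>2" using t by (simp add: power4_eq_xxxx power2_eq_square)
      finally show "sqrt t ^ DIM('a) \<le> t\<^sup>2" .
    qed (use t J in auto)
    finally show ?thesis by (simp add: mult_ac)
  qed
  have "((\<lambda>t. 20 * M * sqrt (4 * pi) ^ DIM('a) / t) \<longlongrightarrow> 0) at_top"
    by (intro tendsto_divide_0[OF tendsto_const] filterlim_at_top_imp_at_infinity filterlim_ident)
  moreover have "((\<lambda>t::real. t\<^sup>2 * (9 * (1 + t) * exp (- (t / 20)))) \<longlongrightarrow> 0) at_top" by real_asymp
  ultimately have "((\<lambda>t. 20 * M * sqrt (4 * pi) ^ DIM('a) / t + J * (t\<^sup>2 * (9 * (1 + t) * exp (- (t / 20))))) \<longlongrightarrow> 0 + J * 0) at_top"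
    by (intro tendsto_intros)
  then have lim: "((\<lambda>t. 20 * M * sqrt (4 * pi) ^ DIM('a) / t + J * (t\<^sup>2 * (9 * (1 + t) * exp (- (t / 20))))) \<longlongrightarrow> 0) at_top"
    by simp
  have "((\<lambda>t. sqrt t ^ DIM('a) * (\<integral>\<xi>. D t \<xi> \<partial>lebesgue)) \<longlongrightarrow> 0) at_top"
  proof (rule Lim_null_comparison[OF _ lim])
    show "\<forall>\<^sub>F t in at_top. norm (sqrt t ^ DIM('a) * (\<integral>\<xi>. D t \<xi> \<partial>lebesgue))
       \<le> 20 * M * sqrt (4 * pi) ^ DIM('a) / t + J * (t\<^sup>2 * (9 * (1 + t) * exp (- (t / 20))))"
      using eventually_ge_at_top[of 1]
    proof eventually_elim
      case (elim t)
      have "0 \<le> sqrt t ^ DIM('a) * (\<integral>\<xi>. D t \<xi> \<partial>lebesgue)"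
        using elim by (intro mult_nonneg_nonneg integral_nonneg_AE) (auto simp: D_def)
      then show ?case using est[OF elim] by simp
    qed
  qed
  then show "((\<lambda>t. sqrt t ^ DIM('a) * (\<integral>\<xi>. \<bar>K_hat t \<xi> - gauss t \<xi>\<bar> * norm (F \<xi>) \<partial>lebesgue)) \<longlongrightarrow> 0) at_top"
    unfolding D_def .
qed

lemma integrable_inverse_square_weight:
  assumes d: "DIM('a::euclidean_space) \<le> 3"
  shows "integrable lebesgue (\<lambda>x::'a. 1 / (1 + (norm x)\<^sup>2)\<^sup>2)"
proof (rule integrableI_bounded)
  let ?f = "\<lambda>x::'a. 1 / (1 + (norm x)\<^sup>2)\<^sup>2"
  let ?V = "unit_ball_vol (real DIM('a))"
  define a where "a = (\<lambda>k (x::'a). ennreal (16 / 16 ^ k) * indicator (cball 0 (2 ^ k)) x)"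
  show "?f \<in> borel_measurable lebesgue" by (intro borel_measurable_lebesgueI) measurable
  have le: "ennreal (norm (?f x)) \<le> (\<Sum>k. a k x)" for x
  proof -
    obtain k0 where "norm x < 2 ^ k0" using real_arch_pow[of 2 "norm x"] by auto
    then have ex: "norm x \<le> 2 ^ k0" by simp
    define k where "k = (LEAST k. norm x \<le> 2 ^ k)"
    have k: "norm x \<le> 2 ^ k" unfolding k_def by (rule LeastI[of "\<lambda>k. norm x \<le> 2 ^ k", OF ex])
    have "?f x \<le> 16 / 16 ^ k"
    proof (cases k)
      case 0
      have "1 \<le> (1 + (norm x)\<^sup>2)\<^sup>2" by (rule one_le_power) simp
      then have "?f x \<le> 1" by (auto simp: divide_le_eq)
      then show ?thesis using 0 by simp
    next
      case (Suc j)
      have "\<not> norm x \<le> 2 ^ j" using not_less_Least[of j "\<lambda>k. norm x \<le> 2 ^ k"] Suc by (simp add: k_def)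
      then have "(2 ^ j) ^ 4 \<le> norm x ^ 4" by (intro power_mono) auto
      also have "norm x ^ 4 = ((norm x)\<^sup>2)\<^sup>2" by simp
      also have "\<dots> \<le> (1 + (norm x)\<^sup>2)\<^sup>2" by (intro power_mono) auto
      also have "((2::real) ^ j) ^ 4 = 16 ^ j" by (simp flip: power_mult add: mult.commute[of j] power_mult)
      finally have "?f x \<le> 1 / 16 ^ j" by (intro divide_left_mono) (auto intro!: mult_pos_pos add_pos_nonneg zero_less_power)
      then show ?thesis by (simp add: Suc)
    qed
    then have "ennreal (norm (?f x)) \<le> ennreal (16 / 16 ^ k)" by (intro ennreal_leI) simp
    also have "\<dots> = a k x" using k by (simp add: a_def)
    also have "\<dots> \<le> (\<Sum>k. a k x)" using sum_le_suminf[of "\<lambda>k. a k x" "{k}"] by simp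
    finally show ?thesis .
  qed
  have "(\<integral>\<^sup>+x. ennreal (norm (?f x)) \<partial>lebesgue) \<le> (\<integral>\<^sup>+x. (\<Sum>k. a k x) \<partial>lebesgue)"
    by (intro nn_integral_mono le)
  also have "\<dots> = (\<Sum>k. \<integral>\<^sup>+x. a k x \<partial>lebesgue)"
    unfolding a_def
    by (intro nn_integral_suminf borel_measurable_times_ennreal borel_measurable_const borel_measurable_indicator) auto
  also have "\<dots> \<le> (\<Sum>k. ennreal (16 * ?V * (1 / 2) ^ k))"
  proof (intro suminf_le summableI)
    fix k
    have "(\<integral>\<^sup>+x. a k x \<partial>lebesgue) = ennreal (16 / 16 ^ k) * emeasure lebesgue (cball (0::'a) (2 ^ k))"
      unfolding a_def by (rule nn_integral_cmult_indicator) auto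
    also have "emeasure lebesgue (cball (0::'a) (2 ^ k)) = ennreal (?V * (2 ^ k) ^ DIM('a))"
      by (simp add: emeasure_cball)
    also have "ennreal (16 / 16 ^ k) * \<dots> = ennreal (16 / 16 ^ k * (?V * (2 ^ k) ^ DIM('a)))"
      by (rule ennreal_mult[symmetric]) auto
    also have "\<dots> \<le> ennreal (16 * ?V * (1 / 2) ^ k)"
    proof (rule ennreal_leI)
      have "((2::real) ^ k) ^ DIM('a) \<le> (2 ^ k) ^ 3" using d by (intro power_increasing) auto
      also have "((2::real) ^ k) ^ 3 = 8 ^ k" by (simp flip: power_mult add: mult.commute[of k] power_mult)
      finally have "16 / 16 ^ k * (?V * (2 ^ k) ^ DIM('a)) \<le> 16 / 16 ^ k * (?V * 8 ^ k)"
        by (intro mult_left_mono) auto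
      also have "\<dots> = 16 * ?V * (8 / 16) ^ k" unfolding power_divide by simp
      finally show "16 / 16 ^ k * (?V * (2 ^ k) ^ DIM('a)) \<le> 16 * ?V * (1 / 2) ^ k" by simp
    qed
    finally show "(\<integral>\<^sup>+x. a k x \<partial>lebesgue) \<le> ennreal (16 * ?V * (1 / 2) ^ k)" .
  qed
  also have "\<dots> < \<infinity>"
  proof -
    have "summable (\<lambda>k. 16 * ?V * (1 / 2) ^ k)" by (intro summable_mult summable_geometric) simp
    then have "(\<Sum>k. ennreal (16 * ?V * (1 / 2) ^ k)) \<noteq> top" by (intro ennreal_suminf_neq_top) auto
    then show ?thesis by (simp add: top.not_eq_extremum)
  qed
  finally show "(\<integral>\<^sup>+x. ennreal (norm (?f x)) \<partial>lebesgue) < \<infinity>" .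
qed

subsection \<open>Lower bounds for the linear equation\<close>

lemma moll_nonneg:
  assumes "AE x in lebesgue. 0 \<le> f x" "e > 0"
  shows "0 \<le> moll e f y"
  unfolding moll_def
proof (rule integral_nonneg_AE)
  show "AE x in lebesgue. 0 \<le> f x * heat e (x - y)"
    using assms(1) by eventually_elim (simp add: heat_nonneg[OF assms(2)])
qed

lemma moll_lower:
  fixes \<delta> :: real and f :: "'a::euclidean_space \<Rightarrow> real"
  assumes "\<delta> > 0" and f: "f \<in> L2" and f0: "AE x in lebesgue. 0 \<le> f x"
    and fA: "AE x in lebesgue. norm x < \<rho> \<longrightarrow> A \<le> f x" and A: "A \<ge> 0"
  shows "\<exists>e0>0. \<forall>e z. 0 < e \<longrightarrow> e < e0 \<longrightarrow> norm z \<le> \<rho> - \<delta> \<longrightarrow> A / 2 \<le> moll e f z"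
proof -
  have bm: "(indicator (ball 0 \<delta>) :: 'a \<Rightarrow> real) \<in> borel_measurable borel"
    by (intro borel_measurable_indicator) simp
  have "\<forall>\<^sub>F a in nhds (0::'a). (indicator (ball 0 \<delta>) a :: real) = 1"
    using assms(1) by (auto simp: eventually_nhds intro!: exI[of _ "ball 0 \<delta>"])
  then have "isCont (indicator (ball 0 \<delta>) :: 'a \<Rightarrow> real) 0"
    using assms(1) isCont_cong[of "indicator (ball 0 \<delta>) :: 'a \<Rightarrow> real" "\<lambda>_. 1" 0] by simp
  then have "((\<lambda>e. \<integral>a. heat e a * indicator (ball 0 \<delta>) (a::'a) \<partial>lebesgue) \<longlongrightarrow> indicator (ball 0 \<delta>) (0::'a)) (at_right 0)"
    by (intro heat_approx_identity[where B = 1] borel_measurable_lebesgueI bm) (auto split: split_indicator)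
  then have "((\<lambda>e. \<integral>a. heat e a * indicator (ball 0 \<delta>) (a::'a) \<partial>lebesgue) \<longlongrightarrow> 1) (at_right 0)"
    using assms(1) by simp
  then have "\<forall>\<^sub>F e in at_right 0. 1 / 2 < (\<integral>a. heat e a * indicator (ball 0 \<delta>) (a::'a) \<partial>lebesgue)"
    by (rule order_tendstoD(1)) simp
  then obtain e0 where e0: "e0 > 0" and half: "\<And>e. 0 < e \<Longrightarrow> e < e0 \<Longrightarrow> 1 / 2 < (\<integral>a. heat e a * indicator (ball 0 \<delta>) (a::'a) \<partial>lebesgue)"
    by (auto simp: eventually_at_right[of 0 1])
  show ?thesis
  proof (intro exI[of _ e0] conjI e0 allI impI)
    fix e :: real and z :: 'a
    assume e: "0 < e" "e < e0" and z: "norm z \<le> \<rho> - \<delta>"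
    let ?h = "\<lambda>x. heat e (x - z) * indicator (ball 0 \<delta>) (x - z)"
    have hm: "?h \<in> borel_measurable borel"
      by (intro borel_measurable_times measurable_compose[OF _ bm] measurable_compose[OF _ heat_measurable]) auto
    have hm0: "(\<lambda>x. heat e x * indicator (ball 0 \<delta>) x) \<in> borel_measurable (borel :: 'a measure)"
      using bm by (intro borel_measurable_times) auto
    have "(\<integral>x. ?h x \<partial>lebesgue) = (\<integral>x. ?h x \<partial>lborel)"
      by (rule integral_completion) (use hm in simp)
    also have "\<dots> = (\<integral>x. ?h (z + x) \<partial>lborel)"
      by (rule integral_lborel_shift[OF hm, symmetric])
    also have "\<dots> = (\<integral>x. heat e x * indicator (ball 0 \<delta>) (x::'a) \<partial>lborel)"
      by simp
    also have "\<dots> = (\<integral>x. heat e x * indicator (ball 0 \<delta>) (x::'a) \<partial>lebesgue)"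
      by (rule integral_completion[symmetric]) (use hm0 in simp)
    finally have hi: "1 / 2 < (\<integral>x. ?h x \<partial>lebesgue)" using half[OF e] by simp
    have "A / 2 \<le> A * (\<integral>x. ?h x \<partial>lebesgue)"
      using mult_left_mono[OF less_imp_le[OF hi] A] by simp
    also have "\<dots> = (\<integral>x. A * ?h x \<partial>lebesgue)" by simp
    also have "\<dots> \<le> moll e f z"
      unfolding moll_def
    proof (rule integral_mono_AE)
      show "integrable lebesgue (\<lambda>x. f x * heat e (x - z))"
        by (rule L2_mult_integrable[OF f heat_shift_L2[OF e(1)]])
      show "integrable lebesgue (\<lambda>x. A * ?h x)"
      proof (intro integrable_mult_right Bochner_Integration.integrable_bound[OF integrable_heat_shift[OF e(1), of z]])
        show "?h \<in> borel_measurable lebesgue" by (rule borel_measurable_lebesgueI[OF hm])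
      qed (auto split: split_indicator)
      show "AE x in lebesgue. A * ?h x \<le> f x * heat e (x - z)"
        using f0 fA
      proof eventually_elim
        case (elim x)
        show ?case
        proof (cases "x - z \<in> ball 0 \<delta>")
          case True
          then have "norm x < \<rho>" using z norm_triangle_ineq[of "x - z" z] by simp
          then show ?thesis using elim True heat_nonneg[OF e(1), of "x - z"] by (simp add: mult_right_mono)
        next
          case False
          then show ?thesis using elim heat_nonneg[OF e(1), of "x - z"] by simp
        qed
      qed
    qed
    finally show "A / 2 \<le> moll e f z" .
  qed
qed

lemma fourier_multiplier_moll:
  fixes f g :: "'a::euclidean_space \<Rightarrow> real"
  assumes "fourier_multiplier m f g"
  shows "\<exists>F. has_fourier (\<lambda>x. complex_of_real (f x)) F \<and>
    (\<forall>e>0. integrable lebesgue (\<lambda>\<xi>. F \<xi> * complex_of_real (gauss e \<xi>))) \<and>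
    (\<forall>e>0. \<forall>z. fint (\<lambda>\<xi>. F \<xi> * complex_of_real (gauss e \<xi>)) z = complex_of_real ((2 * pi) ^ DIM('a) * moll e f z)) \<and>
    (\<forall>e>0. \<forall>z. fint (\<lambda>\<xi>. complex_of_real (m \<xi>) * (F \<xi> * complex_of_real (gauss e \<xi>))) z = complex_of_real ((2 * pi) ^ DIM('a) * moll e g z))"
proof -
  obtain F where F: "has_fourier (\<lambda>x. complex_of_real (f x)) F"
      "has_fourier (\<lambda>x. complex_of_real (g x)) (\<lambda>\<xi>. complex_of_real (m \<xi>) * F \<xi>)"
    using assms by (auto simp: fourier_multiplier_def)
  have r: "a * b * c = a * (c * b)" "m * (a * b) * c = m * a * (c * b)" for a b c m :: complex
    by (simp_all add: mult_ac)
  show ?thesis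
  proof (intro exI[of _ F] conjI F(1) allI impI)
    fix e :: real assume e: "e > 0"
    show "integrable lebesgue (\<lambda>\<xi>. F \<xi> * complex_of_real (gauss e \<xi>))"
      using has_fourier_gauss_integrable[OF F(1) e, of 0] by simp
  next
    fix e :: real and z assume e: "e > 0"
    show "fint (\<lambda>\<xi>. F \<xi> * complex_of_real (gauss e \<xi>)) z = complex_of_real ((2 * pi) ^ DIM('a) * moll e f z)"
      unfolding fint_def r(1) by (rule has_fourier_moll[OF F(1) e])
  next
    fix e :: real and z assume e: "e > 0"
    show "fint (\<lambda>\<xi>. complex_of_real (m \<xi>) * (F \<xi> * complex_of_real (gauss e \<xi>))) z = complex_of_real ((2 * pi) ^ DIM('a) * moll e g z)"
      unfolding fint_def r(2) by (rule has_fourier_moll[OF F(2) e])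
  qed
qed

lemma K_hat_multiplier_moll:
  fixes f g :: "'a::euclidean_space \<Rightarrow> real"
  assumes d: "DIM('a) \<le> 3" and t: "\<tau> \<ge> 0" and fm: "fourier_multiplier (K_hat \<tau>) f g" and e: "e > 0"
    and B: "\<And>z. norm (z - y) \<le> \<tau> \<Longrightarrow> B \<le> moll e f z"
  shows "(1 - exp (- \<tau>)) * B \<le> moll e g y"
proof -
  obtain F where "has_fourier (\<lambda>x. complex_of_real (f x)) F"
    and F1: "\<And>e. e > 0 \<Longrightarrow> integrable lebesgue (\<lambda>\<xi>. F \<xi> * complex_of_real (gauss e \<xi>))"
    and F2: "\<And>e z. e > 0 \<Longrightarrow> fint (\<lambda>\<xi>. F \<xi> * complex_of_real (gauss e \<xi>)) z = complex_of_real ((2 * pi) ^ DIM('a) * moll e f z)"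
    and F3: "\<And>e z. e > 0 \<Longrightarrow> fint (\<lambda>\<xi>. complex_of_real (K_hat \<tau> \<xi>) * (F \<xi> * complex_of_real (gauss e \<xi>))) z = complex_of_real ((2 * pi) ^ DIM('a) * moll e g z)"
    using fourier_multiplier_moll[OF fm] by blast
  note F = F1[OF e] F2[OF e] F3[OF e]
  have "K_hat \<tau> (0::'a) * ((2 * pi) ^ DIM('a) * B) \<le> Re (fint (\<lambda>\<xi>. complex_of_real (K_hat \<tau> \<xi>) * (F \<xi> * complex_of_real (gauss e \<xi>))) y)"
    using B by (intro cone_multD[OF cone_mult_K_hat[OF d t] F(1)]) (simp only: F(2) Re_complex_of_real, simp)
  also have "\<dots> = (2 * pi) ^ DIM('a) * moll e g y"
    by (simp only: F(3) Re_complex_of_real)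
  finally have "(2 * pi) ^ DIM('a) * ((1 - exp (- \<tau>)) * B) \<le> (2 * pi) ^ DIM('a) * moll e g y"
    by (simp only: K_hat_zero mult.left_commute)
  then show ?thesis by simp
qed

lemma K_hat_multiplier_nonneg:
  fixes f g :: "'a::euclidean_space \<Rightarrow> real"
  assumes d: "DIM('a) \<le> 3" and t: "\<tau> \<ge> 0" and fm: "fourier_multiplier (K_hat \<tau>) f g"
    and f: "AE x in lebesgue. 0 \<le> f x"
  shows "AE x in lebesgue. 0 \<le> g x"
proof -
  have "g \<in> L2" using fm by (simp add: fourier_multiplier_def)
  then have "AE x in lebesgue. x \<in> UNIV \<longrightarrow> 0 \<le> g x"
  proof (rule AE_ge_of_moll_ge[where ?e0.0 = 1])
    fix e :: real and y :: 'a assume "0 < e"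
    then show "0 \<le> moll e g y"
      using K_hat_multiplier_moll[OF d t fm, of e y 0] moll_nonneg[OF f] by simp
  qed auto
  then show ?thesis by simp
qed

lemma K_hat_multiplier_cone:
  fixes f g :: "'a::euclidean_space \<Rightarrow> real"
  assumes d: "DIM('a) \<le> 3" and t: "\<tau> \<ge> 0" and fm: "fourier_multiplier (K_hat \<tau>) f g"
    and f: "AE x in lebesgue. 0 \<le> f x" and A: "A \<ge> 0" "AE x in lebesgue. norm x < \<rho> \<longrightarrow> A \<le> f x"
    and \<rho>: "\<rho>' + \<tau> < \<rho>"
  shows "AE x in lebesgue. norm x < \<rho>' \<longrightarrow> (1 - exp (- \<tau>)) * (A / 2) \<le> g x"
proof -
  have L2: "f \<in> L2" "g \<in> L2" using fm by (auto simp: fourier_multiplier_def)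
  obtain e0 where e0: "e0 > 0" and low: "\<And>e z. 0 < e \<Longrightarrow> e < e0 \<Longrightarrow> norm z \<le> \<rho> - (\<rho> - \<rho>' - \<tau>) \<Longrightarrow> A / 2 \<le> moll e f z"
    using moll_lower[of "\<rho> - \<rho>' - \<tau>" f \<rho> A] \<rho> L2(1) f A by auto
  have "AE x in lebesgue. x \<in> ball 0 \<rho>' \<longrightarrow> (1 - exp (- \<tau>)) * (A / 2) \<le> g x"
  proof (rule AE_ge_of_moll_ge[OF L2(2) open_ball e0])
    fix e :: real and y :: 'a assume e: "0 < e" "e < e0" and y: "y \<in> ball 0 \<rho>'"
    show "(1 - exp (- \<tau>)) * (A / 2) \<le> moll e g y"
    proof (rule K_hat_multiplier_moll[OF d t fm e(1)])
      fix z assume "norm (z - y) \<le> \<tau>"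
      then have "norm z \<le> \<rho> - (\<rho> - \<rho>' - \<tau>)"
        using y norm_triangle_ineq[of "z - y" y] by simp
      then show "A / 2 \<le> moll e f z" by (rule low[OF e])
    qed
  qed
  then show ?thesis by simp
qed

lemma diffusive_constant:
  fixes n :: nat
  assumes "n \<le> 3"
  obtains \<mu> :: real where "\<mu> > 0" "exp (- (\<mu> / 16)) < (1 / sqrt (1 + 4 * \<mu>)) ^ n * exp (- (1 / 2))"
proof -
  have "((\<lambda>\<mu>::real. exp (- (\<mu> / 16)) * (1 + 4 * \<mu>)\<^sup>2 * exp (1 / 2)) \<longlongrightarrow> 0) at_top" by real_asymp
  then have "\<forall>\<^sub>F \<mu> in at_top. exp (- (\<mu> / 16)) * (1 + 4 * \<mu>)\<^sup>2 * exp (1 / 2) < (1::real)"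
    by (rule order_tendstoD(2)) simp
  then have "\<forall>\<^sub>F \<mu> in at_top. exp (- (\<mu> / 16)) * (1 + 4 * \<mu>)\<^sup>2 * exp (1 / 2) < 1 \<and> \<mu> > (0::real)"
    using eventually_gt_at_top[of 0] by eventually_elim auto
  then obtain \<mu> :: real where \<mu>: "exp (- (\<mu> / 16)) * (1 + 4 * \<mu>)\<^sup>2 * exp (1 / 2) < 1" "\<mu> > 0"
    by (auto simp: eventually_at_top_linorder)
  have s: "0 \<le> 1 / sqrt (1 + 4 * \<mu>)" "1 / sqrt (1 + 4 * \<mu>) \<le> 1" using \<mu>(2) by auto
  have "exp (- (\<mu> / 16)) < 1 / (1 + 4 * \<mu>)\<^sup>2 * exp (- (1 / 2))"
    using \<mu> by (simp add: exp_minus field_simps)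
  also have "1 / (1 + 4 * \<mu>)\<^sup>2 = (1 / sqrt (1 + 4 * \<mu>)) ^ 4"
    using \<mu>(2) by (simp add: power_divide power4_eq_xxxx power2_eq_square)
  also have "(1 / sqrt (1 + 4 * \<mu>)) ^ 4 * exp (- (1 / 2)) \<le> (1 / sqrt (1 + 4 * \<mu>)) ^ n * exp (- (1 / 2))"
    using assms s by (intro mult_right_mono power_decreasing) auto
  finally show thesis using that \<mu>(2) by blast
qed

text \<open>The mollified data dominate \<open>A / 2 * (exp (- \<mu> \<bar>x\<bar>\<^sup>2 / \<tau>) - exp (- \<mu> / 16))\<close> everywhere.  The Gaussian
  evolves up to a small error as under the heat flow, the constant does not grow, and for large \<open>\<mu>\<close>
  the Gaussian wins.\<close>

lemma K_hat_multiplier_diffusive: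
  assumes d: "DIM('a::euclidean_space) \<le> 3"
  shows "\<exists>c>0. \<exists>\<tau>0\<ge>1. \<forall>\<tau>\<ge>\<tau>0. \<forall>(f :: 'a \<Rightarrow> real) g A. fourier_multiplier (K_hat \<tau>) f g \<longrightarrow>
      (AE x in lebesgue. 0 \<le> f x) \<longrightarrow> A \<ge> 0 \<longrightarrow> (AE x in lebesgue. norm x < sqrt \<tau> / 2 \<longrightarrow> A \<le> f x) \<longrightarrow>
      (AE x in lebesgue. norm x < sqrt (2 * \<tau>) \<longrightarrow> c * A \<le> g x)"
proof -
  obtain \<mu> :: real where \<mu>: "\<mu> > 0" and \<mu>2: "exp (- (\<mu> / 16)) < (1 / sqrt (1 + 4 * \<mu>)) ^ DIM('a) * exp (- (1 / 2))"
    using diffusive_constant[OF d] by blast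
  define P where "P = (1 / sqrt (1 + 4 * \<mu>)) ^ DIM('a) * exp (- (1 / 2))"
  define N where "N = exp (- (\<mu> / 16))"
  define \<kappa> where "\<kappa> = (P - N) / 2"
  have \<kappa>: "\<kappa> > 0" using \<mu>2 by (simp add: \<kappa>_def P_def N_def)
  define G where "G = (\<lambda>\<xi>::'a. complex_of_real (gauss (1 / (4 * \<mu>)) \<xi>))"
  have Gi: "integrable lebesgue (\<lambda>\<xi>::'a. gauss (1 / (4 * \<mu>)) \<xi>)"
    using \<mu> by (intro integrable_gauss) simp
  have Gm: "G \<in> borel_measurable lebesgue"
    unfolding G_def by (intro borel_measurable_lebesgueI) measurable
  have Gb: "norm (G \<xi>) \<le> 1" for \<xi> using \<mu> by (simp add: G_def)
  have GI: "integrable lebesgue (\<lambda>\<xi>. 1 / (1 + norm \<xi>) * norm (G \<xi>))"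
  proof (rule Bochner_Integration.integrable_bound[OF Gi])
    have "(\<lambda>\<xi>::'a. 1 / (1 + norm \<xi>)) \<in> borel_measurable lebesgue"
      by (intro borel_measurable_lebesgueI) measurable
    then show "(\<lambda>\<xi>. 1 / (1 + norm \<xi>) * norm (G \<xi>)) \<in> borel_measurable lebesgue"
      using Gm by measurable
    show "AE \<xi> in lebesgue. norm (1 / (1 + norm \<xi>) * norm (G \<xi>)) \<le> norm (gauss (1 / (4 * \<mu>)) (\<xi>::'a))"
    proof (rule AE_I2)
      fix \<xi> :: 'a
      have "1 / (1 + norm \<xi>) * norm (G \<xi>) \<le> 1 * norm (G \<xi>)"
        by (intro mult_right_mono) (auto simp: divide_le_eq add_pos_nonneg)
      then show "norm (1 / (1 + norm \<xi>) * norm (G \<xi>)) \<le> norm (gauss (1 / (4 * \<mu>)) \<xi>)"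
        by (simp add: G_def abs_mult add_nonneg_nonneg)
    qed
  qed
  define R where "R = (\<lambda>\<tau>. \<integral>\<xi>. \<bar>K_hat \<tau> \<xi> - gauss \<tau> \<xi>\<bar> * norm (G \<xi>) \<partial>lebesgue)"
  have "((\<lambda>\<tau>. sqrt \<tau> ^ DIM('a) * R \<tau>) \<longlongrightarrow> 0) at_top"
    unfolding R_def by (rule K_hat_heat_error[OF d Gm Gb GI])
  then have "((\<lambda>\<tau>. 1 / sqrt (4 * pi * \<mu>) ^ DIM('a) * (sqrt \<tau> ^ DIM('a) * R \<tau>)) \<longlongrightarrow> 1 / sqrt (4 * pi * \<mu>) ^ DIM('a) * 0) at_top"
    by (intro tendsto_intros)
  then have "\<forall>\<^sub>F \<tau> in at_top. 1 / sqrt (4 * pi * \<mu>) ^ DIM('a) * (sqrt \<tau> ^ DIM('a) * R \<tau>) < \<kappa>"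
    using \<kappa> by (intro order_tendstoD(2)) auto
  then have "\<forall>\<^sub>F \<tau> in at_top. \<tau> \<ge> 1 \<and> 1 / sqrt (4 * pi * \<mu>) ^ DIM('a) * (sqrt \<tau> ^ DIM('a) * R \<tau>) < \<kappa>"
    using eventually_ge_at_top[of 1] by eventually_elim auto
  then obtain \<tau>0 where \<tau>0: "\<And>\<tau>. \<tau> \<ge> \<tau>0 \<Longrightarrow> \<tau> \<ge> 1 \<and> 1 / sqrt (4 * pi * \<mu>) ^ DIM('a) * (sqrt \<tau> ^ DIM('a) * R \<tau>) < \<kappa>"
    unfolding eventually_at_top_linorder by blast
  have k2: "\<kappa> / 2 > 0" using \<kappa> by simp
  show ?thesis
  proof (rule exI[of _ "\<kappa> / 2"], rule conjI[OF k2], rule exI[of _ "max \<tau>0 1"], intro conjI allI impI)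
    fix \<tau> A :: real and f g :: "'a \<Rightarrow> real"
    assume \<tau>: "\<tau> \<ge> max \<tau>0 1" and fm: "fourier_multiplier (K_hat \<tau>) f g" and f0: "AE x in lebesgue. 0 \<le> f x"
      and A: "A \<ge> 0" and fA: "AE x in lebesgue. norm x < sqrt \<tau> / 2 \<longrightarrow> A \<le> f x"
    have \<tau>1: "\<tau> \<ge> 1" and err: "1 / sqrt (4 * pi * \<mu>) ^ DIM('a) * (sqrt \<tau> ^ DIM('a) * R \<tau>) < \<kappa>"
      using \<tau>0[of \<tau>] \<tau> by auto
    have L2: "f \<in> L2" "g \<in> L2" using fm by (auto simp: fourier_multiplier_def)
    define h where "h = \<mu> / \<tau>"
    have h: "h > 0" using \<mu> \<tau>1 by (simp add: h_def)
    define H where "H = (\<lambda>\<xi>::'a. complex_of_real (heat h \<xi>))"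
    have Hi: "integrable lebesgue H" unfolding H_def by (intro integrable_of_real integrable_heat h)
    have Hf: "fint H z = complex_of_real (gauss h z)" for z
      unfolding fint_def H_def by (rule integral_heat_cis[OF h])
    have KH: "integrable lebesgue (\<lambda>\<xi>. complex_of_real (K_hat \<tau> \<xi>) * H \<xi>)"
      using \<tau>1 by (intro cone_mult_integrable[OF cone_mult_K_hat[OF d] Hi]) auto
    have main: "P - \<kappa> \<le> Re (fint (\<lambda>\<xi>. complex_of_real (K_hat \<tau> \<xi>) * H \<xi>) y)" if y: "norm y < sqrt (2 * \<tau>)" for y
    proof -
      let ?E = "\<lambda>\<xi>::'a. complex_of_real (gauss \<tau> \<xi>)"
      have Ei: "integrable lebesgue (\<lambda>\<xi>. ?E \<xi> * H \<xi>)"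
        using \<tau>1 by (intro integrable_bounded_mult[OF Hi, where C = 1]) auto
      define c where "c = \<tau> + \<tau> / (4 * \<mu>)"
      have c: "c > 0" "c \<ge> \<tau>" using \<tau>1 \<mu> by (auto simp: c_def add_pos_pos)
      have EH: "?E \<xi> * H \<xi> * cis (\<xi> \<bullet> y) = complex_of_real (1 / sqrt (4 * pi * h) ^ DIM('a)) * (complex_of_real (gauss c \<xi>) * cis (\<xi> \<bullet> y))" for \<xi>
      proof -
        have "- (\<tau> * (norm \<xi>)\<^sup>2) + - (norm \<xi>)\<^sup>2 / (4 * h) = - (c * (norm \<xi>)\<^sup>2)"
          using \<mu> \<tau>1 by (simp add: c_def h_def field_simps)
        then have "gauss \<tau> \<xi> * heat h \<xi> = 1 / sqrt (4 * pi * h) ^ DIM('a) * gauss c \<xi>"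
          unfolding heat_def by (simp flip: exp_add)
        then have "?E \<xi> * H \<xi> = complex_of_real (1 / sqrt (4 * pi * h) ^ DIM('a)) * complex_of_real (gauss c \<xi>)"
          unfolding H_def of_real_mult[symmetric] by simp
        then show ?thesis by (simp only: mult.assoc)
      qed
      have "fint (\<lambda>\<xi>. ?E \<xi> * H \<xi>) y = complex_of_real (1 / sqrt (4 * pi * h) ^ DIM('a)) * complex_of_real (sqrt (pi / c) ^ DIM('a) * exp (- ((norm y)\<^sup>2 / (4 * c))))"
        unfolding fint_def EH integral_mult_right_zero by (simp only: integral_gauss_cis[OF c(1)])
      also have "\<dots> = complex_of_real ((1 / sqrt (1 + 4 * \<mu>)) ^ DIM('a) * exp (- ((norm y)\<^sup>2 / (4 * c))))"
      proof -
        have "sqrt (pi / c) / sqrt (4 * pi * h) = 1 / sqrt (1 + 4 * \<mu>)"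
        proof -
          have "4 * h * c = 1 + 4 * \<mu>" using \<mu> \<tau>1 by (simp add: c_def h_def field_simps)
          moreover have "(pi / c) / (4 * pi * h) = 1 / (4 * h * c)" by simp
          ultimately have "(pi / c) / (4 * pi * h) = 1 / (1 + 4 * \<mu>)" by (simp only:)
          then show ?thesis by (metis real_sqrt_divide real_sqrt_one)
        qed
        then have "1 / sqrt (4 * pi * h) ^ DIM('a) * sqrt (pi / c) ^ DIM('a) = (1 / sqrt (1 + 4 * \<mu>)) ^ DIM('a)"
          by (metis power_divide mult.commute times_divide_eq_right mult.right_neutral)
        then show ?thesis unfolding of_real_mult[symmetric] mult.assoc[symmetric] by (simp only:)
      qed
      finally have fE: "Re (fint (\<lambda>\<xi>. ?E \<xi> * H \<xi>) y) = (1 / sqrt (1 + 4 * \<mu>)) ^ DIM('a) * exp (- ((norm y)\<^sup>2 / (4 * c)))"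
        by (simp only: Re_complex_of_real)
      have "(norm y)\<^sup>2 \<le> (sqrt (2 * \<tau>))\<^sup>2" using y by (intro power_mono) auto
      then have "(norm y)\<^sup>2 \<le> 2 * \<tau>" using \<tau>1 by simp
      then have "(norm y)\<^sup>2 / (4 * c) \<le> 1 / 2" using c \<tau>1 by (simp add: divide_le_eq)
      then have "P \<le> Re (fint (\<lambda>\<xi>. ?E \<xi> * H \<xi>) y)"
        unfolding fE P_def using \<mu> by (intro mult_left_mono) auto
      moreover have "norm (fint (\<lambda>\<xi>. complex_of_real (K_hat \<tau> \<xi>) * H \<xi>) y - fint (\<lambda>\<xi>. ?E \<xi> * H \<xi>) y) \<le> \<kappa>"
      proof -
        have "fint (\<lambda>\<xi>. complex_of_real (K_hat \<tau> \<xi>) * H \<xi>) y - fint (\<lambda>\<xi>. ?E \<xi> * H \<xi>) y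
            = (\<integral>\<xi>. (complex_of_real (K_hat \<tau> \<xi>) - ?E \<xi>) * H \<xi> * cis (\<xi> \<bullet> y) \<partial>lebesgue)"
          unfolding fint_def using integrable_fint[OF KH, of y] integrable_fint[OF Ei, of y]
          by (simp add: left_diff_distrib flip: Bochner_Integration.integral_diff)
        also have "norm \<dots> \<le> (\<integral>\<xi>. norm ((complex_of_real (K_hat \<tau> \<xi>) - ?E \<xi>) * H \<xi> * cis (\<xi> \<bullet> y)) \<partial>lebesgue)"
          by (rule integral_norm_bound)
        also have "\<dots> \<le> (\<integral>\<xi>. (1 / sqrt (4 * pi * h) ^ DIM('a)) * (\<bar>K_hat \<tau> \<xi> - gauss \<tau> \<xi>\<bar> * norm (G \<xi>)) \<partial>lebesgue)"
        proof (rule integral_mono')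
          show "integrable lebesgue (\<lambda>\<xi>. (1 / sqrt (4 * pi * h) ^ DIM('a)) * (\<bar>K_hat \<tau> \<xi> - gauss \<tau> \<xi>\<bar> * norm (G \<xi>)))"
            by (intro integrable_mult_right integrable_K_hat_heat_diff[OF d Gm Gb GI \<tau>1])
          fix \<xi> :: 'a
          have "norm (H \<xi>) \<le> (1 / sqrt (4 * pi * h) ^ DIM('a)) * norm (G \<xi>)"
          proof -
            have "1 / (4 * \<mu>) * (norm \<xi>)\<^sup>2 \<le> (norm \<xi>)\<^sup>2 / (4 * h)"
            proof -
              have "(norm \<xi>)\<^sup>2 / (4 * \<mu>) * 1 \<le> (norm \<xi>)\<^sup>2 / (4 * \<mu>) * \<tau>"
                using \<tau>1 \<mu> by (intro mult_left_mono) auto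
              then show ?thesis by (simp add: h_def)
            qed
            then have "exp (- (norm \<xi>)\<^sup>2 / (4 * h)) \<le> norm (G \<xi>)" by (simp add: G_def)
            then have "heat h \<xi> \<le> norm (G \<xi>) / sqrt (4 * pi * h) ^ DIM('a)"
              unfolding heat_def using h by (intro divide_right_mono) auto
            moreover have "norm (H \<xi>) = heat h \<xi>"
              unfolding H_def norm_of_real using heat_nonneg[OF h, of \<xi>] by simp
            ultimately show ?thesis by simp
          qed
          then have "norm (complex_of_real (K_hat \<tau> \<xi>) - ?E \<xi>) * norm (H \<xi>)
              \<le> norm (complex_of_real (K_hat \<tau> \<xi>) - ?E \<xi>) * ((1 / sqrt (4 * pi * h) ^ DIM('a)) * norm (G \<xi>))"
            by (rule mult_left_mono) simp
          moreover have "norm (complex_of_real (K_hat \<tau> \<xi>) - ?E \<xi>) = \<bar>K_hat \<tau> \<xi> - gauss \<tau> \<xi>\<bar>"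
            unfolding of_real_diff[symmetric] by (rule norm_of_real)
          ultimately show "norm ((complex_of_real (K_hat \<tau> \<xi>) - ?E \<xi>) * H \<xi> * cis (\<xi> \<bullet> y))
             \<le> (1 / sqrt (4 * pi * h) ^ DIM('a)) * (\<bar>K_hat \<tau> \<xi> - gauss \<tau> \<xi>\<bar> * norm (G \<xi>))"
            by (simp only: norm_mult norm_cis mult_1_right mult.left_commute)
          show "0 \<le> (1 / sqrt (4 * pi * h) ^ DIM('a)) * (\<bar>K_hat \<tau> \<xi> - gauss \<tau> \<xi>\<bar> * norm (G \<xi>))"
            using h by (intro mult_nonneg_nonneg) auto
        qed
        also have "\<dots> = 1 / sqrt (4 * pi * h) ^ DIM('a) * R \<tau>"
          unfolding R_def by (rule integral_mult_right_zero)
        also have "1 / sqrt (4 * pi * h) ^ DIM('a) = 1 / sqrt (4 * pi * \<mu>) ^ DIM('a) * sqrt \<tau> ^ DIM('a)"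
          using \<tau>1 \<mu> by (simp add: h_def real_sqrt_divide power_divide)
        finally show ?thesis using err by (simp add: mult.assoc)
      qed
      ultimately show ?thesis
        using abs_Re_le_cmod[of "fint (\<lambda>\<xi>. complex_of_real (K_hat \<tau> \<xi>) * H \<xi>) y - fint (\<lambda>\<xi>. ?E \<xi> * H \<xi>) y"] by simp
    qed
    have "sqrt \<tau> / 4 > 0" using \<tau>1 by simp
    then obtain e0 where e0: "e0 > 0" and low: "\<And>e z. 0 < e \<Longrightarrow> e < e0 \<Longrightarrow> norm z \<le> sqrt \<tau> / 2 - sqrt \<tau> / 4 \<Longrightarrow> A / 2 \<le> moll e f z"
      using moll_lower[OF _ L2(1) f0 fA A] by blast
    obtain F where "has_fourier (\<lambda>x. complex_of_real (f x)) F" and F: "\<And>e. e > 0 \<Longrightarrow> integrable lebesgue (\<lambda>\<xi>. F \<xi> * complex_of_real (gauss e \<xi>))"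
      "\<And>e z. e > 0 \<Longrightarrow> fint (\<lambda>\<xi>. F \<xi> * complex_of_real (gauss e \<xi>)) z = complex_of_real ((2 * pi) ^ DIM('a) * moll e f z)"
      "\<And>e z. e > 0 \<Longrightarrow> fint (\<lambda>\<xi>. complex_of_real (K_hat \<tau> \<xi>) * (F \<xi> * complex_of_real (gauss e \<xi>))) z = complex_of_real ((2 * pi) ^ DIM('a) * moll e g z)"
      using fourier_multiplier_moll[OF fm] by blast
    have "AE x in lebesgue. x \<in> ball 0 (sqrt (2 * \<tau>)) \<longrightarrow> \<kappa> / 2 * A \<le> g x"
    proof (rule AE_ge_of_moll_ge[OF L2(2) open_ball e0])
      fix e :: real and y :: 'a assume e: "0 < e" "e < e0" and y: "y \<in> ball 0 (sqrt (2 * \<tau>))"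
      let ?c = "(2 * pi) ^ DIM('a) :: real"
      define Fe where "Fe = (\<lambda>\<xi>. F \<xi> * complex_of_real (gauss e \<xi>))"
      define Ft where "Ft = (\<lambda>\<xi>. complex_of_real (1 / ?c) * Fe \<xi> - complex_of_real (A / 2) * H \<xi>)"
      have Fei: "integrable lebesgue Fe" unfolding Fe_def by (rule F(1)[OF e(1)])
      have Fti: "integrable lebesgue Ft"
        unfolding Ft_def by (intro Bochner_Integration.integrable_diff integrable_mult_right Fei Hi)
      have lin: "fint (\<lambda>\<xi>. complex_of_real (1 / ?c) * X \<xi> - complex_of_real (A / 2) * Y \<xi>) z
          = complex_of_real (1 / ?c) * fint X z - complex_of_real (A / 2) * fint Y z"
        if "integrable lebesgue X" "integrable lebesgue Y" for X Y :: "'a \<Rightarrow> complex" and z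
      proof -
        have "(complex_of_real (1 / ?c) * X \<xi> - complex_of_real (A / 2) * Y \<xi>) * cis (\<xi> \<bullet> z)
           = complex_of_real (1 / ?c) * (X \<xi> * cis (\<xi> \<bullet> z)) - complex_of_real (A / 2) * (Y \<xi> * cis (\<xi> \<bullet> z))" for \<xi>
          by (simp only: left_diff_distrib mult.assoc)
        then show ?thesis
          unfolding fint_def using integrable_fint[OF that(1), of z] integrable_fint[OF that(2), of z]
          by (simp only: Bochner_Integration.integral_diff integrable_mult_right integral_mult_right_zero)
      qed
      have c0: "?c > 0" by simp
      have cc: "1 / ?c * (?c * x) = x" for x using c0 by simp
      have ft: "Re (fint Ft z) = moll e f z - A / 2 * gauss h z" for z
      proof -
        have "fint Ft z = complex_of_real (1 / ?c * (?c * moll e f z) - A / 2 * gauss h z)"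
          unfolding Ft_def lin[OF Fei Hi] Hf unfolding Fe_def F(2)[OF e(1)]
          by (simp only: of_real_diff of_real_mult)
        then show ?thesis unfolding cc by simp
      qed
      have B: "- (A / 2 * N) \<le> Re (fint Ft z)" for z
      proof (cases "norm z \<le> sqrt \<tau> / 4")
        case True
        have "A / 2 \<le> moll e f z" using True by (intro low e) simp
        moreover have "A / 2 * gauss h z \<le> A / 2 * 1" using A h by (intro mult_left_mono) auto
        moreover have "0 \<le> A / 2 * N" using A by (simp add: N_def)
        ultimately show ?thesis unfolding ft by linarith
      next
        case False
        have "(sqrt \<tau> / 4)\<^sup>2 \<le> (norm z)\<^sup>2" using False \<tau>1 by (intro power_mono) auto
        then have "\<tau> / 16 \<le> (norm z)\<^sup>2" using \<tau>1 by (simp add: power_divide)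
        then have "h * (\<tau> / 16) \<le> h * (norm z)\<^sup>2" using h by (intro mult_left_mono) auto
        moreover have "h * (\<tau> / 16) = \<mu> / 16" using \<tau>1 by (simp add: h_def)
        ultimately have "gauss h z \<le> N" by (simp add: N_def)
        then have "A / 2 * gauss h z \<le> A / 2 * N" using A by (intro mult_left_mono) auto
        moreover have "0 \<le> moll e f z" by (rule moll_nonneg[OF f0 e(1)])
        ultimately show ?thesis unfolding ft by linarith
      qed
      have "K_hat \<tau> (0::'a) * - (A / 2 * N) \<le> Re (fint (\<lambda>\<xi>. complex_of_real (K_hat \<tau> \<xi>) * Ft \<xi>) y)"
        using \<tau>1 by (intro cone_multD[OF cone_mult_K_hat[OF d] Fti B]) auto
      also have "fint (\<lambda>\<xi>. complex_of_real (K_hat \<tau> \<xi>) * Ft \<xi>) y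
         = complex_of_real (moll e g y) - complex_of_real (A / 2) * fint (\<lambda>\<xi>. complex_of_real (K_hat \<tau> \<xi>) * H \<xi>) y"
      proof -
        have KF: "integrable lebesgue (\<lambda>\<xi>. complex_of_real (K_hat \<tau> \<xi>) * Fe \<xi>)"
          using \<tau>1 by (intro cone_mult_integrable[OF cone_mult_K_hat[OF d] Fei]) auto
        have "complex_of_real (K_hat \<tau> \<xi>) * Ft \<xi>
           = complex_of_real (1 / ?c) * (complex_of_real (K_hat \<tau> \<xi>) * Fe \<xi>) - complex_of_real (A / 2) * (complex_of_real (K_hat \<tau> \<xi>) * H \<xi>)" for \<xi>
          unfolding Ft_def right_diff_distrib by (simp only: mult.left_commute)
        then have "fint (\<lambda>\<xi>. complex_of_real (K_hat \<tau> \<xi>) * Ft \<xi>) y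
           = complex_of_real (1 / ?c) * fint (\<lambda>\<xi>. complex_of_real (K_hat \<tau> \<xi>) * Fe \<xi>) y - complex_of_real (A / 2) * fint (\<lambda>\<xi>. complex_of_real (K_hat \<tau> \<xi>) * H \<xi>) y"
          by (simp only: lin[OF KF KH])
        also have "fint (\<lambda>\<xi>. complex_of_real (K_hat \<tau> \<xi>) * Fe \<xi>) y = complex_of_real (?c * moll e g y)"
          unfolding Fe_def by (rule F(3)[OF e(1)])
        finally show ?thesis unfolding of_real_mult[symmetric] cc .
      qed
      finally have "K_hat \<tau> (0::'a) * - (A / 2 * N) \<le> moll e g y - A / 2 * Re (fint (\<lambda>\<xi>. complex_of_real (K_hat \<tau> \<xi>) * H \<xi>) y)"
        by simp
      moreover have "A / 2 * (P - \<kappa>) \<le> A / 2 * Re (fint (\<lambda>\<xi>. complex_of_real (K_hat \<tau> \<xi>) * H \<xi>) y)"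
        using y A by (intro mult_left_mono main) auto
      moreover have "- (A / 2 * N) \<le> K_hat \<tau> (0::'a) * - (A / 2 * N)"
      proof -
        have "K_hat \<tau> (0::'a) * (A / 2 * N) \<le> 1 * (A / 2 * N)"
          using A unfolding K_hat_zero by (intro mult_right_mono) (auto simp: N_def)
        then show ?thesis by simp
      qed
      ultimately have "A / 2 * (P - \<kappa>) - A / 2 * N \<le> moll e g y" by linarith
      moreover have "A / 2 * (P - \<kappa>) - A / 2 * N = \<kappa> / 2 * A"
        by (simp add: \<kappa>_def field_simps)
      ultimately show "\<kappa> / 2 * A \<le> moll e g y" by simp
    qed
    then show "AE x in lebesgue. norm x < sqrt (2 * \<tau>) \<longrightarrow> \<kappa> / 2 * A \<le> g x" by simp
  qed simp
qed

lemma
  fixes f :: "'a::euclidean_space \<Rightarrow> real"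
  assumes f: "integrable lebesgue f"
  defines "F \<equiv> \<lambda>\<xi>. \<integral>x. cis (- (x \<bullet> \<xi>)) * complex_of_real (f x) \<partial>lebesgue"
  shows L1_transform_measurable: "F \<in> borel_measurable lebesgue"
    and L1_transform_bounded: "norm (F \<xi>) \<le> (\<integral>x. \<bar>f x\<bar> \<partial>lebesgue)"
    and L1_transform_isCont: "isCont F \<xi>"
proof -
  have [measurable]: "f \<in> borel_measurable lebesgue" using f by auto
  have c1: "(\<lambda>x. cis (- (x \<bullet> \<xi>))) \<in> borel_measurable lebesgue" for \<xi> :: 'a
    by (intro borel_measurable_lebesgueI) measurable
  have m1 [measurable]: "(\<lambda>x. cis (- (x \<bullet> \<xi>)) * complex_of_real (f x)) \<in> borel_measurable lebesgue" for \<xi>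
    using c1[of \<xi>] by measurable
  show "norm (F \<xi>) \<le> (\<integral>x. \<bar>f x\<bar> \<partial>lebesgue)" for \<xi>
    unfolding F_def by (rule order.trans[OF integral_norm_bound]) (simp add: norm_mult)
  show cont: "isCont F \<xi>" for \<xi>
    unfolding continuous_at_sequentially comp_def
  proof (intro allI impI)
    fix X assume X: "X \<longlonglongrightarrow> \<xi>"
    show "(\<lambda>n. F (X n)) \<longlonglongrightarrow> F \<xi>"
      unfolding F_def
    proof (rule integral_dominated_convergence[where w = "\<lambda>x. \<bar>f x\<bar>"])
      show "AE x in lebesgue. (\<lambda>n. cis (- (x \<bullet> X n)) * complex_of_real (f x)) \<longlonglongrightarrow> cis (- (x \<bullet> \<xi>)) * complex_of_real (f x)"
        by (intro AE_I2 tendsto_intros X)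
      show "integrable lebesgue (\<lambda>x. \<bar>f x\<bar>)" using f by simp
    qed (auto simp: norm_mult m1)
  qed
  then have "continuous_on UNIV F" by (simp add: continuous_at_imp_continuous_on)
  then show "F \<in> borel_measurable lebesgue"
    by (intro borel_measurable_lebesgueI borel_measurable_continuous_onI)
qed

lemma H1_transform_weighted:
  fixes f :: "'a::euclidean_space \<Rightarrow> real"
  assumes d: "DIM('a) \<le> 3" and f: "integrable lebesgue f" "f \<in> H1"
  shows "integrable lebesgue (\<lambda>\<xi>. 1 / (1 + norm \<xi>) * norm (\<integral>x. cis (- (x \<bullet> \<xi>)) * complex_of_real (f x) \<partial>lebesgue))"
proof -
  define F0 where "F0 = (\<lambda>\<xi>. \<integral>x. cis (- (x \<bullet> \<xi>)) * complex_of_real (f x) \<partial>lebesgue)"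
  obtain F where F: "has_fourier (\<lambda>x. complex_of_real (f x)) F"
      "integrable lebesgue (\<lambda>\<xi>. (1 + (norm \<xi>)\<^sup>2) * (norm (F \<xi>))\<^sup>2)"
    using f(2) by (auto simp: H1_def)
  have AE: "AE \<xi> in lebesgue. F \<xi> = F0 \<xi>"
    unfolding F0_def by (rule has_fourier_L1[OF F(1)]) (use f(1) in simp)
  have F0m: "F0 \<in> borel_measurable lebesgue"
    unfolding F0_def by (rule L1_transform_measurable[OF f(1)])
  have wm: "(\<lambda>\<xi>::'a. 1 / (1 + norm \<xi>)) \<in> borel_measurable lebesgue"
    by (intro borel_measurable_lebesgueI) measurable
  have "integrable lebesgue (\<lambda>\<xi>. (1 + (norm \<xi>)\<^sup>2) * (norm (F \<xi>))\<^sup>2 + 1 / (1 + (norm \<xi>)\<^sup>2)\<^sup>2)"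
    by (intro Bochner_Integration.integrable_add F(2) integrable_inverse_square_weight[OF d])
  then have "integrable lebesgue (\<lambda>\<xi>. 1 / (1 + norm \<xi>) * norm (F0 \<xi>))"
  proof (rule Bochner_Integration.integrable_bound)
    show "(\<lambda>\<xi>. 1 / (1 + norm \<xi>) * norm (F0 \<xi>)) \<in> borel_measurable lebesgue"
      using wm F0m by measurable
    show "AE \<xi> in lebesgue. norm (1 / (1 + norm \<xi>) * norm (F0 \<xi>))
        \<le> norm ((1 + (norm \<xi>)\<^sup>2) * (norm (F \<xi>))\<^sup>2 + 1 / (1 + (norm \<xi>)\<^sup>2)\<^sup>2)"
      using AE
    proof eventually_elim
      case (elim \<xi>)
      let ?r = "norm \<xi>" and ?w = "1 + (norm \<xi>)\<^sup>2"
      have w: "?w > 0" by (simp add: add_pos_nonneg)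
      have le: "?w \<le> (1 + ?r)\<^sup>2" by (simp add: power2_sum)
      define a where "a = sqrt ?w * norm (F \<xi>)"
      define b where "b = 1 / ((1 + ?r) * sqrt ?w)"
      have ab: "1 / (1 + ?r) * norm (F0 \<xi>) = a * b"
        using w elim by (simp add: a_def b_def)
      have "0 \<le> a * b" unfolding a_def b_def using w by (intro mult_nonneg_nonneg divide_nonneg_nonneg) auto
      moreover have "2 * (a * b) \<le> a\<^sup>2 + b\<^sup>2" using sum_squares_bound[of a b] by simp
      moreover have "a\<^sup>2 = ?w * (norm (F \<xi>))\<^sup>2" using w by (simp add: a_def power_mult_distrib)
      moreover have "b\<^sup>2 \<le> 1 / ?w\<^sup>2"
      proof -
        have "b\<^sup>2 = 1 / ((1 + ?r)\<^sup>2 * ?w)" using w by (simp add: b_def power_divide power_mult_distrib)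
        also have "\<dots> \<le> 1 / (?w * ?w)"
          using w le by (intro divide_left_mono mult_right_mono mult_pos_pos) auto
        finally show ?thesis by (simp add: power2_eq_square)
      qed
      ultimately show ?case unfolding ab real_norm_def by linarith
    qed
  qed
  then show ?thesis unfolding F0_def .
qed

lemma linear_lower:
  fixes f :: "'a::euclidean_space \<Rightarrow> real"
  assumes d: "DIM('a) \<le> 3" and f: "integrable lebesgue f" "f \<in> H1" and pos: "(\<integral>x. f x \<partial>lebesgue) > 0"
  shows "\<exists>c>0. \<exists>t0\<ge>1. \<forall>t\<ge>t0. \<forall>g. fourier_multiplier (K_hat t) f g \<longrightarrow>
    (AE x in lebesgue. norm x < sqrt t \<longrightarrow> c / sqrt t ^ DIM('a) \<le> g x)"
proof -
  define F0 where "F0 = (\<lambda>\<xi>. \<integral>x. cis (- (x \<bullet> \<xi>)) * complex_of_real (f x) \<partial>lebesgue)"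
  define M where "M = (\<integral>x. f x \<partial>lebesgue)"
  define L where "L = (\<integral>x. \<bar>f x\<bar> \<partial>lebesgue)"
  have M: "M > 0" using pos by (simp add: M_def)
  have F0m: "F0 \<in> borel_measurable lebesgue"
    unfolding F0_def by (rule L1_transform_measurable[OF f(1)])
  have F0b: "norm (F0 \<xi>) \<le> L" for \<xi>
    unfolding F0_def L_def by (rule L1_transform_bounded[OF f(1)])
  have F00: "F0 0 = complex_of_real M" by (simp add: F0_def M_def)
  have F0w: "integrable lebesgue (\<lambda>\<xi>. 1 / (1 + norm \<xi>) * norm (F0 \<xi>))"
    unfolding F0_def by (rule H1_transform_weighted[OF d f])
  have L: "M \<le> L" using F0b[of 0] M by (simp add: F00)
  let ?E = "\<lambda>t \<xi>::'a. gauss t \<xi>"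
  define R1 where "R1 = (\<lambda>t. \<integral>\<xi>. \<bar>K_hat t \<xi> - ?E t \<xi>\<bar> * norm (F0 \<xi>) \<partial>lebesgue)"
  define R2 where "R2 = (\<lambda>t. \<integral>\<xi>. ?E t \<xi> * norm (F0 \<xi> - complex_of_real M) \<partial>lebesgue)"
  have R1: "((\<lambda>t. sqrt t ^ DIM('a) * R1 t) \<longlongrightarrow> 0) at_top"
    unfolding R1_def by (rule K_hat_heat_error[OF d F0m F0b F0w])
  have R2: "((\<lambda>t. sqrt t ^ DIM('a) * R2 t) \<longlongrightarrow> 0) at_top"
  proof -
    define \<Phi> where "\<Phi> = (\<lambda>\<xi>. norm (F0 \<xi> - complex_of_real M))"
    have \<Phi>m: "\<Phi> \<in> borel_measurable lebesgue" unfolding \<Phi>_def using F0m by measurable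
    have \<Phi>b: "\<bar>\<Phi> \<xi>\<bar> \<le> 2 * L" for \<xi>
      unfolding \<Phi>_def using norm_triangle_ineq4[of "F0 \<xi>" "complex_of_real M"] F0b[of \<xi>] L M by simp
    have \<Phi>c: "isCont \<Phi> 0"
      unfolding \<Phi>_def by (intro continuous_intros) (unfold F0_def, rule L1_transform_isCont[OF f(1)])
    have fl: "filterlim (\<lambda>t::real. 1 / (4 * t)) (at_right 0) at_top" by real_asymp
    have "((\<lambda>t. \<integral>a. heat (1 / (4 * t)) a * \<Phi> a \<partial>lebesgue) \<longlongrightarrow> \<Phi> 0) at_top"
      by (rule filterlim_compose[OF heat_approx_identity[OF \<Phi>m \<Phi>b \<Phi>c] fl])
    then have "((\<lambda>t. sqrt pi ^ DIM('a) * (\<integral>a. heat (1 / (4 * t)) a * \<Phi> a \<partial>lebesgue)) \<longlongrightarrow> sqrt pi ^ DIM('a) * \<Phi> 0) at_top"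
      by (intro tendsto_intros)
    then have 1: "((\<lambda>t. sqrt pi ^ DIM('a) * (\<integral>a. heat (1 / (4 * t)) a * \<Phi> a \<partial>lebesgue)) \<longlongrightarrow> 0) at_top"
      by (simp add: \<Phi>_def F00)
    show ?thesis
    proof (rule Lim_transform_eventually[OF 1])
      show "\<forall>\<^sub>F t in at_top. sqrt pi ^ DIM('a) * (\<integral>a. heat (1 / (4 * t)) a * \<Phi> a \<partial>lebesgue) = sqrt t ^ DIM('a) * R2 t"
        using eventually_gt_at_top[of 0]
      proof eventually_elim
        case (elim t)
        have E: "?E t \<xi> * \<Phi> \<xi> = sqrt (pi / t) ^ DIM('a) * (heat (1 / (4 * t)) \<xi> * \<Phi> \<xi>)" for \<xi>
          unfolding exp_eq_heat[OF elim] by simp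
        have "R2 t = (\<integral>\<xi>. ?E t \<xi> * \<Phi> \<xi> \<partial>lebesgue)" by (simp only: R2_def \<Phi>_def)
        then have "R2 t = sqrt (pi / t) ^ DIM('a) * (\<integral>a. heat (1 / (4 * t)) a * \<Phi> a \<partial>lebesgue)"
          unfolding E integral_mult_right_zero .
        moreover have "sqrt t ^ DIM('a) * sqrt (pi / t) ^ DIM('a) = sqrt pi ^ DIM('a)"
          unfolding power_mult_distrib[symmetric] real_sqrt_mult[symmetric] using elim by simp
        ultimately show ?case by (simp only: mult.assoc[symmetric])
      qed
    qed
  qed
  define c where "c = M * sqrt (pi / 2) ^ DIM('a) * exp (- 1) / 2"
  have c: "c > 0" using M by (simp add: c_def)
  have "((\<lambda>t. sqrt t ^ DIM('a) * R1 t + sqrt t ^ DIM('a) * R2 t) \<longlongrightarrow> 0 + 0) at_top"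
    by (intro tendsto_add R1 R2)
  then have "\<forall>\<^sub>F t in at_top. sqrt t ^ DIM('a) * R1 t + sqrt t ^ DIM('a) * R2 t < c"
    using c by (intro order_tendstoD(2)) auto
  then have "\<forall>\<^sub>F t in at_top. t \<ge> 1 \<and> sqrt t ^ DIM('a) * R1 t + sqrt t ^ DIM('a) * R2 t < c"
    using eventually_ge_at_top[of 1] by eventually_elim auto
  then obtain t0 where t0: "\<And>t. t \<ge> t0 \<Longrightarrow> t \<ge> 1 \<and> sqrt t ^ DIM('a) * R1 t + sqrt t ^ DIM('a) * R2 t < c"
    unfolding eventually_at_top_linorder by blast
  define C where "C = (2 * pi) ^ DIM('a)"
  have C: "C > 0" by (simp add: C_def)
  have main: "AE x in lebesgue. norm x < sqrt t \<longrightarrow> c / C / sqrt t ^ DIM('a) \<le> g x"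
    if t: "t \<ge> max t0 1" and fm: "fourier_multiplier (K_hat t) f g" for t and g :: "'a \<Rightarrow> real"
  proof -
    have t1: "t \<ge> 1" and err: "sqrt t ^ DIM('a) * R1 t + sqrt t ^ DIM('a) * R2 t < c"
      using t0[of t] t by auto
    have gL2: "g \<in> L2" using fm by (simp add: fourier_multiplier_def)
    obtain F where F: "has_fourier (\<lambda>x. complex_of_real (f x)) F"
      "\<And>e. e > 0 \<Longrightarrow> integrable lebesgue (\<lambda>\<xi>. F \<xi> * complex_of_real (gauss e \<xi>))"
      "\<And>e z. e > 0 \<Longrightarrow> fint (\<lambda>\<xi>. complex_of_real (K_hat t \<xi>) * (F \<xi> * complex_of_real (gauss e \<xi>))) z = complex_of_real ((2 * pi) ^ DIM('a) * moll e g z)"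
      using fourier_multiplier_moll[OF fm] by blast
    have AE: "AE \<xi> in lebesgue. F \<xi> = F0 \<xi>"
      unfolding F0_def by (rule has_fourier_L1[OF F(1)]) (use f(1) in simp)
    have "AE x in lebesgue. x \<in> ball 0 (sqrt t) \<longrightarrow> c / C / sqrt t ^ DIM('a) \<le> g x"
    proof (rule AE_ge_of_moll_ge[OF gL2 open_ball zero_less_one])
      fix e :: real and y :: 'a assume e: "0 < e" "e < 1" and y: "y \<in> ball 0 (sqrt t)"
      let ?g = "\<lambda>\<xi>::'a. complex_of_real (gauss e \<xi>)"
      define X where "X = (\<lambda>\<xi>. complex_of_real (K_hat t \<xi>) * (F \<xi> * ?g \<xi>))"
      define Y where "Y = (\<lambda>\<xi>::'a. complex_of_real M * complex_of_real (gauss (t + e) \<xi>))"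
      have Xi: "integrable lebesgue X"
        unfolding X_def using t1 by (intro cone_mult_integrable[OF cone_mult_K_hat[OF d] F(2)] e) auto
      have Yi: "integrable lebesgue Y"
        unfolding Y_def using t1 e by (intro integrable_mult_right integrable_of_real integrable_gauss) auto
      have Ei: "integrable lebesgue (\<lambda>\<xi>. ?E t \<xi> * norm (F0 \<xi> - complex_of_real M))"
      proof (rule Bochner_Integration.integrable_bound[OF integrable_mult_right[OF integrable_gauss[of t], of "2 * L"]])
        have "(\<lambda>\<xi>. ?E t \<xi>) \<in> borel_measurable lebesgue" by (intro borel_measurable_lebesgueI) measurable
        then show "(\<lambda>\<xi>. ?E t \<xi> * norm (F0 \<xi> - complex_of_real M)) \<in> borel_measurable lebesgue"
          using F0m by measurable
        show "AE \<xi> in lebesgue. norm (?E t \<xi> * norm (F0 \<xi> - complex_of_real M)) \<le> norm (2 * L * ?E t \<xi>)"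
        proof (rule AE_I2)
          fix \<xi>
          have "norm (F0 \<xi> - complex_of_real M) \<le> 2 * L"
            using norm_triangle_ineq4[of "F0 \<xi>" "complex_of_real M"] F0b[of \<xi>] L M by simp
          then have "?E t \<xi> * norm (F0 \<xi> - complex_of_real M) \<le> ?E t \<xi> * (2 * L)" by (rule mult_left_mono) simp
          then show "norm (?E t \<xi> * norm (F0 \<xi> - complex_of_real M)) \<le> norm (2 * L * ?E t \<xi>)"
            using L M by (simp add: abs_mult mult_ac)
        qed
      qed (use t1 in auto)
      have D1: "integrable lebesgue (\<lambda>\<xi>. \<bar>K_hat t \<xi> - ?E t \<xi>\<bar> * norm (F0 \<xi>))"
        by (rule integrable_K_hat_heat_diff[OF d F0m F0b F0w t1])
      have "norm (fint X y - fint Y y) = norm (\<integral>\<xi>. X \<xi> * cis (\<xi> \<bullet> y) - Y \<xi> * cis (\<xi> \<bullet> y) \<partial>lebesgue)"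
        unfolding fint_def using integrable_fint[OF Xi, of y] integrable_fint[OF Yi, of y] by simp
      also have "\<dots> \<le> (\<integral>\<xi>. norm (X \<xi> * cis (\<xi> \<bullet> y) - Y \<xi> * cis (\<xi> \<bullet> y)) \<partial>lebesgue)"
        by (rule integral_norm_bound)
      also have "\<dots> \<le> (\<integral>\<xi>. \<bar>K_hat t \<xi> - ?E t \<xi>\<bar> * norm (F0 \<xi>) + ?E t \<xi> * norm (F0 \<xi> - complex_of_real M) \<partial>lebesgue)"
      proof (rule integral_mono_AE)
        show "integrable lebesgue (\<lambda>\<xi>. norm (X \<xi> * cis (\<xi> \<bullet> y) - Y \<xi> * cis (\<xi> \<bullet> y)))"
          by (intro integrable_norm Bochner_Integration.integrable_diff integrable_fint Xi Yi)
        show "integrable lebesgue (\<lambda>\<xi>. \<bar>K_hat t \<xi> - ?E t \<xi>\<bar> * norm (F0 \<xi>) + ?E t \<xi> * norm (F0 \<xi> - complex_of_real M))"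
          by (intro Bochner_Integration.integrable_add D1 Ei)
        show "AE \<xi> in lebesgue. norm (X \<xi> * cis (\<xi> \<bullet> y) - Y \<xi> * cis (\<xi> \<bullet> y))
            \<le> \<bar>K_hat t \<xi> - ?E t \<xi>\<bar> * norm (F0 \<xi>) + ?E t \<xi> * norm (F0 \<xi> - complex_of_real M)"
          using AE
        proof eventually_elim
          case (elim \<xi>)
          let ?Ec = "complex_of_real (?E t \<xi>)" and ?K = "complex_of_real (K_hat t \<xi>)"
          have "gauss (t + e) \<xi> = ?E t \<xi> * gauss e \<xi>"
            by (simp add: distrib_right flip: exp_add)
          then have Y: "Y \<xi> = complex_of_real M * (?Ec * ?g \<xi>)" by (simp only: Y_def of_real_mult)
          have "X \<xi> - Y \<xi> = ((?K - ?Ec) * F0 \<xi> + ?Ec * (F0 \<xi> - complex_of_real M)) * ?g \<xi>"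
            unfolding X_def Y elim by (simp add: algebra_simps)
          then have "norm (X \<xi> * cis (\<xi> \<bullet> y) - Y \<xi> * cis (\<xi> \<bullet> y))
              = norm ((?K - ?Ec) * F0 \<xi> + ?Ec * (F0 \<xi> - complex_of_real M)) * norm (?g \<xi>)"
            by (simp only: left_diff_distrib[symmetric] norm_mult norm_cis mult_1_right)
          also have "\<dots> \<le> norm ((?K - ?Ec) * F0 \<xi> + ?Ec * (F0 \<xi> - complex_of_real M)) * 1"
            using e by (intro mult_left_mono) auto
          also have "\<dots> \<le> norm ((?K - ?Ec) * F0 \<xi>) + norm (?Ec * (F0 \<xi> - complex_of_real M))"
            unfolding mult_1_right by (rule norm_triangle_ineq)
          also have "\<dots> = \<bar>K_hat t \<xi> - ?E t \<xi>\<bar> * norm (F0 \<xi>) + ?E t \<xi> * norm (F0 \<xi> - complex_of_real M)"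
            unfolding norm_mult of_real_diff[symmetric] norm_of_real by simp
          finally show ?case .
        qed
      qed
      also have "\<dots> = R1 t + R2 t"
        unfolding R1_def R2_def by (rule Bochner_Integration.integral_add[OF D1 Ei])
      finally have dist: "norm (fint X y - fint Y y) \<le> R1 t + R2 t" .
      have "fint X y = complex_of_real (C * moll e g y)"
        unfolding X_def C_def by (rule F(3)[OF e(1)])
      moreover have "fint Y y = complex_of_real (M * (sqrt (pi / (t + e)) ^ DIM('a) * exp (- ((norm y)\<^sup>2 / (4 * (t + e))))))"
      proof -
        have "fint Y y = complex_of_real M * (\<integral>x. complex_of_real (gauss (t + e) x) * cis (x \<bullet> y) \<partial>lebesgue)"
          unfolding fint_def Y_def mult.assoc by (rule integral_mult_right_zero)
        also have "(\<integral>x. complex_of_real (gauss (t + e) x) * cis (x \<bullet> y) \<partial>lebesgue)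
            = complex_of_real (sqrt (pi / (t + e)) ^ DIM('a) * exp (- ((norm y)\<^sup>2 / (4 * (t + e)))))"
          by (rule integral_gauss_cis) (use t1 e in simp)
        finally show ?thesis by (simp only: of_real_mult)
      qed
      ultimately have "\<bar>C * moll e g y - M * (sqrt (pi / (t + e)) ^ DIM('a) * exp (- ((norm y)\<^sup>2 / (4 * (t + e)))))\<bar> \<le> R1 t + R2 t"
        using dist by (simp only: of_real_diff[symmetric] norm_of_real)
      then have low: "M * (sqrt (pi / (t + e)) ^ DIM('a) * exp (- ((norm y)\<^sup>2 / (4 * (t + e))))) - (R1 t + R2 t) \<le> C * moll e g y"
        by linarith
      have s0: "sqrt t ^ DIM('a) > 0" using t1 by simp
      have "2 * c / sqrt t ^ DIM('a) \<le> M * (sqrt (pi / (t + e)) ^ DIM('a) * exp (- ((norm y)\<^sup>2 / (4 * (t + e)))))"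
      proof -
        have "2 * c / sqrt t ^ DIM('a) = M * (sqrt (pi / (2 * t)) ^ DIM('a) * exp (- 1))"
          by (simp add: c_def real_sqrt_divide real_sqrt_mult power_divide power_mult_distrib)
        also have "\<dots> \<le> M * (sqrt (pi / (t + e)) ^ DIM('a) * exp (- ((norm y)\<^sup>2 / (4 * (t + e)))))"
        proof (intro mult_left_mono mult_mono)
          show "sqrt (pi / (2 * t)) ^ DIM('a) \<le> sqrt (pi / (t + e)) ^ DIM('a)"
            using t1 e by (intro power_mono real_sqrt_le_mono divide_left_mono mult_pos_pos) auto
          have "(norm y)\<^sup>2 \<le> (sqrt t)\<^sup>2" using y by (intro power_mono) auto
          then have "(norm y)\<^sup>2 \<le> t" using t1 by simp
          then have "(norm y)\<^sup>2 / (4 * (t + e)) \<le> 1" using t1 e by (simp add: divide_le_eq)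
          then show "exp (- 1) \<le> exp (- ((norm y)\<^sup>2 / (4 * (t + e))))" by simp
        qed (use t1 e M in auto)
        finally show ?thesis .
      qed
      moreover have "R1 t + R2 t \<le> c / sqrt t ^ DIM('a)"
        using err s0 by (simp add: pos_le_divide_eq algebra_simps)
      ultimately have "2 * c / sqrt t ^ DIM('a) - c / sqrt t ^ DIM('a) \<le> C * moll e g y" using low by linarith
      then have "c / sqrt t ^ DIM('a) \<le> C * moll e g y" by (simp add: diff_divide_distrib[symmetric])
      then show "c / C / sqrt t ^ DIM('a) \<le> moll e g y"
        using C s0 by (simp add: field_simps)
    qed
    then show ?thesis by simp
  qed
  show ?thesis
    using main c C by (intro exI[of _ "c / C"] conjI exI[of _ "max t0 1"]) auto
qed

lemma multiplier_zero:
  fixes a :: "'a::euclidean_space \<Rightarrow> real"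
  assumes fm: "fourier_multiplier m (\<lambda>x. 0) a"
  shows "AE x in lebesgue. 0 \<le> a x"
proof -
  obtain F where F: "has_fourier (\<lambda>x::'a. complex_of_real 0) F"
    "\<And>e z. e > 0 \<Longrightarrow> fint (\<lambda>\<xi>. complex_of_real (m \<xi>) * (F \<xi> * complex_of_real (gauss e \<xi>))) z = complex_of_real ((2 * pi) ^ DIM('a) * moll e a z)"
    using fourier_multiplier_moll[OF fm] by blast
  have AE: "AE \<xi> in lebesgue. F \<xi> = 0"
    using has_fourier_L1[OF F(1)] by simp
  have "moll e a y = 0" if "e > 0" for e y
  proof -
    have "fint (\<lambda>\<xi>. complex_of_real (m \<xi>) * (F \<xi> * complex_of_real (gauss e \<xi>))) y = 0"
      unfolding fint_def by (rule integral_eq_zero_AE) (use AE in eventually_elim, simp)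
    then show ?thesis unfolding F(2)[OF that] by simp
  qed
  moreover have "a \<in> L2" using fm by (simp add: fourier_multiplier_def)
  ultimately have "AE x in lebesgue. x \<in> UNIV \<longrightarrow> 0 \<le> a x"
    by (intro AE_ge_of_moll_ge[where ?e0.0 = 1]) auto
  then show ?thesis by simp
qed

subsection \<open>Lower bounds for Duhamel integrals\<close>

lemma has_L2_integral_pairing_lower:
  fixes G :: "real \<Rightarrow> 'a::euclidean_space \<Rightarrow> real"
  assumes h: "has_L2_integral M G I" and fin: "finite_measure M" and D: "D \<in> lmeasurable"
    and m: "integrable M m"
    and low: "AE t in M. m t \<le> (\<integral>x. indicator D x * G t x \<partial>lebesgue)"
  shows "(\<integral>t. m t \<partial>M) \<le> (\<integral>x. indicator D x * I x \<partial>lebesgue)"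
proof -
  interpret finite_measure M by (rule fin)
  define pr where "pr = (\<lambda>g::'a \<Rightarrow> real. \<integral>x. indicator D x * g x \<partial>lebesgue)"
  define \<phi> where "\<phi> = (indicator D :: 'a \<Rightarrow> real)"
  have \<phi>: "\<phi> \<in> L2"
  proof -
    have "(\<lambda>x. (norm (\<phi> x))\<^sup>2) = \<phi>" by (auto simp: \<phi>_def fun_eq_iff split: split_indicator)
    moreover have "integrable lebesgue \<phi>"
      unfolding \<phi>_def using D by (intro integrable_real_indicator) (auto simp: fmeasurable_def)
    ultimately show ?thesis by (simp add: L2_def borel_measurable_integrable)
  qed
  have pri: "integrable lebesgue (\<lambda>x. indicator D x * g x)" if "g \<in> L2" for g :: "'a \<Rightarrow> real"
    using L2_integrable_on_bounded[OF that D] by simp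
  have CS: "\<bar>pr f - pr g\<bar> \<le> L2_norm \<phi> * L2_norm (\<lambda>x. f x - g x)" if "f \<in> L2" "g \<in> L2" for f g
  proof -
    have "pr f - pr g = (\<integral>x. \<phi> x * (f x - g x) \<partial>lebesgue)"
      unfolding pr_def \<phi>_def right_diff_distrib using pri that by simp
    then show ?thesis using L2_Cauchy_Schwarz[OF \<phi> L2_diff[OF that]] by simp
  qed
  obtain s where s: "L2_approx M G s" and sI: "tendsto_L2 (\<lambda>i. L2_simple_integral M (s i)) I sequentially"
    using h by (auto simp: has_L2_integral_def)
  have simp_s: "simple_function M (s i)" and L2_s: "s i ` space M \<subseteq> L2" for i
    using s by (auto simp: L2_approx_def L2_simple_def)
  have AEs: "AE t in M. tendsto_L2 (\<lambda>i. s i t) (G t) sequentially"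
    and lims: "(\<lambda>i. \<integral>\<^sup>+t. ennreal (L2_norm (\<lambda>x. G t x - s i t x)) \<partial>M) \<longlonglongrightarrow> 0"
    using s by (auto simp: L2_approx_def)
  have prs: "integrable M (\<lambda>t. pr (s i t)) \<and> (\<integral>t. pr (s i t) \<partial>M) = pr (L2_simple_integral M (s i))" for i
  proof -
    let ?S = "s i ` space M"
    have finS: "finite ?S" using simp_s[of i] by (simp add: simple_function_def)
    let ?A = "\<lambda>g. {t \<in> space M. s i t = g}"
    have A: "?A g \<in> sets M" for g
    proof -
      have "?A g = s i -` {g} \<inter> space M" by auto
      then show ?thesis using simple_functionD(2)[OF simp_s[of i], of "{g}"] by simp
    qed
    have eq: "pr (s i t) = (\<Sum>g\<in>?S. pr g * indicator (?A g) t)" if "t \<in> space M" for t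
    proof -
      have "(\<Sum>g\<in>?S. pr g * indicator (?A g) t) = (\<Sum>g\<in>?S. if g = s i t then pr g else 0)"
        using that by (intro sum.cong) (auto simp: indicator_def)
      then show ?thesis using finS that by simp
    qed
    have ii: "integrable M (\<lambda>t. \<Sum>g\<in>?S. pr g * indicator (?A g) t)"
      using A by (intro Bochner_Integration.integrable_sum integrable_mult_right integrable_real_indicator) (auto simp: emeasure_finite less_top[symmetric])
    have i1: "integrable M (\<lambda>t. pr (s i t))"
      using ii by (subst Bochner_Integration.integrable_cong[OF refl eq]) auto
    have "(\<integral>t. pr (s i t) \<partial>M) = (\<integral>t. (\<Sum>g\<in>?S. pr g * indicator (?A g) t) \<partial>M)"
      by (rule Bochner_Integration.integral_cong[OF refl eq])
    also have "\<dots> = (\<Sum>g\<in>?S. pr g * measure M (?A g))"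
      using A by (subst Bochner_Integration.integral_sum)
        (auto intro!: sum.cong integrable_mult_right integrable_real_indicator simp: emeasure_finite less_top[symmetric] Int_absorb2 sets.sets_into_space)
    also have "\<dots> = (\<Sum>g\<in>?S. (\<integral>x. measure M (?A g) * (indicator D x * g x) \<partial>lebesgue))"
      by (simp add: pr_def mult.commute)
    also have "\<dots> = (\<integral>x. (\<Sum>g\<in>?S. measure M (?A g) * (indicator D x * g x)) \<partial>lebesgue)"
      using L2_s[of i] by (intro Bochner_Integration.integral_sum[symmetric] integrable_mult_right pri) auto
    also have "\<dots> = pr (L2_simple_integral M (s i))"
      unfolding pr_def L2_simple_integral_def sum_distrib_left
      by (intro Bochner_Integration.integral_cong refl sum.cong) simp
    finally show ?thesis using i1 by blast
  qed
  have I: "I \<in> L2" and evI: "\<forall>\<^sub>F i in sequentially. L2_simple_integral M (s i) \<in> L2"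
    and l0: "(\<lambda>i. L2_norm (\<lambda>x. L2_simple_integral M (s i) x - I x)) \<longlonglongrightarrow> 0"
    using sI by (auto simp: tendsto_L2_def)
  have limI: "(\<lambda>i. \<integral>t. pr (s i t) \<partial>M) \<longlonglongrightarrow> pr I"
  proof -
    have "(\<lambda>i. pr (L2_simple_integral M (s i)) - pr I) \<longlonglongrightarrow> 0"
    proof (rule Lim_null_comparison)
      show "\<forall>\<^sub>F i in sequentially. norm (pr (L2_simple_integral M (s i)) - pr I)
          \<le> L2_norm \<phi> * L2_norm (\<lambda>x. L2_simple_integral M (s i) x - I x)"
        using evI by eventually_elim (use CS I in auto)
      show "(\<lambda>i. L2_norm \<phi> * L2_norm (\<lambda>x. L2_simple_integral M (s i) x - I x)) \<longlonglongrightarrow> 0"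
        using tendsto_mult[OF tendsto_const[of "L2_norm \<phi>"] l0] by simp
    qed
    then show ?thesis using prs by (simp add: LIM_zero_iff)
  qed
  define w where "w = L2_norm \<phi> + 1"
  have w: "w > 0" using L2_norm_nonneg[of \<phi>] by (simp add: w_def)
  define hh where "hh = (\<lambda>i t. max 0 (m t - pr (s i t)) / w)"
  have hi: "integrable M (hh i)" for i
    unfolding hh_def using m prs[of i] by (intro integrable_divide integrable_max) auto
  have hle: "AE t in M. hh i t \<le> L2_norm (\<lambda>x. G t x - s i t x)" for i
    using AEs low AE_space
  proof eventually_elim
    case (elim t)
    have "G t \<in> L2" using elim by (simp add: tendsto_L2_def)
    moreover have "s i t \<in> L2" using L2_s[of i] elim by auto
    ultimately have "\<bar>pr (G t) - pr (s i t)\<bar> \<le> L2_norm \<phi> * L2_norm (\<lambda>x. G t x - s i t x)" by (rule CS)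
    also have "\<dots> \<le> w * L2_norm (\<lambda>x. G t x - s i t x)"
      by (intro mult_right_mono L2_norm_nonneg) (simp add: w_def)
    finally have "m t - pr (s i t) \<le> w * L2_norm (\<lambda>x. G t x - s i t x)"
      using elim by (simp add: pr_def)
    moreover have "0 \<le> w * L2_norm (\<lambda>x. G t x - s i t x)" using w by (simp add: L2_norm_nonneg)
    ultimately show ?case using w by (simp add: hh_def pos_divide_le_eq mult.commute)
  qed
  have h0: "(\<lambda>i. \<integral>t. hh i t \<partial>M) \<longlonglongrightarrow> 0"
  proof -
    have nn: "0 \<le> hh i t" for i t using w by (simp add: hh_def)
    have "ennreal (\<integral>t. hh i t \<partial>M) \<le> (\<integral>\<^sup>+t. ennreal (L2_norm (\<lambda>x. G t x - s i t x)) \<partial>M)" for i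
      using hle[of i] nn by (subst nn_integral_eq_integral[OF hi, symmetric]) (auto intro!: nn_integral_mono_AE ennreal_leI elim: eventually_mono)
    then have "(\<lambda>i. ennreal (\<integral>t. hh i t \<partial>M)) \<longlonglongrightarrow> 0"
      by (intro tendsto_sandwich[OF _ _ tendsto_const lims]) auto
    then show ?thesis using nn by (subst (asm) ennreal_tendsto_0_iff) (auto intro: integral_nonneg_AE)
  qed
  have le: "(\<integral>t. m t \<partial>M) - w * (\<integral>t. hh i t \<partial>M) \<le> (\<integral>t. pr (s i t) \<partial>M)" for i
  proof -
    have "(\<integral>t. m t \<partial>M) - w * (\<integral>t. hh i t \<partial>M) = (\<integral>t. m t - w * hh i t \<partial>M)"
      using m hi[of i] by simp
    also have "\<dots> \<le> (\<integral>t. pr (s i t) \<partial>M)"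
      using m hi[of i] prs[of i] w by (intro integral_mono) (auto simp: hh_def)
    finally show ?thesis .
  qed
  have "(\<lambda>i. (\<integral>t. m t \<partial>M) - w * (\<integral>t. hh i t \<partial>M)) \<longlonglongrightarrow> (\<integral>t. m t \<partial>M) - w * 0"
    by (intro tendsto_intros h0)
  then show ?thesis
    using LIMSEQ_le[OF _ limI] le by (auto simp: pr_def)
qed

lemma has_L2_integral_lower:
  fixes G :: "real \<Rightarrow> 'a::euclidean_space \<Rightarrow> real"
  assumes h: "has_L2_integral (lebesgue_on {0..t}) G I" and ab: "0 \<le> a" "a \<le> b" "b \<le> t" and c: "c \<ge> 0"
    and L2: "AE s in lebesgue_on {0..t}. G s \<in> L2"
    and nn: "AE s in lebesgue_on {0..t}. AE x in lebesgue. 0 \<le> G s x"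
    and low: "AE s in lebesgue_on {0..t}. s \<in> {a..b} \<longrightarrow> (AE x in lebesgue. norm x < r \<longrightarrow> c \<le> G s x)"
  shows "AE x in lebesgue. norm x < r \<longrightarrow> (b - a) * c \<le> I x"
proof -
  have IL2: "I \<in> L2" using h by (auto simp: has_L2_integral_def tendsto_L2_def)
  have [measurable]: "I \<in> borel_measurable lebesgue" by (rule L2_measurable[OF IL2])
  define D where "D = {x \<in> ball 0 r. I x < (b - a) * c}"
  have Ds: "D \<in> sets lebesgue"
  proof -
    have "{x \<in> space lebesgue. I x < (b - a) * c} \<in> sets lebesgue" by measurable
    moreover have "D = ball 0 r \<inter> {x \<in> space lebesgue. I x < (b - a) * c}" by (auto simp: D_def)
    moreover have "ball (0::'a) r \<in> sets lebesgue" by simp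
    ultimately show ?thesis by (simp only: sets.Int)
  qed
  have D: "D \<in> lmeasurable"
    by (rule fmeasurableI2[OF lmeasurable_ball[of 0 r] _ Ds]) (auto simp: D_def)
  have emD: "emeasure lebesgue D < \<infinity>" using D by (auto simp: fmeasurable_def)
  let ?M = "lebesgue_on {0..t}"
  have t: "0 \<le> t" using ab by simp
  have fin: "finite_measure ?M"
    using finite_measure_lebesgue_on[of "{0..t}"] by simp
  define m where "m = (\<lambda>s. (c * measure lebesgue D) * indicator {a..b} s)"
  have abm: "{a..b} \<in> sets ?M" using ab by (auto simp: sets_restrict_space_iff)
  have im: "integrable ?M (indicator {a..b} :: real \<Rightarrow> real)"
    using abm finite_measure.emeasure_finite[OF fin] by (intro integrable_real_indicator) (auto simp: less_top[symmetric])
  have m: "integrable ?M m" unfolding m_def by (intro integrable_mult_right im)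
  have "(\<integral>s. m s \<partial>?M) \<le> (\<integral>x. indicator D x * I x \<partial>lebesgue)"
  proof (rule has_L2_integral_pairing_lower[OF h fin D m])
    show "AE s in ?M. m s \<le> (\<integral>x. indicator D x * G s x \<partial>lebesgue)"
      using L2 nn low
    proof eventually_elim
      case (elim s)
      have iG: "integrable lebesgue (\<lambda>x. indicator D x * G s x)"
        using L2_integrable_on_bounded[OF elim(1) D] by simp
      show ?case
      proof (cases "s \<in> {a..b}")
        case True
        have "m s = (\<integral>x. c * indicator D x \<partial>lebesgue)" using True by (simp add: m_def)
        also have "\<dots> \<le> (\<integral>x. indicator D x * G s x \<partial>lebesgue)"
        proof (rule integral_mono_AE[OF _ iG])
          show "integrable lebesgue (\<lambda>x. c * indicator D x)"
            using Ds emD by (intro integrable_mult_right integrable_real_indicator)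
          have "AE x in lebesgue. norm x < r \<longrightarrow> c \<le> G s x" using elim(3) True by blast
          then show "AE x in lebesgue. c * indicator D x \<le> indicator D x * G s x"
            by eventually_elim (auto simp: D_def split: split_indicator)
        qed
        finally show ?thesis .
      next
        case False
        have "0 \<le> (\<integral>x. indicator D x * G s x \<partial>lebesgue)"
          using elim(2) by (intro integral_nonneg_AE) (auto split: split_indicator)
        then show ?thesis using False by (simp add: m_def)
      qed
    qed
  qed
  also have "(\<integral>s. m s \<partial>?M) = (\<integral>x. (b - a) * c * indicator D x \<partial>lebesgue)"
  proof -
    have "measure ?M {a..b} = b - a"
      using ab by (subst measure_restrict_space) auto
    moreover have "(\<integral>s. indicator {a..b} s \<partial>?M) = measure ?M {a..b}"
      using abm sets.sets_into_space[OF abm] by (subst Bochner_Integration.integral_indicator) (auto simp: Int_absorb2)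
    ultimately show ?thesis by (simp add: m_def)
  qed
  finally have "(\<integral>x. (b - a) * c * indicator D x \<partial>lebesgue) \<le> (\<integral>x. indicator D x * I x \<partial>lebesgue)" .
  moreover have i1: "integrable lebesgue (\<lambda>x. (b - a) * c * indicator D x)"
    using Ds emD by (intro integrable_mult_right integrable_real_indicator)
  moreover have i2: "integrable lebesgue (\<lambda>x. indicator D x * I x)"
    using L2_integrable_on_bounded[OF IL2 D] by simp
  ultimately have "(\<integral>x. (b - a) * c * indicator D x - indicator D x * I x \<partial>lebesgue) \<le> 0" by simp
  moreover have nonneg: "AE x in lebesgue. 0 \<le> (b - a) * c * indicator D x - indicator D x * I x"
    by (intro AE_I2) (auto simp: D_def split: split_indicator)
  ultimately have "(\<integral>x. (b - a) * c * indicator D x - indicator D x * I x \<partial>lebesgue) = 0"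
    using integral_nonneg_AE[OF nonneg] by linarith
  then have "AE x in lebesgue. (b - a) * c * indicator D x - indicator D x * I x = 0"
    using integral_nonneg_eq_0_iff_AE[OF Bochner_Integration.integrable_diff[OF i1 i2] nonneg] by simp
  then show ?thesis by eventually_elim (auto simp: D_def not_le split: split_indicator_asm)
qed

lemma duhamel_lower:
  fixes w :: "'a::euclidean_space \<Rightarrow> real"
  assumes d: "DIM('a) \<le> 3" and duh: "duhamel_solution (\<lambda>x. 0) w1 F t w" and F0: "\<And>s x. 0 \<le> F s x"
    and ab: "0 \<le> a" "a \<le> b" "b \<le> t" and c: "c \<ge> 0"
    and lin: "\<And>g. fourier_multiplier (K_hat t) w1 g \<Longrightarrow> AE x in lebesgue. norm x < r \<longrightarrow> c0 \<le> g x"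
    and low: "\<And>s g. s \<in> {a..b} \<Longrightarrow> fourier_multiplier (K_hat (t - s)) (F s) g \<Longrightarrow> AE x in lebesgue. norm x < r \<longrightarrow> c \<le> g x"
  shows "AE x in lebesgue. norm x < r \<longrightarrow> c0 + (b - a) * c \<le> w x"
proof -
  obtain l G I where l: "linear_solution (\<lambda>x. 0) w1 t l"
    and G: "AE s in lebesgue_on {0..t}. fourier_multiplier (K_hat (t - s)) (F s) (G s)"
    and I: "has_L2_integral (lebesgue_on {0..t}) G I" and w: "AE x in lebesgue. w x = l x + I x"
    using duh by (auto simp: duhamel_solution_def)
  obtain a0 g where a0: "fourier_multiplier (\<lambda>\<xi>. K_hat t \<xi> + dt_K_hat t \<xi>) (\<lambda>x. 0) a0"
    and g: "fourier_multiplier (K_hat t) w1 g" and lx: "AE x in lebesgue. l x = a0 x + g x"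
    using l by (auto simp: linear_solution_def)
  have sp: "AE s in lebesgue_on {0..t}. s \<in> {0..t}" by (rule AE_I2) simp
  have "AE x in lebesgue. norm x < r \<longrightarrow> (b - a) * c \<le> I x"
  proof (rule has_L2_integral_lower[OF I ab c])
    show "AE s in lebesgue_on {0..t}. G s \<in> L2"
      using G by eventually_elim (simp add: fourier_multiplier_def)
    show "AE s in lebesgue_on {0..t}. AE x in lebesgue. 0 \<le> G s x"
      using G sp by eventually_elim (rule K_hat_multiplier_nonneg[OF d], auto simp: F0)
    show "AE s in lebesgue_on {0..t}. s \<in> {a..b} \<longrightarrow> (AE x in lebesgue. norm x < r \<longrightarrow> c \<le> G s x)"
      using G by eventually_elim (use low in blast)
  qed
  then show ?thesis
    using w lx lin[OF g] multiplier_zero[OF a0] by eventually_elim auto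
qed

subsection \<open>Growth and blow-up\<close>

definition grows :: "(real \<Rightarrow> 'a::euclidean_space \<Rightarrow> real) \<Rightarrow> real \<Rightarrow> bool" where
  "grows w \<kappa> \<longleftrightarrow> (\<exists>c>0. \<exists>t0\<ge>1. \<forall>t\<ge>t0. AE x in lebesgue. norm x < sqrt t \<longrightarrow> c * t powr \<kappa> \<le> w t x)"

definition diffuses :: "('a::euclidean_space \<Rightarrow> real) \<Rightarrow> bool" where
  "diffuses f \<longleftrightarrow> (\<exists>c>0. \<exists>t0\<ge>1. \<forall>t\<ge>t0. \<forall>g. fourier_multiplier (K_hat t) f g \<longrightarrow>
    (AE x in lebesgue. norm x < sqrt t \<longrightarrow> c / sqrt t ^ DIM('a) \<le> g x))"

lemma grows_mono:
  assumes "grows w \<kappa>" "\<kappa>' \<le> \<kappa>"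
  shows "grows w \<kappa>'"
proof -
  obtain c t0 where c: "c > 0" "t0 \<ge> 1" and w: "\<And>t. t \<ge> t0 \<Longrightarrow> AE x in lebesgue. norm x < sqrt t \<longrightarrow> c * t powr \<kappa> \<le> w t x"
    using assms(1) by (auto simp: grows_def)
  have "AE x in lebesgue. norm x < sqrt t \<longrightarrow> c * t powr \<kappa>' \<le> w t x" if t: "t \<ge> t0" for t
  proof -
    have "c * t powr \<kappa>' \<le> c * t powr \<kappa>" using c t assms(2) by (intro mult_left_mono powr_mono) auto
    then show ?thesis using w[OF t] by (auto elim: eventually_mono)
  qed
  then show ?thesis using c unfolding grows_def by blast
qed

lemma power_nonlinearity_nonneg: "0 \<le> power_nonlinearity a b u v t x"
  by (simp add: power_nonlinearity_def)

lemma power_nonlinearity_ge: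
  assumes "0 \<le> a" "0 \<le> b" "0 \<le> A" "0 \<le> B" "A \<le> u t x" "B \<le> v t x"
  shows "A powr a * B powr b \<le> power_nonlinearity a b u v t x"
  unfolding power_nonlinearity_def using assms by (intro mult_mono powr_mono2) auto

lemma grows_power_nonlinearity:
  assumes u: "grows u \<kappa>1" and v: "grows v \<kappa>2" and a: "0 \<le> a" "0 \<le> b"
  shows "grows (power_nonlinearity a b u v) (a * \<kappa>1 + b * \<kappa>2)"
proof -
  obtain c1 t1 where c1: "c1 > 0" "t1 \<ge> 1" and U: "\<And>t. t \<ge> t1 \<Longrightarrow> AE x in lebesgue. norm x < sqrt t \<longrightarrow> c1 * t powr \<kappa>1 \<le> u t x"
    using u by (auto simp: grows_def)
  obtain c2 t2 where c2: "c2 > 0" "t2 \<ge> 1" and V: "\<And>t. t \<ge> t2 \<Longrightarrow> AE x in lebesgue. norm x < sqrt t \<longrightarrow> c2 * t powr \<kappa>2 \<le> v t x"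
    using v by (auto simp: grows_def)
  have "AE x in lebesgue. norm x < sqrt t \<longrightarrow> c1 powr a * c2 powr b * t powr (a * \<kappa>1 + b * \<kappa>2) \<le> power_nonlinearity a b u v t x"
    if t: "t \<ge> max t1 t2" for t
  proof -
    have eq: "c1 powr a * c2 powr b * t powr (a * \<kappa>1 + b * \<kappa>2) = (c1 * t powr \<kappa>1) powr a * (c2 * t powr \<kappa>2) powr b"
      using c1 c2 t by (simp add: powr_mult powr_powr powr_add mult_ac)
    have "AE x in lebesgue. norm x < sqrt t \<longrightarrow> c1 * t powr \<kappa>1 \<le> u t x" "AE x in lebesgue. norm x < sqrt t \<longrightarrow> c2 * t powr \<kappa>2 \<le> v t x"
      using U V t by auto
    then show ?thesis
      unfolding eq by eventually_elim (use a c1 c2 in \<open>auto intro!: power_nonlinearity_ge\<close>)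
  qed
  then show ?thesis
    using c1 c2 unfolding grows_def by (intro exI[of _ "c1 powr a * c2 powr b"] conjI exI[of _ "max t1 t2"]) auto
qed

lemma grows_linear:
  fixes w :: "real \<Rightarrow> 'a::euclidean_space \<Rightarrow> real"
  assumes d: "DIM('a) \<le> 3" and F0: "\<And>s x. 0 \<le> F s x"
    and duh: "\<And>t. t \<ge> 0 \<Longrightarrow> duhamel_solution (\<lambda>x. 0) w1 F t (w t)" and lin: "diffuses w1"
  shows "grows w (- real DIM('a) / 2)"
proof -
  obtain c t0 where c: "c > 0" "t0 \<ge> 1" and L: "\<And>t g. t \<ge> t0 \<Longrightarrow> fourier_multiplier (K_hat t) w1 g \<Longrightarrow> AE x in lebesgue. norm x < sqrt t \<longrightarrow> c / sqrt t ^ DIM('a) \<le> g x"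
    using lin unfolding diffuses_def by blast
  have "AE x in lebesgue. norm x < sqrt t \<longrightarrow> c * t powr (- real DIM('a) / 2) \<le> w t x" if t: "t \<ge> t0" for t
  proof -
    have t1: "t \<ge> 1" using t c by simp
    have "AE x in lebesgue. norm x < sqrt t \<longrightarrow> c / sqrt t ^ DIM('a) + (0 - 0) * 0 \<le> w t x"
    proof (rule duhamel_lower[OF d duh F0])
      fix s g assume "s \<in> {0..0::real}" and g: "fourier_multiplier (K_hat (t - s)) (F s) g"
      then have "0 \<le> t - s" using t1 by simp
      then have "AE x in lebesgue. 0 \<le> g x" by (rule K_hat_multiplier_nonneg[OF d _ g]) (simp add: F0)
      then show "AE x in lebesgue. norm x < sqrt t \<longrightarrow> 0 \<le> g x" by eventually_elim simp
    qed (use t1 L[OF t] in auto)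
    moreover have "c / sqrt t ^ DIM('a) = c * t powr (- real DIM('a) / 2)"
    proof -
      have "sqrt t ^ DIM('a) = t powr (real DIM('a) / 2)"
        using t1 by (simp add: powr_half_sqrt[symmetric] powr_realpow[symmetric] powr_powr)
      then show ?thesis by (simp add: powr_minus_divide)
    qed
    ultimately show ?thesis by simp
  qed
  then show ?thesis using c unfolding grows_def by blast
qed

lemma grows_step:
  fixes w :: "real \<Rightarrow> 'a::euclidean_space \<Rightarrow> real"
  assumes d: "DIM('a) \<le> 3" and F0: "\<And>s x. 0 \<le> F s x"
    and duh: "\<And>t. t \<ge> 0 \<Longrightarrow> duhamel_solution (\<lambda>x. 0) w1 F t (w t)" and lin: "diffuses w1"
    and F: "grows F e"
  shows "grows w (1 + e)"
proof -
  obtain c0 t0 where c0: "c0 > 0" "t0 \<ge> 1" and L: "\<And>t g. t \<ge> t0 \<Longrightarrow> fourier_multiplier (K_hat t) w1 g \<Longrightarrow> AE x in lebesgue. norm x < sqrt t \<longrightarrow> c0 / sqrt t ^ DIM('a) \<le> g x"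
    using lin unfolding diffuses_def by blast
  obtain C t1 where C: "C > 0" "t1 \<ge> 1" and FC: "\<And>t. t \<ge> t1 \<Longrightarrow> AE x in lebesgue. norm x < sqrt t \<longrightarrow> C * t powr e \<le> F t x"
    using F by (auto simp: grows_def)
  obtain cd \<tau>0 where cd: "cd > 0" "\<tau>0 \<ge> 1"
    and D: "\<And>\<tau> (f :: 'a \<Rightarrow> real) g A. \<tau> \<ge> \<tau>0 \<Longrightarrow> fourier_multiplier (K_hat \<tau>) f g \<Longrightarrow> AE x in lebesgue. 0 \<le> f x \<Longrightarrow>
      A \<ge> 0 \<Longrightarrow> AE x in lebesgue. norm x < sqrt \<tau> / 2 \<longrightarrow> A \<le> f x \<Longrightarrow>
      AE x in lebesgue. norm x < sqrt (2 * \<tau>) \<longrightarrow> cd * A \<le> g x"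
    using K_hat_multiplier_diffusive[OF d] by blast
  define K where "K = min ((1 / 4) powr e) ((1 / 2) powr e)"
  have K: "K > 0" by (simp add: K_def)
  have Kle: "K * t powr e \<le> s powr e" if "t > 0" "s \<in> {t / 4..t / 2}" for s t
  proof -
    have q: "1 / 4 \<le> s / t" "s / t \<le> 1 / 2" using that by (auto simp: field_simps)
    have q0: "0 < s / t" using that by auto
    have "K \<le> (s / t) powr e"
    proof (cases "e \<ge> 0")
      case True
      have "(1 / 4) powr e \<le> (s / t) powr e" using q True by (intro powr_mono2) auto
      then show ?thesis by (simp add: K_def)
    next
      case False
      have "(1 / 2) powr e \<le> (s / t) powr e" using q q0 False by (intro powr_mono2') auto
      then show ?thesis by (simp add: K_def)
    qed
    then have "K * t powr e \<le> (s / t) powr e * t powr e" by (intro mult_right_mono) auto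
    also have "\<dots> = s powr e" using that by (simp add: powr_divide)
    finally show ?thesis .
  qed
  define T where "T = max t0 (max (4 * t1) (2 * \<tau>0))"
  have "AE x in lebesgue. norm x < sqrt t \<longrightarrow> (cd * C * K / 4) * t powr (1 + e) \<le> w t x" if t: "t \<ge> T" for t
  proof -
    have tt: "t \<ge> t0" "t \<ge> 4 * t1" "t \<ge> 2 * \<tau>0" "t \<ge> 1" using t c0 by (auto simp: T_def)
    define A where "A = C * (K * t powr e)"
    have A: "A \<ge> 0" using C K by (simp add: A_def)
    have "AE x in lebesgue. norm x < sqrt t \<longrightarrow> c0 / sqrt t ^ DIM('a) + (t / 2 - t / 4) * (cd * A) \<le> w t x"
    proof (rule duhamel_lower[OF d duh F0])
      fix s g assume s: "s \<in> {t / 4..t / 2}" and g: "fourier_multiplier (K_hat (t - s)) (F s) g"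
      have "AE x in lebesgue. norm x < sqrt s \<longrightarrow> C * s powr e \<le> F s x"
        using s tt by (intro FC) auto
      moreover have "A \<le> C * s powr e" unfolding A_def using C s tt by (intro mult_left_mono Kle) auto
      moreover have "sqrt (t - s) / 2 \<le> sqrt s"
      proof -
        have "sqrt (t - s) \<le> sqrt (4 * s)" using s tt by (intro real_sqrt_le_mono) auto
        then show ?thesis by (simp add: real_sqrt_mult)
      qed
      ultimately have "AE x in lebesgue. norm x < sqrt (t - s) / 2 \<longrightarrow> A \<le> F s x"
        by (auto elim!: eventually_mono)
      then have "AE x in lebesgue. norm x < sqrt (2 * (t - s)) \<longrightarrow> cd * A \<le> g x"
        using s tt by (intro D[OF _ g _ A]) (auto simp: F0)
      moreover have le: "sqrt t \<le> sqrt (2 * (t - s))" using s by (intro real_sqrt_le_mono) auto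
      ultimately show "AE x in lebesgue. norm x < sqrt t \<longrightarrow> cd * A \<le> g x"
        by (elim eventually_mono) (meson le less_le_trans)
    qed (use tt L[OF tt(1)] A cd in auto)
    moreover have "(cd * C * K / 4) * t powr (1 + e) = (t / 2 - t / 4) * (cd * A)"
      using tt by (simp add: A_def powr_add)
    moreover have "0 \<le> c0 / sqrt t ^ DIM('a)" using c0 tt by simp
    ultimately show ?thesis by (elim eventually_mono) linarith
  qed
  moreover have "cd * C * K / 4 > 0" "T \<ge> 1" using cd C K c0 by (auto simp: T_def)
  ultimately show ?thesis unfolding grows_def by blast
qed

lemma exp_deficit:
  assumes "0 \<le> \<tau>" "\<tau> \<le> 1"
  shows "\<tau> / 2 \<le> 1 - exp (- \<tau> :: real)"
proof -
  have "(1 + \<tau>) * (1 - \<tau> / 2) \<ge> 1" using mult_left_mono[OF assms(2,1)] by (simp add: algebra_simps)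
  then have "1 \<le> exp \<tau> * (1 - \<tau> / 2)"
    using mult_right_mono[OF exp_ge_add_one_self[of \<tau>], of "1 - \<tau> / 2"] assms by linarith
  then show ?thesis by (simp add: exp_minus field_simps)
qed

lemma local_step:
  fixes w :: "'a::euclidean_space \<Rightarrow> real"
  assumes d: "DIM('a) \<le> 3" and F0: "\<And>s x. 0 \<le> F s x"
    and duh: "duhamel_solution (\<lambda>x. 0) w1 F t w"
    and lin: "\<And>g. fourier_multiplier (K_hat t) w1 g \<Longrightarrow> AE x in lebesgue. norm x < r' \<longrightarrow> 0 \<le> g x"
    and l: "0 < l" "l \<le> 1" "2 * l \<le> t" and A: "A \<ge> 0" and r: "r' + 2 * l < r"
    and F: "\<And>s. s \<in> {t - 2 * l..t - l} \<Longrightarrow> AE x in lebesgue. norm x < r \<longrightarrow> A \<le> F s x"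
  shows "AE x in lebesgue. norm x < r' \<longrightarrow> l\<^sup>2 / 4 * A \<le> w x"
proof -
  have "AE x in lebesgue. norm x < r' \<longrightarrow> 0 + ((t - l) - (t - 2 * l)) * (l / 2 * (A / 2)) \<le> w x"
  proof (rule duhamel_lower[OF d duh F0])
    fix s g assume s: "s \<in> {t - 2 * l..t - l}" and g: "fourier_multiplier (K_hat (t - s)) (F s) g"
    have "AE x in lebesgue. norm x < r' \<longrightarrow> (1 - exp (- (t - s))) * (A / 2) \<le> g x"
      using s l r by (intro K_hat_multiplier_cone[OF d _ g _ A F[OF s]]) (auto simp: F0)
    moreover have "l / 2 * (A / 2) \<le> (1 - exp (- (t - s))) * (A / 2)"
    proof (rule mult_right_mono)
      have "exp (- (t - s)) \<le> exp (- l)" using s by simp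
      then show "l / 2 \<le> 1 - exp (- (t - s))" using exp_deficit[of l] l by linarith
    qed (use A in simp)
    ultimately show "AE x in lebesgue. norm x < r' \<longrightarrow> l / 2 * (A / 2) \<le> g x"
      by (elim eventually_mono) linarith
  qed (use l A lin in auto)
  then show ?thesis by (simp add: power2_eq_square mult.assoc)
qed

text \<open>The lower bound \<open>L k\<close> is propagated through time steps of length of order \<open>2\<^sup>-\<^sup>k\<close> on balls shrinking to the
  unit ball.  A step turns \<open>L k\<close> into \<open>4\<^sup>-\<^sup>k (L k)\<^sup>\<gamma> / 64\<close>, and \<open>D\<close> and \<open>\<Lambda>\<close> are chosen such that
  this is \<open>L (Suc k)\<close>.\<close>

lemma blowup:
  fixes u v :: "real \<Rightarrow> 'a::euclidean_space \<Rightarrow> real"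
  assumes d: "DIM('a) \<le> 3"
    and duh_u: "\<And>t. t \<ge> 0 \<Longrightarrow> duhamel_solution (\<lambda>x. 0) u1 (power_nonlinearity \<alpha> p u v) t (u t)"
    and duh_v: "\<And>t. t \<ge> 0 \<Longrightarrow> duhamel_solution (\<lambda>x. 0) v1 (power_nonlinearity q \<beta> u v) t (v t)"
    and lin: "diffuses u1" "diffuses v1"
    and ex: "0 \<le> \<alpha>" "0 \<le> p" "0 \<le> q" "0 \<le> \<beta>" "1 < \<alpha> + p" "1 < q + \<beta>"
    and gr: "grows u 1" "grows v 1"
  shows False
proof -
  define \<gamma> where "\<gamma> = min (\<alpha> + p) (q + \<beta>)"
  have \<gamma>: "\<gamma> > 1" "\<gamma> \<le> \<alpha> + p" "\<gamma> \<le> q + \<beta>" using ex by (auto simp: \<gamma>_def)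
  define D where "D = 4 powr (1 / (\<gamma> - 1))"
  have D: "D > 1" "D powr (\<gamma> - 1) = 4" using \<gamma> by (auto simp: D_def powr_powr gr_one_powr)
  define \<Lambda> where "\<Lambda> = (64 * D) powr (1 / (\<gamma> - 1))"
  have \<Lambda>: "\<Lambda> \<ge> 1" "\<Lambda> powr (\<gamma> - 1) = 64 * D"
    using \<gamma> D by (auto simp: \<Lambda>_def powr_powr intro!: ge_one_powr_ge_zero)
  define L where "L = (\<lambda>k::nat. \<Lambda> * D ^ k)"
  have L1: "L k \<ge> 1" for k
  proof -
    have "1 * 1 \<le> \<Lambda> * D ^ k" using \<Lambda> D by (intro mult_mono) auto
    then show ?thesis by (simp add: L_def)
  qed
  have Lstep: "L (Suc k) \<le> (1 / 2 ^ (k + 2))\<^sup>2 / 4 * L k powr \<gamma>" for k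
  proof -
    have "L k powr \<gamma> = L k * L k powr (\<gamma> - 1)"
      using L1[of k] by (simp add: powr_diff)
    also have "L k powr (\<gamma> - 1) = 64 * D * 4 ^ k"
    proof -
      have "(D ^ k) powr (\<gamma> - 1) = (D powr (\<gamma> - 1)) ^ k"
        using D(1) by (simp add: powr_realpow[symmetric] powr_powr mult.commute)
      then show ?thesis using \<Lambda> D by (simp add: L_def powr_mult)
    qed
    also have "(1 / 2 ^ (k + 2))\<^sup>2 / 4 * (L k * (64 * D * 4 ^ k)) = L (Suc k)"
    proof -
      have "((2::real) ^ k)\<^sup>2 = 4 ^ k"
        by (simp add: power2_eq_square flip: power_mult_distrib)
      then have "((2::real) ^ (k + 2))\<^sup>2 = 16 * 4 ^ k"
        by (simp add: power_add power_mult_distrib)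
      then show ?thesis by (simp add: L_def power_divide)
    qed
    finally show ?thesis by simp
  qed
  obtain cu tu where u: "cu > 0" "tu \<ge> 1" "\<And>t. t \<ge> tu \<Longrightarrow> AE x in lebesgue. norm x < sqrt t \<longrightarrow> cu * t powr 1 \<le> u t x"
    using gr(1) by (auto simp: grows_def)
  obtain cv tv where v: "cv > 0" "tv \<ge> 1" "\<And>t. t \<ge> tv \<Longrightarrow> AE x in lebesgue. norm x < sqrt t \<longrightarrow> cv * t powr 1 \<le> v t x"
    using gr(2) by (auto simp: grows_def)
  obtain du su where lu: "du > 0" "su \<ge> 1" "\<And>t g. t \<ge> su \<Longrightarrow> fourier_multiplier (K_hat t) u1 g \<Longrightarrow> AE x in lebesgue. norm x < sqrt t \<longrightarrow> du / sqrt t ^ DIM('a) \<le> g x"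
    using lin(1) unfolding diffuses_def by blast
  obtain dv sv where lv: "dv > 0" "sv \<ge> 1" "\<And>t g. t \<ge> sv \<Longrightarrow> fourier_multiplier (K_hat t) v1 g \<Longrightarrow> AE x in lebesgue. norm x < sqrt t \<longrightarrow> dv / sqrt t ^ DIM('a) \<le> g x"
    using lin(2) unfolding diffuses_def by blast
  define T where "T = tu + tv + su + sv + 9 + \<Lambda> / cu + \<Lambda> / cv"
  have T: "T \<ge> tu" "T \<ge> tv" "T \<ge> su" "T \<ge> sv" "T \<ge> 9" "T \<ge> \<Lambda> / cu" "T \<ge> \<Lambda> / cv"
  proof -
    have "0 \<le> \<Lambda> / cu" "0 \<le> \<Lambda> / cv" using \<Lambda>(1) u(1) v(1) by simp_all
    then show "T \<ge> tu" "T \<ge> tv" "T \<ge> su" "T \<ge> sv" "T \<ge> 9" "T \<ge> \<Lambda> / cu" "T \<ge> \<Lambda> / cv"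
      unfolding T_def using u(2) v(2) lu(2) lv(2) by linarith+
  qed
  have s3: "3 \<le> sqrt t" if "t \<ge> T" for t
    using that T by (intro real_le_rsqrt) auto
  have claim: "\<forall>t\<in>{T + 1 - 1 / 2 ^ k..T + 1}. (AE x in lebesgue. norm x < 1 + 2 / 2 ^ k \<longrightarrow> L k \<le> u t x) \<and>
      (AE x in lebesgue. norm x < 1 + 2 / 2 ^ k \<longrightarrow> L k \<le> v t x)" for k
  proof (induction k)
    case 0
    show ?case
    proof (intro ballI conjI)
      fix t assume "t \<in> {T + 1 - 1 / 2 ^ 0..T + 1}"
      then have t: "t \<ge> T" by simp
      have t0: "t > 0" using t T by simp
      have "\<Lambda> \<le> cu * t" using T(6) t u(1) by (simp add: divide_le_eq mult.commute)
        (metis mult.commute mult_le_cancel_left_pos order.trans)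
      moreover have "AE x in lebesgue. norm x < sqrt t \<longrightarrow> cu * t powr 1 \<le> u t x" using t T by (intro u) auto
      ultimately show "AE x in lebesgue. norm x < 1 + 2 / 2 ^ 0 \<longrightarrow> L 0 \<le> u t x"
        using s3[OF t] t0 by (auto elim!: eventually_mono simp: L_def)
      have "\<Lambda> \<le> cv * t" using T(7) t v(1) by (simp add: divide_le_eq mult.commute)
        (metis mult.commute mult_le_cancel_left_pos order.trans)
      moreover have "AE x in lebesgue. norm x < sqrt t \<longrightarrow> cv * t powr 1 \<le> v t x" using t T by (intro v) auto
      ultimately show "AE x in lebesgue. norm x < 1 + 2 / 2 ^ 0 \<longrightarrow> L 0 \<le> v t x"
        using s3[OF t] t0 by (auto elim!: eventually_mono simp: L_def)
    qed
  next
    case (Suc k)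
    define l :: real where "l = 1 / 2 ^ (k + 2)"
    have "(1::real) \<le> 2 ^ (k + 2)" by (rule one_le_power) simp
    then have l: "0 < l" "l \<le> 1" unfolding l_def by (auto simp: divide_le_eq_1)
    have lk: "1 / 2 ^ k = 4 * l" "1 / 2 ^ Suc k = 2 * l" "2 / 2 ^ k = 8 * l" "2 / 2 ^ Suc k = 4 * l"
      by (auto simp: l_def)
    have l4: "4 * l \<le> 1" using lk(1) by (metis divide_le_eq_1_pos one_le_numeral one_le_power zero_less_numeral zero_less_power)
    have F: "AE x in lebesgue. norm x < 1 + 8 * l \<longrightarrow> L k powr \<gamma> \<le> power_nonlinearity a b u v s x"
      if s: "s \<in> {T + 1 - 4 * l..T + 1}" and ab: "0 \<le> a" "0 \<le> b" "\<gamma> \<le> a + b" for s a b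
    proof -
      have "AE x in lebesgue. norm x < 1 + 8 * l \<longrightarrow> L k \<le> u s x" "AE x in lebesgue. norm x < 1 + 8 * l \<longrightarrow> L k \<le> v s x"
        using Suc.IH s unfolding lk by auto
      then show ?thesis
      proof eventually_elim
        case (elim x)
        have "L k powr \<gamma> \<le> L k powr (a + b)" using L1 ab by (intro powr_mono) auto
        also have "\<dots> = L k powr a * L k powr b" by (rule powr_add)
        finally have "L k powr \<gamma> \<le> L k powr a * L k powr b" .
        moreover have "norm x < 1 + 8 * l \<Longrightarrow> L k powr a * L k powr b \<le> power_nonlinearity a b u v s x"
          using elim ab L1[of k] by (intro power_nonlinearity_ge) auto
        ultimately show ?case by linarith
      qed
    qed
    show ?case
      unfolding lk
    proof (intro ballI conjI)
      fix t assume t: "t \<in> {T + 1 - 2 * l..T + 1}"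
      have tT: "t \<ge> T" "t \<ge> 0" "2 * l \<le> t" using t l4 l T(5) by auto
      have r: "1 + 4 * l \<le> sqrt t" using s3[OF tT(1)] l4 by linarith
      have "AE x in lebesgue. norm x < 1 + 4 * l \<longrightarrow> l\<^sup>2 / 4 * L k powr \<gamma> \<le> u t x"
      proof (rule local_step[OF d power_nonlinearity_nonneg duh_u[OF tT(2)] _ l tT(3)])
        fix g assume g: "fourier_multiplier (K_hat t) u1 g"
        have "AE x in lebesgue. norm x < sqrt t \<longrightarrow> du / sqrt t ^ DIM('a) \<le> g x"
          using tT T by (intro lu(3) g) auto
        moreover have "0 \<le> du / sqrt t ^ DIM('a)" using lu(1) tT by simp
        ultimately show "AE x in lebesgue. norm x < 1 + 4 * l \<longrightarrow> 0 \<le> g x"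
          using r by (auto elim!: eventually_mono)
      next
        fix s assume "s \<in> {t - 2 * l..t - l}"
        then show "AE x in lebesgue. norm x < 1 + 8 * l \<longrightarrow> L k powr \<gamma> \<le> power_nonlinearity \<alpha> p u v s x"
          using t l ex \<gamma> by (intro F) auto
      qed (use l in auto)
      then show "AE x in lebesgue. norm x < 1 + 4 * l \<longrightarrow> L (Suc k) \<le> u t x"
        using Lstep[of k] unfolding l_def[symmetric] by (auto elim!: eventually_mono)
      have "AE x in lebesgue. norm x < 1 + 4 * l \<longrightarrow> l\<^sup>2 / 4 * L k powr \<gamma> \<le> v t x"
      proof (rule local_step[OF d power_nonlinearity_nonneg duh_v[OF tT(2)] _ l tT(3)])
        fix g assume g: "fourier_multiplier (K_hat t) v1 g"
        have "AE x in lebesgue. norm x < sqrt t \<longrightarrow> dv / sqrt t ^ DIM('a) \<le> g x"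
          using tT T by (intro lv(3) g) auto
        moreover have "0 \<le> dv / sqrt t ^ DIM('a)" using lv(1) tT by simp
        ultimately show "AE x in lebesgue. norm x < 1 + 4 * l \<longrightarrow> 0 \<le> g x"
          using r by (auto elim!: eventually_mono)
      next
        fix s assume "s \<in> {t - 2 * l..t - l}"
        then show "AE x in lebesgue. norm x < 1 + 8 * l \<longrightarrow> L k powr \<gamma> \<le> power_nonlinearity q \<beta> u v s x"
          using t l ex \<gamma> by (intro F) auto
      qed (use l in auto)
      then show "AE x in lebesgue. norm x < 1 + 4 * l \<longrightarrow> L (Suc k) \<le> v t x"
        using Lstep[of k] unfolding l_def[symmetric] by (auto elim!: eventually_mono)
    qed
  qed
  have "AE x in lebesgue. norm x < 1 \<longrightarrow> L k \<le> u (T + 1) x" for k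
  proof -
    have "AE x in lebesgue. norm x < 1 + 2 / 2 ^ k \<longrightarrow> L k \<le> u (T + 1) x"
      using claim[of k] by simp
    moreover have "(0::real) < 2 / 2 ^ k" by simp
    ultimately show ?thesis by (elim eventually_mono) linarith
  qed
  then have "AE x in lebesgue. \<forall>k. norm x < 1 \<longrightarrow> L k \<le> u (T + 1) x"
    unfolding AE_all_countable by blast
  then have "AE x in lebesgue. x \<notin> ball (0::'a) 1"
  proof eventually_elim
    case (elim x)
    show ?case
    proof
      assume "x \<in> ball 0 1"
      then have le: "L k \<le> u (T + 1) x" for k using elim by simp
      obtain k where "u (T + 1) x < D ^ k" using real_arch_pow[OF D(1)] by blast
      moreover have "D ^ k \<le> L k" using \<Lambda>(1) D(1) by (simp add: L_def)
      ultimately show False using le[of k] by linarith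
    qed
  qed
  then have "ball (0::'a) 1 \<in> null_sets lebesgue"
    by (subst AE_iff_null_sets) auto
  then have "measure lebesgue (ball (0::'a) 1) = 0"
    by (simp add: measure_eq_0_null_sets)
  moreover have "0 < measure lebesgue (ball (0::'a) 1)"
    using content_ball_pos[of 1 "0::'a"] by simp
  ultimately show False by simp
qed

text \<open>Subcriticality is \<open>\<epsilon> > 0\<close>, the gain in the exponent of a lower bound for \<open>u\<close> by one application of
  \<open>grows_step\<close>.\<close>

lemma no_global_solution:
  fixes u v :: "real \<Rightarrow> 'a::euclidean_space \<Rightarrow> real"
  assumes d: "DIM('a) \<le> 3"
    and duh_u: "\<And>t. t \<ge> 0 \<Longrightarrow> duhamel_solution (\<lambda>x. 0) u1 (power_nonlinearity \<alpha> p u v) t (u t)"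
    and duh_v: "\<And>t. t \<ge> 0 \<Longrightarrow> duhamel_solution (\<lambda>x. 0) v1 (power_nonlinearity q \<beta> u v) t (v t)"
    and lin: "diffuses u1" "diffuses v1"
    and ex: "1 \<le> \<alpha>" "0 < p" "0 < q" "1 \<le> \<beta>" and sub: "\<alpha> + p < 1 + 2 / real DIM('a)"
  shows False
proof -
  let ?n = "real DIM('a)"
  define \<epsilon> where "\<epsilon> = 1 - ?n * (\<alpha> + p - 1) / 2"
  have n: "?n > 0" by simp
  have \<epsilon>: "\<epsilon> > 0"
  proof -
    have "(\<alpha> + p - 1) * ?n < 2 / ?n * ?n" using sub n by (intro mult_strict_right_mono) auto
    then show ?thesis using n by (simp add: \<epsilon>_def mult.commute)
  qed
  have u0: "grows u (- ?n / 2)"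
    by (rule grows_linear[OF d power_nonlinearity_nonneg duh_u lin(1)])
  have v0: "grows v (- ?n / 2)"
    by (rule grows_linear[OF d power_nonlinearity_nonneg duh_v lin(2)])
  have uj: "grows u (- ?n / 2 + real j * \<epsilon>)" for j
  proof (induction j)
    case 0
    then show ?case using u0 by simp
  next
    case (Suc j)
    have "grows u (1 + (\<alpha> * (- ?n / 2 + real j * \<epsilon>) + p * (- ?n / 2)))"
      using ex by (intro grows_step[OF d power_nonlinearity_nonneg duh_u lin(1)] grows_power_nonlinearity Suc v0) auto
    moreover have "- ?n / 2 + real (Suc j) * \<epsilon> \<le> 1 + (\<alpha> * (- ?n / 2 + real j * \<epsilon>) + p * (- ?n / 2))"
    proof -
      have "1 * (real j * \<epsilon>) \<le> \<alpha> * (real j * \<epsilon>)" using ex \<epsilon> by (intro mult_right_mono) auto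
      moreover have "1 + (\<alpha> * (- ?n / 2 + real j * \<epsilon>) + p * (- ?n / 2)) = - ?n / 2 + \<epsilon> + \<alpha> * (real j * \<epsilon>)"
        by (simp add: \<epsilon>_def field_simps)
      ultimately show ?thesis by (simp add: distrib_right)
    qed
    ultimately show ?case by (rule grows_mono)
  qed
  have uN: "grows u N" for N
  proof -
    obtain j where "(N + ?n / 2) / \<epsilon> < real j" using reals_Archimedean2 by blast
    then have "N \<le> - ?n / 2 + real j * \<epsilon>" using \<epsilon> by (simp add: divide_less_eq)
    then show ?thesis using grows_mono[OF uj] by blast
  qed
  have "grows v (1 + (q * (\<beta> * ?n / (2 * q)) + \<beta> * (- ?n / 2)))"
    using ex by (intro grows_step[OF d power_nonlinearity_nonneg duh_v lin(2)] grows_power_nonlinearity uN v0) auto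
  moreover have "1 + (q * (\<beta> * ?n / (2 * q)) + \<beta> * (- ?n / 2)) = 1" using ex by simp
  ultimately have "grows v 1" by (simp only:)
  then show False
    using ex by (intro blowup[OF d duh_u duh_v lin _ _ _ _ _ _ uN]) auto
qed

theorem proposition4p2:
  fixes p q \<alpha> \<beta> :: real
    and u0 u1 v0 v1 :: "real ^ 'n \<Rightarrow> real"
  assumes "1 \<le> CARD('n)" "CARD('n) \<le> 3"
    and "p > 0" "q > 0" "\<alpha> \<ge> 1" "\<beta> \<ge> 1"
    and "u0 = (\<lambda>x. 0)" "v0 = (\<lambda>x. 0)"
    and "integrable lebesgue u1" "u1 \<in> H1"
    and "integrable lebesgue v1" "v1 \<in> H1"
    and "(\<integral>x. u1 x \<partial>lebesgue) > 0" "(\<integral>x. v1 x \<partial>lebesgue) > 0"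
    and "min (p + \<alpha>) (q + \<beta>) < 1 + 2 / real CARD('n)"
  shows "\<not> (\<exists>u v. global_mild_solution \<alpha> p q \<beta> u0 u1 v0 v1 u v)"
proof
  assume "\<exists>u v. global_mild_solution \<alpha> p q \<beta> u0 u1 v0 v1 u v"
  then obtain u v where sol: "global_mild_solution \<alpha> p q \<beta> u0 u1 v0 v1 u v" by blast
  have d: "DIM(real ^ 'n) \<le> 3" using assms(2) by simp
  have duh_u: "duhamel_solution (\<lambda>x. 0) u1 (power_nonlinearity \<alpha> p u v) t (u t)"
    and duh_v: "duhamel_solution (\<lambda>x. 0) v1 (power_nonlinearity q \<beta> u v) t (v t)" if "t \<ge> 0" for t
    using sol that assms(7,8) by (auto simp: mild_solution_def time_interval_def)
  have lin: "diffuses u1" "diffuses v1"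
    unfolding diffuses_def using linear_lower[OF d] assms(9-14) by auto
  have swap: "power_nonlinearity a b u v = power_nonlinearity b a v u" for a b
    by (simp add: power_nonlinearity_def fun_eq_iff mult.commute)
  show False
  proof (cases "\<alpha> + p < 1 + 2 / real CARD('n)")
    case True
    then show False
      using assms(3-6) by (intro no_global_solution[OF d duh_u duh_v lin]) auto
  next
    case False
    then have "\<beta> + q < 1 + 2 / real CARD('n)" using assms(15) by (auto simp: min_def add.commute split: if_splits)
    then show False
      using assms(3-6) by (intro no_global_solution[OF d duh_v[unfolded swap] duh_u[unfolded swap] lin(2,1)]) auto
  qed
qed

end
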